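(* Let $G$ be a finite group such that the comaximal subgroup graphs $\Gamma(G)$ and $\Gamma(A_5)$ are isomorphic as graphs, where $A_5$ is the alternating group on $5$ letters. Then $G\cong A_5$.
   Context: For a group $G$, the comaximal subgroup graph $\Gamma(G)$ is the simple undirected graph whose vertices are the non-trivial proper subgroups of $G$ (all subgroups $H$ with $H\neq\{e\}$ and $H\neq G$), where two distinct vertices $H$ and $K$ are adjacent if and only if $HK=G$, with $HK=\{hk: h\in H, k\in K\}$. *)

theory Defs
  imports
    "HOL-Algebra.Sym_Groups"
    "Graph_Theory.Pair_Digraph"
    "Graph_Theory.Digraph_Isomorphism"
begin

text \<open>
  An undirected simple graph is represented, as usual in \<^theory>\<open>Graph_Theory.Digraph\<close>,
  by a symmetric loop-free digraph without parallel arcs; each edge gives two arcs.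
\<close>

definition comaximal_subgroup_graph :: "('a, 'b) monoid_scheme \<Rightarrow> 'a set pair_pre_digraph" where
  "comaximal_subgroup_graph G =
    (let V = {H. subgroup H G \<and> H \<noteq> {\<one>\<^bsub>G\<^esub>} \<and> H \<noteq> carrier G}
     in \<lparr> pverts = V,
          parcs = {(H, K). H \<in> V \<and> K \<in> V \<and> H \<noteq> K \<and> H <#>\<^bsub>G\<^esub> K = carrier G} \<rparr>)"

lemma (in group) set_mult_eq_carrier_commute:
  assumes "subgroup H G" and "subgroup K G" and "H <#> K = carrier G"
  shows "K <#> H = carrier G"
proof -
  have sub: "H \<subseteq> carrier G" "K \<subseteq> carrier G"
    using assms subgroup.subset by blast+
  have "x \<in> K <#> H" if "x \<in> carrier G" for x
  proof -
    have "inv x \<in> H <#> K" using that assms(3) by simp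
    then obtain h k where hk: "h \<in> H" "k \<in> K" "inv x = h \<otimes> k"
      unfolding set_mult_def by blast
    have "x = inv (h \<otimes> k)" using hk(3) that by (metis inv_inv)
    also have "\<dots> = inv k \<otimes> inv h" using hk sub by (intro inv_mult_group) auto
    finally show ?thesis
      unfolding set_mult_def
      using hk subgroup.m_inv_closed[OF assms(1)] subgroup.m_inv_closed[OF assms(2)] by blast
  qed
  then show ?thesis using set_mult_closed[OF sub(2,1)] by blast
qed

lemma pair_graph_comaximal_subgroup_graph:
  assumes "group G" and "finite (carrier G)"
  shows "pair_graph (comaximal_subgroup_graph G)"
proof -
  interpret group G by fact
  let ?C = "comaximal_subgroup_graph G"
  have "pverts ?C \<subseteq> Pow (carrier G)"
    by (auto simp: comaximal_subgroup_graph_def Let_def dest: subgroup.subset)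
  then have fin: "finite (pverts ?C)"
    using assms(2) by (meson finite_Pow_iff finite_subset)
  have arcs: "parcs ?C \<subseteq> pverts ?C \<times> pverts ?C"
    by (auto simp: comaximal_subgroup_graph_def Let_def)
  then have fin': "finite (parcs ?C)" using fin by (meson finite_SigmaI finite_subset)
  have sym: "sym (parcs ?C)"
  proof (rule symI)
    fix H K assume "(H, K) \<in> parcs ?C"
    then show "(K, H) \<in> parcs ?C"
      using set_mult_eq_carrier_commute[of H K]
      unfolding comaximal_subgroup_graph_def Let_def by auto
  qed
  show ?thesis
  proof
    fix e assume e: "e \<in> parcs ?C"
    show "fst e \<in> pverts ?C" "snd e \<in> pverts ?C" using e arcs by auto
    show "fst e \<noteq> snd e" using e unfolding comaximal_subgroup_graph_def Let_def by auto
  next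
    show "symmetric (with_proj ?C)" unfolding symmetric_def with_proj_simps by (rule sym)
  qed (rule fin fin')+
qed

lemma digraph_iso_with_proj_iff:
  assumes "pair_wf_digraph A" and "pair_wf_digraph B"
  shows "digraph_iso (with_proj A) (with_proj B) \<longleftrightarrow>
    (\<exists>f. bij_betw f (pverts A) (pverts B) \<and>
      (\<forall>u\<in>pverts A. \<forall>v\<in>pverts A. (u, v) \<in> parcs A \<longleftrightarrow> (f u, f v) \<in> parcs B))"
    (is "?L \<longleftrightarrow> ?R")
proof -
  interpret A: pair_wf_digraph A by fact
  interpret B: pair_wf_digraph B by fact
  show ?thesis
  proof
    assume ?L
    then obtain h where h: "pre_digraph.digraph_isomorphism (with_proj A) h"
      and B: "with_proj B = app_iso h (with_proj A)"
      unfolding digraph_iso_def by blast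
    let ?f = "iso_verts h" and ?g = "iso_arcs h"
    have V: "pverts B = ?f ` pverts A" and E: "parcs B = ?g ` parcs A"
      and t: "iso_tail h = fst" and hd: "iso_head h = snd"
      using B by (auto simp: with_proj_def app_iso_def)
    have inj: "inj_on ?f (pverts A)"
      and g: "\<And>a. a \<in> parcs A \<Longrightarrow> ?g a = (?f (fst a), ?f (snd a))"
      using h unfolding pre_digraph.digraph_isomorphism_def t hd by (auto simp: prod_eq_iff)
    have "(u, v) \<in> parcs A" if "u \<in> pverts A" "v \<in> pverts A" "(?f u, ?f v) \<in> parcs B" for u v
    proof -
      from that(3) obtain a where a: "a \<in> parcs A" "(?f u, ?f v) = ?g a" unfolding E by blast
      have "?f u = ?f (fst a)" "?f v = ?f (snd a)" using g[OF a(1)] a(2) by simp_all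
      then have "fst a = u" "snd a = v"
        using A.arc_fst_in_verts[OF a(1)] A.arc_snd_in_verts[OF a(1)] that(1,2)
          inj_onD[OF inj] by metis+
      with a(1) show ?thesis by (metis prod.collapse)
    qed
    moreover have "(?f u, ?f v) \<in> parcs B" if "(u, v) \<in> parcs A" for u v
      using g[OF that] that unfolding E by (metis fst_conv image_eqI snd_conv)
    ultimately show ?R using V inj unfolding bij_betw_def by blast
  next
    assume ?R
    then obtain f where f: "inj_on f (pverts A)" "pverts B = f ` pverts A"
      and e: "\<And>u v. u \<in> pverts A \<Longrightarrow> v \<in> pverts A \<Longrightarrow> (u, v) \<in> parcs A \<longleftrightarrow> (f u, f v) \<in> parcs B"
      unfolding bij_betw_def by blast
    let ?h = "\<lparr> iso_verts = f, iso_arcs = map_prod f f, iso_head = snd, iso_tail = fst \<rparr>"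
    have E: "parcs B = map_prod f f ` parcs A"
    proof (intro equalityI subsetI)
      fix a assume a: "a \<in> parcs B"
      obtain u v where uv: "u \<in> pverts A" "v \<in> pverts A" "a = (f u, f v)"
        using B.arc_fst_in_verts[OF a] B.arc_snd_in_verts[OF a] unfolding f(2)
        by (metis (no_types, lifting) imageE prod.collapse)
      then show "a \<in> map_prod f f ` parcs A" using e a by force
    next
      fix a assume "a \<in> map_prod f f ` parcs A"
      then obtain u v where "(u, v) \<in> parcs A" "a = (f u, f v)" by auto
      then show "a \<in> parcs B" using e[of u v] A.in_arcsD1 A.in_arcsD2 by blast
    qed
    have "inj_on (map_prod f f) (parcs A)"
      using map_prod_inj_on[OF f(1) f(1)]
      by (rule inj_on_subset) (auto dest: A.wellformed')
    then have "pre_digraph.digraph_isomorphism (with_proj A) ?h"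
      unfolding pre_digraph.digraph_isomorphism_def
      using f(1) A.wf_digraph by auto
    moreover have "with_proj B = app_iso ?h (with_proj A)"
      by (simp add: with_proj_def app_iso_def f(2) E)
    ultimately show ?L unfolding digraph_iso_def by blast
  qed
qed

end

theory Submission
  imports Defs "HOL-Algebra.Sylow" "HOL-Algebra.Multiplicative_Group" "HOL-Number_Theory.Cong"
begin

text \<open>
  Write $V$ for the set of non-trivial proper subgroups.  In $A_5$ the subgroups of order 12 are the
  five point stabilizers, and a proper subgroup whose order is divisible by 5 has order 5 or 10; there
  are twelve of these.  Two members of $V$ multiply to $A_5$ exactly if one is of the first and the other
  of the second kind.  So the graph is a complete bipartite graph $K_{5,12}$ together with isolated
  vertices.  A subgroup of order 5 acts on the isolated vertices without fixed points, hence their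
  number is divisible by 5, and counting those of orders 2, 3 and 4 shows that there are at least 20.
  The locale \<open>bipartite_comax\<close> collects these properties of the graph; an isomorphism of graphs
  carries them over to $G$.  The theorem is then a statement about such a group $G$.

  The first half shows that $G$ has no normal subgroup $M$ of prime index $p$ (lemma
  \<open>no_prime_index_normal\<close>).  Such an $M$ satisfies $MK = G$ for all $K$ outside $M$, so one part
  $Y$ of the bipartite graph consists of all proper subgroups that are not inside $M$.  It is closed
  under conjugation and under passing to larger proper subgroups, it has at most 12 members, and no two
  of its members multiply to $G$.  Everything follows from these restrictions.  A normal member of $Y$
  would make $G$ cyclic or produce a perfect quotient with too many Sylow subgroups
  (\<open>normal_sub_M\<close>), so every member of $Y$ has at least $p+1$ conjugates.  A maximal subgroup $N$
  containing a Sylow $p$-subgroup has index at most 12.  If the index is a power of a prime $q$, then a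
  Sylow $q$-subgroup $Q$ multiplies with $N$ to $G$, hence lies in the part opposite to $Y$, hence
  multiplies to $G$ with all of $Y$; this makes $Q$ normal with a cyclic complement of $p$-power
  order.  The indices 6, 10 and 12 give too many classes (\<open>cyclic_sylow_complement\<close>).  The classes
  in $Y$ now have sizes that are powers of $q$, add up to 5 or 12, and are at least $p+1$.
  If $Y$ has 12 members, this forces the $p$-th power of a generator of the complement to be central,
  and then $M$ is a direct product in which the isolated vertices number $-1$ modulo 5
  (\<open>direct_product_impossible\<close>).  If $Y$ has 5 members, there are at most 16 isolated vertices.

  In the second half a maximal subgroup $N$ containing a member of the part of size 5 has all its
  conjugates in this part.  As $N$ is not normal and no subgroup has index 2, 3 or 4
  (\<open>no_small_index\<close>), there are five conjugates, and conjugation gives a homomorphism from $G$ to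
  permutations of five points.  All permutations in the image are even, and the image has order
  divisible by 5; a proper such subgroup of $A_5$ has order 5 or 10 and would give a normal subgroup of
  prime index.  So $G$ maps onto $A_5$.  Both groups have the same number of subgroups, because
  the graphs have the same number of vertices, and therefore the kernel is trivial.
\<close>

section \<open>Finite group actions\<close>

lemma card_eq_sum_fibres:
  assumes "finite A"
  shows "card A = (\<Sum>y\<in>f ` A. card {x \<in> A. f x = y})"
  using sum.image_gen[OF assms, of "\<lambda>_. 1::nat" f] by simp

text \<open>
  Only the restriction of \<open>f\<close> to \<open>R\<close> and \<open>E\<close> matters, so that the same function, conjugation or
  translation, can be used for every subgroup and every invariant family.
\<close>
definition acts :: "('a, 'c) monoid_scheme \<Rightarrow> 'a set \<Rightarrow> 'b set \<Rightarrow> ('a \<Rightarrow> 'b \<Rightarrow> 'b) \<Rightarrow> bool" where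
  "acts G R E f \<longleftrightarrow> subgroup R G \<and> finite R \<and> finite E \<and>
     (\<forall>g\<in>R. \<forall>e\<in>E. f g e \<in> E) \<and> (\<forall>e\<in>E. f \<one>\<^bsub>G\<^esub> e = e) \<and>
     (\<forall>g\<in>R. \<forall>h\<in>R. \<forall>e\<in>E. f (g \<otimes>\<^bsub>G\<^esub> h) e = f g (f h e))"

context group
begin

lemma actsD:
  assumes "acts G R E f"
  shows "subgroup R G" "finite R" "finite E" "\<And>g e. g \<in> R \<Longrightarrow> e \<in> E \<Longrightarrow> f g e \<in> E"
    "\<And>e. e \<in> E \<Longrightarrow> f \<one> e = e"
    "\<And>g h e. g \<in> R \<Longrightarrow> h \<in> R \<Longrightarrow> e \<in> E \<Longrightarrow> f (g \<otimes> h) e = f g (f h e)"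
  using assms unfolding acts_def by blast+

lemma acts_cancel:
  assumes a: "acts G R E f" and "g \<in> R" "e \<in> E"
  shows "f (inv g) (f g e) = e" "f g (f (inv g) e) = e"
proof -
  note d = actsD[OF a]
  have gi: "inv g \<in> R" "g \<in> carrier G" using assms d(1) subgroup.m_inv_closed subgroup.mem_carrier by metis+
  show "f (inv g) (f g e) = e" using d(5,6) gi assms by (metis l_inv)
  show "f g (f (inv g) e) = e" using d(5,6) gi assms by (metis r_inv)
qed

text \<open>
  All fibres of the orbit map are translates of the stabilizer.
\<close>
lemma orbit_stabilizer:
  assumes a: "acts G R E f" and e: "e \<in> E"
  shows "card ((\<lambda>g. f g e) ` R) * card {g \<in> R. f g e = e} = card R"
proof -
  note d = actsD[OF a]
  have "card {g \<in> R. f g e = y} = card {g \<in> R. f g e = e}" if y: "y \<in> (\<lambda>g. f g e) ` R" for y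
  proof -
    obtain g0 where g0: "g0 \<in> R" "y = f g0 e" using y by blast
    have c: "g0 \<in> carrier G" "inv g0 \<in> R" "\<And>g. g \<in> R \<Longrightarrow> g \<in> carrier G"
      using g0 d(1) subgroup.mem_carrier subgroup.m_inv_closed by metis+
    have "bij_betw (\<lambda>g. g0 \<otimes> g) {g \<in> R. f g e = e} {g \<in> R. f g e = y}"
    proof (rule bij_betw_byWitness[where f' = "\<lambda>g. inv g0 \<otimes> g"])
      show "\<forall>g\<in>{g \<in> R. f g e = e}. inv g0 \<otimes> (g0 \<otimes> g) = g"
        using c by (simp add: m_assoc[symmetric])
      show "\<forall>g\<in>{g \<in> R. f g e = y}. g0 \<otimes> (inv g0 \<otimes> g) = g"
        using c by (simp add: m_assoc[symmetric])
      show "(\<otimes>) g0 ` {g \<in> R. f g e = e} \<subseteq> {g \<in> R. f g e = y}"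
        using g0 d(6)[OF g0(1) _ e] subgroup.m_closed[OF d(1)] by auto
      show "(\<otimes>) (inv g0) ` {g \<in> R. f g e = y} \<subseteq> {g \<in> R. f g e = e}"
        using g0 d(6)[OF c(2) _ e] subgroup.m_closed[OF d(1)] c acts_cancel[OF a g0(1) e] by auto
    qed
    then show ?thesis by (rule bij_betw_same_card[symmetric])
  qed
  then have "card R = (\<Sum>y\<in>(\<lambda>g. f g e) ` R. card {g \<in> R. f g e = e})"
    using card_eq_sum_fibres[OF d(2), of "\<lambda>g. f g e"] by simp
  then show ?thesis by simp
qed

lemma orbit_refl: "acts G R E f \<Longrightarrow> e \<in> E \<Longrightarrow> e \<in> (\<lambda>g. f g e) ` R"
  by (metis actsD(1,5) image_eqI subgroup.one_closed)

lemma orbit_eq: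
  assumes a: "acts G R E f" and e: "e \<in> E" and y: "y \<in> (\<lambda>g. f g e) ` R"
  shows "(\<lambda>g. f g y) ` R = (\<lambda>g. f g e) ` R"
proof -
  note d = actsD[OF a]
  have sub: "(\<lambda>g. f g y) ` R \<subseteq> (\<lambda>g. f g e) ` R" if e: "e \<in> E" and y: "y \<in> (\<lambda>g. f g e) ` R" for e y
  proof -
    obtain g0 where "g0 \<in> R" "y = f g0 e" using y by blast
    then have "f g y = f (g \<otimes> g0) e" "g \<otimes> g0 \<in> R" if "g \<in> R" for g
      using d(6)[OF that _ e] subgroup.m_closed[OF d(1) that] by auto
    then show ?thesis by blast
  qed
  obtain g0 where g0: "g0 \<in> R" "y = f g0 e" using y by blast
  have "y \<in> E" using g0 d(4) e by simp
  moreover have "e \<in> (\<lambda>g. f g y) ` R"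
    using acts_cancel(1)[OF a g0(1) e] g0 subgroup.m_inv_closed[OF d(1)] by (metis image_eqI)
  ultimately show ?thesis using sub e y by blast
qed

text \<open>
  The orbits partition \<open>E\<close>.
\<close>
lemma orbits_dvd_card:
  assumes a: "acts G R E f" and dv: "\<And>e. e \<in> E \<Longrightarrow> d dvd card ((\<lambda>g. f g e) ` R)"
  shows "d dvd card E"
proof -
  let ?o = "\<lambda>e. (\<lambda>g. f g e) ` R"
  have "card {x \<in> E. ?o x = y} = card y" if yin: "y \<in> ?o ` E" for y
  proof -
    obtain e where e: "e \<in> E" "y = ?o e" using yin by blast
    have "{x \<in> E. ?o x = y} = y"
    proof (intro equalityI subsetI)
      fix x assume "x \<in> {x \<in> E. ?o x = y}"
      then show "x \<in> y" using orbit_refl[OF a, of x] by simp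
    next
      fix x assume x: "x \<in> y"
      then have "?o x = y" using orbit_eq[OF a e(1), of x] e(2) by simp
      moreover have "x \<in> E" using x e actsD(4)[OF a] by auto
      ultimately show "x \<in> {x \<in> E. ?o x = y}" by simp
    qed
    then show ?thesis by simp
  qed
  then have "d dvd card {x \<in> E. ?o x = y}" if "y \<in> ?o ` E" for y using that dv by force
  then show ?thesis using card_eq_sum_fibres[OF actsD(3)[OF a], of ?o] by (simp add: dvd_sum)
qed

text \<open>
  Orbits outside the fixed points have a size that divides a power of \<open>p\<close> and is not 1.
\<close>
lemma p_group_fixed_points:
  assumes a: "acts G R E f" and p: "prime p" and R: "card R = p ^ k"
  shows "card E mod p = card {e \<in> E. \<forall>g\<in>R. f g e = e} mod p"
proof -
  note d = actsD[OF a]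
  define F where "F = {e \<in> E. \<forall>g\<in>R. f g e = e}"
  have F: "F \<subseteq> E" "\<And>g e. g \<in> R \<Longrightarrow> e \<in> F \<Longrightarrow> f g e = e"
    "\<And>e. e \<in> E \<Longrightarrow> (\<And>g. g \<in> R \<Longrightarrow> f g e = e) \<Longrightarrow> e \<in> F"
    unfolding F_def by auto
  have mv: "f g e \<in> E - F" if g: "g \<in> R" and e: "e \<in> E - F" for g e
  proof -
    have gi: "inv g \<in> R" using subgroup.m_inv_closed[OF d(1) g] .
    have "f g e \<notin> F"
    proof
      assume *: "f g e \<in> F"
      from F(2)[OF gi *] have "f g e = e" using acts_cancel(1)[OF a g] e by simp
      then show False using * e by simp
    qed
    then show ?thesis using d(4)[OF g] e by simp
  qed
  have a': "acts G R (E - F) f"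
    unfolding acts_def using d mv by auto
  have "p dvd card ((\<lambda>g. f g e) ` R)" if e: "e \<in> E - F" for e
  proof -
    have "card ((\<lambda>g. f g e) ` R) dvd p ^ k"
      unfolding R[symmetric] using orbit_stabilizer[OF a' e] by (intro dvdI[of _ _ "card {g \<in> R. f g e = e}"]) simp
    moreover have "card ((\<lambda>g. f g e) ` R) \<noteq> 1"
    proof
      assume "card ((\<lambda>g. f g e) ` R) = 1"
      then obtain z where z: "(\<lambda>g. f g e) ` R = {z}" using card_1_singletonE by blast
      have "e = z" using orbit_refl[OF a'  e] z by simp
      then have "f g e = e" if "g \<in> R" for g
        using z that by blast
      then show False using F(3) e by blast
    qed
    moreover from calculation(1) obtain j where j: "card ((\<lambda>g. f g e) ` R) = p ^ j"
      using divides_primepow_nat[OF p] by blast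
    ultimately have "j \<noteq> 0" by (intro notI) simp
    then show ?thesis using j by simp
  qed
  then have "p dvd card (E - F)" by (rule orbits_dvd_card[OF a'])
  moreover have "card E = card (E - F) + card F"
    using card_Diff_subset[OF finite_subset[OF F(1) d(3)] F(1)] card_mono[OF d(3) F(1)] by linarith
  ultimately obtain c where "card E = p * c + card F" by (metis dvdE)
  then have "card E mod p = card F mod p" by simp
  then show ?thesis unfolding F_def .
qed

end

section \<open>Conjugates, normalizers and products of subgroups\<close>

context group
begin

definition conjg :: "'a \<Rightarrow> 'a set \<Rightarrow> 'a set" where
  "conjg g H = (\<lambda>h. g \<otimes> h \<otimes> inv g) ` H"

definition Normalizer :: "'a set \<Rightarrow> 'a set" where
  "Normalizer H = {g \<in> carrier G. conjg g H = H}"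

definition conj_class :: "'a set \<Rightarrow> 'a set set" where
  "conj_class H = (\<lambda>g. conjg g H) ` carrier G"

lemma conjg_one: "H \<subseteq> carrier G \<Longrightarrow> conjg \<one> H = H"
proof -
  assume "H \<subseteq> carrier G"
  then have "\<one> \<otimes> h \<otimes> inv \<one> = h" if "h \<in> H" for h using that by auto
  then show ?thesis unfolding conjg_def by simp
qed

lemma conjg_mult:
  assumes "g \<in> carrier G" "h \<in> carrier G" "H \<subseteq> carrier G"
  shows "conjg (g \<otimes> h) H = conjg g (conjg h H)"
proof -
  have "(g \<otimes> h) \<otimes> x \<otimes> inv (g \<otimes> h) = g \<otimes> (h \<otimes> x \<otimes> inv h) \<otimes> inv g" if "x \<in> H" for x
    using assms that by (auto simp: m_assoc inv_mult_group)
  then show ?thesis unfolding conjg_def image_image by (simp cong: image_cong)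
qed

lemma conjg_subset: "g \<in> carrier G \<Longrightarrow> H \<subseteq> carrier G \<Longrightarrow> conjg g H \<subseteq> carrier G"
  unfolding conjg_def by auto

lemma conjg_mono: "H \<subseteq> K \<Longrightarrow> conjg g H \<subseteq> conjg g K"
  unfolding conjg_def by auto

lemma conjg_inv:
  assumes "g \<in> carrier G" "H \<subseteq> carrier G"
  shows "conjg (inv g) (conjg g H) = H" "conjg g (conjg (inv g) H) = H"
  using assms conjg_mult[of "inv g" g H] conjg_mult[of g "inv g" H] conjg_one by auto

lemma inj_conjg: "g \<in> carrier G \<Longrightarrow> H \<subseteq> carrier G \<Longrightarrow> inj_on (\<lambda>h. g \<otimes> h \<otimes> inv g) H"
  by (rule inj_onI) (metis inv_closed Units_eq Units_l_cancel m_closed right_cancel subsetD)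

lemma card_conjg: "g \<in> carrier G \<Longrightarrow> H \<subseteq> carrier G \<Longrightarrow> card (conjg g H) = card H"
  unfolding conjg_def by (rule card_image[OF inj_conjg])

lemma conjg_subgroup:
  assumes g: "g \<in> carrier G" and H: "subgroup H G"
  shows "subgroup (conjg g H) G"
proof (rule subgroupI)
  have c: "H \<subseteq> carrier G" using H subgroup.subset by blast
  show "conjg g H \<subseteq> carrier G" using conjg_subset[OF g c] .
  show "conjg g H \<noteq> {}" using subgroup.one_closed[OF H] unfolding conjg_def by auto
  fix a assume "a \<in> conjg g H"
  then obtain h where h: "h \<in> H" "a = g \<otimes> h \<otimes> inv g" unfolding conjg_def by auto
  have hc: "h \<in> carrier G" using h c by blast
  have "inv a = g \<otimes> inv h \<otimes> inv g" using h hc g by (simp add: inv_mult_group m_assoc)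
  then show "inv a \<in> conjg g H" using subgroup.m_inv_closed[OF H h(1)] unfolding conjg_def by auto
  fix b assume "b \<in> conjg g H"
  then obtain k where k: "k \<in> H" "b = g \<otimes> k \<otimes> inv g" unfolding conjg_def by auto
  have kc: "k \<in> carrier G" using k c by blast
  have "a \<otimes> b = g \<otimes> h \<otimes> (inv g \<otimes> (g \<otimes> (k \<otimes> inv g)))"
    using h k hc kc g by (simp add: m_assoc)
  also have "\<dots> = g \<otimes> h \<otimes> (k \<otimes> inv g)" using hc kc g by (simp add: m_assoc[symmetric])
  also have "\<dots> = g \<otimes> (h \<otimes> k) \<otimes> inv g" using hc kc g by (simp add: m_assoc)
  finally show "a \<otimes> b \<in> conjg g H" using subgroup.m_closed[OF H h(1) k(1)] unfolding conjg_def by auto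
qed

lemma conjg_self:
  assumes H: "subgroup H G" and g: "g \<in> H"
  shows "conjg g H = H"
proof -
  have sub: "conjg x H \<subseteq> H" if "x \<in> H" for x
    unfolding conjg_def using that subgroup.m_closed[OF H] subgroup.m_inv_closed[OF H] by auto
  have c: "H \<subseteq> carrier G" "g \<in> carrier G" using H g subgroup.subset by blast+
  have "conjg g (conjg (inv g) H) \<subseteq> conjg g H"
    by (rule conjg_mono[OF sub[OF subgroup.m_inv_closed[OF H g]]])
  then show ?thesis using conjg_inv(2)[OF c(2,1)] sub[OF g] by simp
qed

lemma Normalizer_subgroup:
  assumes "H \<subseteq> carrier G" shows "subgroup (Normalizer H) G"
proof (rule subgroupI)
  show "Normalizer H \<subseteq> carrier G" "Normalizer H \<noteq> {}" using conjg_one[OF assms] unfolding Normalizer_def by auto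
  fix a assume a: "a \<in> Normalizer H"
  then show "inv a \<in> Normalizer H" using conjg_inv(1)[of a H] assms unfolding Normalizer_def by auto
  fix b assume "b \<in> Normalizer H"
  then show "a \<otimes> b \<in> Normalizer H" using a conjg_mult[of a b H] assms unfolding Normalizer_def by auto
qed

lemma subset_Normalizer: "subgroup H G \<Longrightarrow> H \<subseteq> Normalizer H"
  using conjg_self subgroup.subset unfolding Normalizer_def by blast

lemma NormalizerD: "g \<in> Normalizer H \<Longrightarrow> g \<in> carrier G" "g \<in> Normalizer H \<Longrightarrow> conjg g H = H"
  unfolding Normalizer_def by auto

lemma normal_iff_conjg:
  assumes "subgroup H G"
  shows "H \<lhd> G \<longleftrightarrow> (\<forall>g\<in>carrier G. conjg g H = H)"
proof
  assume "H \<lhd> G"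
  then have sub: "conjg g H \<subseteq> H" if "g \<in> carrier G" for g
    using that unfolding conjg_def normal_inv_iff by auto
  have c: "H \<subseteq> carrier G" using assms subgroup.subset by blast
  show "\<forall>g\<in>carrier G. conjg g H = H"
  proof
    fix g assume g: "g \<in> carrier G"
    have "conjg g (conjg (inv g) H) \<subseteq> conjg g H" by (rule conjg_mono[OF sub]) (use g in simp)
    then show "conjg g H = H" using sub[OF g] conjg_inv(2)[OF g c] by simp
  qed
next
  assume *: "\<forall>g\<in>carrier G. conjg g H = H"
  have "g \<otimes> h \<otimes> inv g \<in> H" if "g \<in> carrier G" "h \<in> H" for g h
    using *[rule_format, OF that(1)] that(2) unfolding conjg_def by blast
  then show "H \<lhd> G" unfolding normal_inv_iff using assms by blast
qed

lemma normal_iff_Normalizer: "subgroup H G \<Longrightarrow> H \<lhd> G \<longleftrightarrow> Normalizer H = carrier G"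
  unfolding normal_iff_conjg Normalizer_def by blast

lemma self_in_conj_class: "H \<subseteq> carrier G \<Longrightarrow> H \<in> conj_class H"
  unfolding conj_class_def using conjg_one by (metis image_eqI one_closed)

lemma conj_class_subgroup: "subgroup H G \<Longrightarrow> K \<in> conj_class H \<Longrightarrow> subgroup K G"
  unfolding conj_class_def using conjg_subgroup by blast

lemma conj_class_card: "H \<subseteq> carrier G \<Longrightarrow> K \<in> conj_class H \<Longrightarrow> card K = card H"
  unfolding conj_class_def using card_conjg by blast

lemma conj_class_conjg:
  assumes "H \<subseteq> carrier G" "K \<in> conj_class H" "g \<in> carrier G" shows "conjg g K \<in> conj_class H"
proof -
  obtain h where "h \<in> carrier G" "K = conjg h H" using assms unfolding conj_class_def by blast
  then show ?thesis using conjg_mult[of g h H] assms unfolding conj_class_def by (metis image_eqI m_closed)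
qed

text \<open>
  The fibres of multiplication from \<open>H \<times> K\<close> are torsors of the intersection \<open>H \<inter> K\<close>.
\<close>
lemma set_mult_inter_card:
  assumes H: "subgroup H G" and K: "subgroup K G" and fin: "finite H" "finite K"
  shows "card (H <#> K) * card (H \<inter> K) = card H * card K"
proof -
  let ?m = "\<lambda>(h, k). h \<otimes> k"
  have Hc: "h \<in> carrier G" if "h \<in> H" for h using that subgroup.mem_carrier[OF H] by simp
  have Kc: "h \<in> carrier G" if "h \<in> K" for h using that subgroup.mem_carrier[OF K] by simp
  have img: "?m ` (H \<times> K) = H <#> K" unfolding set_mult_def by auto
  have "card {x \<in> H \<times> K. ?m x = y} = card (H \<inter> K)" if y: "y \<in> H <#> K" for y
  proof -
    obtain a b where ab: "a \<in> H" "b \<in> K" "y = a \<otimes> b" using y unfolding set_mult_def by blast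
    have "bij_betw (\<lambda>t. (a \<otimes> t, inv t \<otimes> b)) (H \<inter> K) {x \<in> H \<times> K. ?m x = y}"
    proof (rule bij_betw_byWitness[where f' = "\<lambda>(h, k). inv a \<otimes> h"])
      show "\<forall>t\<in>H \<inter> K. (\<lambda>(h, k). inv a \<otimes> h) (a \<otimes> t, inv t \<otimes> b) = t"
        using ab Hc by (simp add: m_assoc[symmetric])
      have "(a \<otimes> (inv a \<otimes> h), inv (inv a \<otimes> h) \<otimes> b) = (h, k)" if "h \<in> H" "k \<in> K" "h \<otimes> k = y" for h k
      proof -
        have c: "a \<in> carrier G" "b \<in> carrier G" "h \<in> carrier G" "k \<in> carrier G" using ab that Hc Kc by auto
        have "inv (inv a \<otimes> h) \<otimes> b = inv h \<otimes> (a \<otimes> b)" using c by (simp add: inv_mult_group m_assoc)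
        also have "\<dots> = inv h \<otimes> (h \<otimes> k)" using that(3) ab(3) by simp
        also have "\<dots> = k" using c by (simp add: m_assoc[symmetric])
        finally show ?thesis using c by (simp add: m_assoc[symmetric])
      qed
      then show "\<forall>x\<in>{x \<in> H \<times> K. ?m x = y}. (a \<otimes> (case x of (h, k) \<Rightarrow> inv a \<otimes> h),
          inv (case x of (h, k) \<Rightarrow> inv a \<otimes> h) \<otimes> b) = x" by auto
      have "a \<otimes> t \<otimes> (inv t \<otimes> b) = y" if "t \<in> H \<inter> K" for t
      proof -
        have "a \<otimes> t \<otimes> (inv t \<otimes> b) = a \<otimes> (t \<otimes> inv t) \<otimes> b"
          using Hc[of a] Kc[of b] Hc[of t] ab that by (simp only: m_assoc inv_closed m_closed IntD1)
        then show ?thesis using Hc[of a] Kc[of b] Hc[of t] ab that by (simp add: r_inv)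
      qed
      then show "(\<lambda>t. (a \<otimes> t, inv t \<otimes> b)) ` (H \<inter> K) \<subseteq> {x \<in> H \<times> K. ?m x = y}"
        using ab subgroup.m_closed[OF H] subgroup.m_closed[OF K] subgroup.m_inv_closed[OF K] by auto
      have "inv a \<otimes> h \<in> H \<inter> K" if "h \<in> H" "k \<in> K" "h \<otimes> k = y" for h k
      proof -
        have c: "a \<in> carrier G" "b \<in> carrier G" "h \<in> carrier G" "k \<in> carrier G" using ab that Hc Kc by auto
        have "h = a \<otimes> b \<otimes> inv k" using that(3) ab(3) c
          by (metis inv_closed inv_solve_right' m_closed)
        then have "inv a \<otimes> h = b \<otimes> inv k" using c by (simp add: m_assoc[symmetric])
        then show ?thesis
          using subgroup.m_closed[OF H] subgroup.m_inv_closed[OF H] subgroup.m_closed[OF K]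
            subgroup.m_inv_closed[OF K] ab that by (metis IntI)
      qed
      then show "(\<lambda>(h, k). inv a \<otimes> h) ` {x \<in> H \<times> K. ?m x = y} \<subseteq> H \<inter> K" by auto
    qed
    then show ?thesis by (rule bij_betw_same_card[symmetric])
  qed
  then have "card (H \<times> K) = (\<Sum>y\<in>H <#> K. card (H \<inter> K))"
    using card_eq_sum_fibres[of "H \<times> K" ?m] fin img by simp
  then show ?thesis by (simp add: card_cartesian_product)
qed

lemma normalizing_mult_subgroup:
  assumes H: "subgroup H G" and K: "subgroup K G" and n: "H \<subseteq> Normalizer K"
  shows "subgroup (H <#> K) G"
proof (rule subgroupI)
  have Hc: "h \<in> carrier G" if "h \<in> H" for h using that subgroup.mem_carrier[OF H] by simp
  have Kc: "h \<in> carrier G" if "h \<in> K" for h using that subgroup.mem_carrier[OF K] by simp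
  have cj: "inv h \<otimes> k \<otimes> h \<in> K" if "h \<in> H" "k \<in> K" for h k
  proof -
    have "inv h \<in> H" using that subgroup.m_inv_closed[OF H] by simp
    then have "conjg (inv h) K = K" using NormalizerD(2) n by blast
    then have "inv h \<otimes> k \<otimes> inv (inv h) \<in> K" unfolding conjg_def using that by blast
    then show ?thesis using Hc that by simp
  qed
  show "H <#> K \<subseteq> carrier G" unfolding set_mult_def using Hc Kc by auto
  show "H <#> K \<noteq> {}" unfolding set_mult_def
    using subgroup.one_closed[OF H] subgroup.one_closed[OF K] by auto
  fix a assume "a \<in> H <#> K"
  then obtain h k where hk: "h \<in> H" "k \<in> K" "a = h \<otimes> k" unfolding set_mult_def by blast
  have "inv a = inv h \<otimes> (inv (inv h) \<otimes> inv k \<otimes> inv h)"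
    using hk Hc[of h] Kc[of k] by (simp add: inv_mult_group m_assoc[symmetric])
  moreover have "inv (inv h) \<otimes> inv k \<otimes> inv h \<in> K"
    using cj[of "inv h" "inv k"] hk subgroup.m_inv_closed[OF H] subgroup.m_inv_closed[OF K] by simp
  ultimately show "inv a \<in> H <#> K" unfolding set_mult_def
    using hk subgroup.m_inv_closed[OF H] by blast
  fix b assume "b \<in> H <#> K"
  then obtain h' k' where hk': "h' \<in> H" "k' \<in> K" "b = h' \<otimes> k'" unfolding set_mult_def by blast
  have c: "h \<in> carrier G" "k \<in> carrier G" "h' \<in> carrier G" "k' \<in> carrier G" using hk hk' Hc Kc by auto
  have "a \<otimes> b = h \<otimes> h' \<otimes> (inv h' \<otimes> k \<otimes> h' \<otimes> k')"
  proof -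
    have "h \<otimes> h' \<otimes> (inv h' \<otimes> k \<otimes> h' \<otimes> k') = h \<otimes> (h' \<otimes> (inv h' \<otimes> (k \<otimes> (h' \<otimes> k'))))"
      using c by (simp add: m_assoc)
    also have "\<dots> = h \<otimes> (k \<otimes> (h' \<otimes> k'))" using c by (simp add: m_assoc[symmetric])
    finally show ?thesis using c hk(3) hk'(3) by (simp add: m_assoc)
  qed
  moreover have "inv h' \<otimes> k \<otimes> h' \<otimes> k' \<in> K" using cj[OF hk'(1) hk(2)] hk' subgroup.m_closed[OF K] by blast
  ultimately show "a \<otimes> b \<in> H <#> K" unfolding set_mult_def
    using subgroup.m_closed[OF H hk(1) hk'(1)] by blast
qed

lemma subset_set_mult:
  assumes "subgroup H G" "subgroup K G" shows "H \<subseteq> H <#> K" "K \<subseteq> H <#> K"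
proof -
  show "H \<subseteq> H <#> K"
  proof
    fix h assume "h \<in> H"
    then have "h = h \<otimes> \<one>" using subgroup.mem_carrier[OF assms(1)] by simp
    then show "h \<in> H <#> K" unfolding set_mult_def using \<open>h \<in> H\<close> subgroup.one_closed[OF assms(2)] by blast
  qed
  show "K \<subseteq> H <#> K"
  proof
    fix h assume "h \<in> K"
    then have "h = \<one> \<otimes> h" using subgroup.mem_carrier[OF assms(2)] by simp
    then show "h \<in> H <#> K" unfolding set_mult_def using \<open>h \<in> K\<close> subgroup.one_closed[OF assms(1)] by blast
  qed
qed

end

section \<open>Sylow's theorems relative to a subgroup\<close>

locale fin_group = group +
  assumes fin: "finite (carrier G)"
begin

lemma sub_carrier: "subgroup H G \<Longrightarrow> H \<subseteq> carrier G"
  by (rule subgroup.subset)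

lemma fin_sub: "subgroup H G \<Longrightarrow> finite H"
  using fin sub_carrier finite_subset by blast

lemma card_pos: "subgroup H G \<Longrightarrow> card H > 0"
  using fin_sub subgroup.one_closed card_gt_0_iff by blast

lemma sub_eq_card: "H \<subseteq> K \<Longrightarrow> subgroup K G \<Longrightarrow> card H = card K \<Longrightarrow> H = K"
  using card_subset_eq fin_sub by blast

lemma acts_conjg:
  assumes "subgroup S G" "\<And>e. e \<in> E \<Longrightarrow> e \<subseteq> carrier G" "\<And>g e. g \<in> S \<Longrightarrow> e \<in> E \<Longrightarrow> conjg g e \<in> E"
  shows "acts G S E conjg"
proof -
  have "E \<subseteq> Pow (carrier G)" using assms(2) by blast
  then have "finite E" using fin finite_subset by blast
  then show ?thesis unfolding acts_def
    using assms fin_sub[OF assms(1)] conjg_one conjg_mult subgroup.mem_carrier[OF assms(1)] by simp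
qed

lemma acts_restrict:
  assumes "acts G S E f" "subgroup R G" "R \<subseteq> S" shows "acts G R E f"
  unfolding acts_def
proof (intro conjI ballI)
  note d = actsD[OF assms(1)]
  have RS: "g \<in> S" if "g \<in> R" for g using that assms(3) by (rule rev_subsetD)
  show "subgroup R G" by fact
  show "finite R" using fin_sub[OF assms(2)] .
  show "finite E" using d(3) .
  show "f g e \<in> E" if "g \<in> R" "e \<in> E" for g e using d(4)[OF RS[OF that(1)] that(2)] .
  show "f \<one> e = e" if "e \<in> E" for e using d(5)[OF that] .
  show "f (g \<otimes> h) e = f g (f h e)" if "g \<in> R" "h \<in> R" "e \<in> E" for g h e
    using d(6)[OF RS[OF that(1)] RS[OF that(2)] that(3)] .
qed

lemma acts_cosets:
  assumes "subgroup S G" "subgroup P G" "P \<subseteq> S"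
  shows "acts G S ((\<lambda>g. (\<otimes>) g ` P) ` S) (\<lambda>g C. (\<otimes>) g ` C)"
  unfolding acts_def
proof (intro conjI ballI)
  have c: "g \<in> carrier G" if "g \<in> S" for g using subgroup.mem_carrier[OF assms(1)] that by simp
  show "subgroup S G" "finite S" "finite ((\<lambda>g. (\<otimes>) g ` P) ` S)" using assms fin_sub by simp_all
  have mul: "(\<otimes>) g ` ((\<otimes>) h ` C) = (\<otimes>) (g \<otimes> h) ` C" if "g \<in> S" "h \<in> S" "C \<subseteq> carrier G" for g h C
    unfolding image_image by (rule image_cong) (use that c in \<open>auto simp: m_assoc\<close>)
  have sub: "C \<subseteq> carrier G" if "C \<in> (\<lambda>g. (\<otimes>) g ` P) ` S" for C
    using that c assms(3) by auto
  show "(\<otimes>) g ` e \<in> (\<lambda>g. (\<otimes>) g ` P) ` S" if g: "g \<in> S" and e: "e \<in> (\<lambda>g. (\<otimes>) g ` P) ` S" for g e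
  proof -
    obtain h where h: "h \<in> S" "e = (\<otimes>) h ` P" using e by blast
    show ?thesis unfolding h(2) mul[OF g h(1) sub_carrier[OF assms(2)]]
      using subgroup.m_closed[OF assms(1) g h(1)] by blast
  qed
  show "(\<otimes>) \<one> ` e = e" if "e \<in> (\<lambda>g. (\<otimes>) g ` P) ` S" for e
  proof -
    have "(\<otimes>) \<one> ` e = id ` e" by (rule image_cong) (use sub[OF that] in auto)
    then show ?thesis by simp
  qed
  show "(\<otimes>) (g \<otimes> h) ` e = (\<otimes>) g ` ((\<otimes>) h ` e)"
    if "g \<in> S" "h \<in> S" "e \<in> (\<lambda>g. (\<otimes>) g ` P) ` S" for g h e
    using mul[OF that(1,2) sub[OF that(3)]] by simp
qed

lemma coset_eq_self:
  assumes P: "subgroup P G" and g: "g \<in> carrier G"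
  shows "(\<otimes>) g ` P = P \<longleftrightarrow> g \<in> P"
proof
  assume "(\<otimes>) g ` P = P"
  moreover have "g \<otimes> \<one> \<in> (\<otimes>) g ` P" using subgroup.one_closed[OF P] by blast
  ultimately show "g \<in> P" using g by simp
next
  assume gP: "g \<in> P"
  have "(\<otimes>) g ` P \<subseteq> P" using subgroup.m_closed[OF P gP] by blast
  moreover have "card ((\<otimes>) g ` P) = card P"
    by (rule card_image, rule inj_onI) (metis P g subgroup.mem_carrier Units_eq Units_l_cancel)
  ultimately show "(\<otimes>) g ` P = P" using sub_eq_card[OF _ P] by blast
qed

lemma card_cosets:
  assumes "subgroup S G" "subgroup P G" "P \<subseteq> S"
  shows "card ((\<lambda>g. (\<otimes>) g ` P) ` S) * card P = card S"
proof -
  have "P \<in> (\<lambda>g. (\<otimes>) g ` P) ` S"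
    using subgroup.one_closed[OF assms(1)] coset_eq_self[OF assms(2) one_closed] subgroup.one_closed[OF assms(2)]
    by (metis image_eqI)
  moreover have "{g \<in> S. (\<otimes>) g ` P = P} = P"
    using coset_eq_self[OF assms(2)] subgroup.mem_carrier[OF assms(1)] assms(3) by blast
  ultimately show ?thesis using orbit_stabilizer[OF acts_cosets[OF assms], of P] by simp
qed

lemma card_dvd:
  assumes "subgroup S G" "subgroup P G" "P \<subseteq> S" shows "card P dvd card S"
  using card_cosets[OF assms] by (metis dvd_triv_right)

lemma card_dvd_carrier: "subgroup P G \<Longrightarrow> card P dvd card (carrier G)"
  using card_dvd[OF subgroup_self] sub_carrier by blast

lemma card_orbit_conjg:
  assumes "subgroup S G" "H \<subseteq> carrier G"
  shows "card ((\<lambda>g. conjg g H) ` S) * card (S \<inter> Normalizer H) = card S"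
proof -
  let ?E = "(\<lambda>g. conjg g H) ` S"
  have c: "g \<in> carrier G" if "g \<in> S" for g using subgroup.mem_carrier[OF assms(1)] that by simp
  have "acts G S ?E conjg"
  proof (rule acts_conjg[OF assms(1)])
    show "e \<subseteq> carrier G" if "e \<in> ?E" for e using that c conjg_subset[OF _ assms(2)] by blast
    show "conjg g e \<in> ?E" if g: "g \<in> S" and e: "e \<in> ?E" for g e
    proof -
      obtain h where h: "h \<in> S" "e = conjg h H" using e by blast
      then have "conjg g e = conjg (g \<otimes> h) H" using conjg_mult[OF c c assms(2)] g by simp
      then show ?thesis using subgroup.m_closed[OF assms(1) g h(1)] by blast
    qed
  qed
  moreover have "H \<in> ?E" using conjg_one[OF assms(2)] subgroup.one_closed[OF assms(1)] by (metis image_eqI)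
  moreover have "{g \<in> S. conjg g H = H} = S \<inter> Normalizer H" unfolding Normalizer_def using c by blast
  ultimately show ?thesis using orbit_stabilizer[of S ?E conjg H] by simp
qed

lemma card_conj_class: "H \<subseteq> carrier G \<Longrightarrow> card (conj_class H) * card (Normalizer H) = card (carrier G)"
  using card_orbit_conjg[OF subgroup_self, of H] Normalizer_subgroup[of H] sub_carrier[of "Normalizer H"]
  unfolding conj_class_def by (simp add: Int_absorb1)

lemma fin_conj_class: "finite (conj_class H)" unfolding conj_class_def using fin by simp

text \<open>
  The property that is used is that the index in \<open>S\<close> is prime to \<open>p\<close>; the ambient \<open>S\<close> is a subgroup of the group, which
  allows Sylow arguments inside \<open>S\<close> without changing the group.
\<close>
definition sylow_subgroup :: "nat \<Rightarrow> 'a set \<Rightarrow> 'a set \<Rightarrow> bool" where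
  "sylow_subgroup p P S \<longleftrightarrow> subgroup P G \<and> P \<subseteq> S \<and> (\<exists>a. card P = p ^ a) \<and> \<not> p dvd card S div card P"

lemma prime_power_subgroup:
  assumes p: "prime p" and S: "subgroup S G" and d: "p ^ k dvd card S"
  shows "\<exists>H. subgroup H G \<and> H \<subseteq> S \<and> card H = p ^ k"
proof -
  obtain m where m: "card S = p ^ k * m" using d by blast
  interpret S: group "G\<lparr>carrier := S\<rparr>" using subgroup_imp_group[OF S] .
  obtain H where H: "subgroup H (G\<lparr>carrier := S\<rparr>)" "card H = p ^ k"
    using sylow_thm[OF p S.is_group, of k m] m fin_sub[OF S] unfolding order_def by auto
  then have "subgroup H G" using incl_subgroup[OF S] by blast
  moreover have "H \<subseteq> S" using subgroup.subset[OF H(1)] by simp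
  ultimately show ?thesis using H(2) by blast
qed

lemma syl_exists:
  assumes p: "prime p" and S: "subgroup S G"
  shows "\<exists>P. sylow_subgroup p P S"
proof -
  let ?k = "multiplicity p (card S)"
  have nz: "card S \<noteq> 0" using card_pos[OF S] by simp
  obtain H where "subgroup H G" "H \<subseteq> S" "card H = p ^ ?k"
    using prime_power_subgroup[OF p S multiplicity_dvd] by blast
  moreover have "\<not> p dvd card S div p ^ ?k"
    by (rule multiplicity_decompose) (use nz p in auto)
  ultimately show ?thesis unfolding sylow_subgroup_def by auto
qed

text \<open>
  The \<open>p\<close>-group \<open>R\<close> permutes the cosets of \<open>P\<close>; their number is prime to \<open>p\<close>, so some coset is fixed,
  and a fixed coset of \<open>g\<close> says that \<open>R\<close> lies in the conjugate by \<open>g\<close>.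
\<close>
lemma p_subgroup_conj:
  assumes p: "prime p" and S: "subgroup S G" and R: "subgroup R G" "R \<subseteq> S" "card R = p ^ k"
    and P: "subgroup P G" "P \<subseteq> S" "\<not> p dvd card S div card P"
  shows "\<exists>g\<in>S. R \<subseteq> conjg g P"
proof -
  let ?E = "(\<lambda>g. (\<otimes>) g ` P) ` S"
  have Sc: "g \<in> carrier G" if "g \<in> S" for g using subgroup.mem_carrier[OF S] that by simp
  have a: "acts G R ?E (\<lambda>g C. (\<otimes>) g ` C)"
    by (rule acts_restrict[OF acts_cosets[OF S P(1,2)] R(1,2)])
  have "card ?E = card S div card P" using card_cosets[OF S P(1,2)] card_pos[OF P(1)]
    by (metis nonzero_mult_div_cancel_right less_not_refl2)
  then have "card ?E mod p \<noteq> 0" using P(3) by (simp add: dvd_eq_mod_eq_0)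
  moreover have "card ?E mod p = card {e \<in> ?E. \<forall>g\<in>R. (\<otimes>) g ` e = e} mod p"
    by (rule p_group_fixed_points[OF a p R(3)])
  ultimately have "{e \<in> ?E. \<forall>g\<in>R. (\<otimes>) g ` e = e} \<noteq> {}" by (intro notI) simp
  then obtain C where C: "C \<in> ?E" "\<forall>g\<in>R. (\<otimes>) g ` C = C" by blast
  then obtain g where g: "g \<in> S" "C = (\<otimes>) g ` P" by blast
  have "r \<in> conjg g P" if r: "r \<in> R" for r
  proof -
    have "g \<otimes> \<one> \<in> C" unfolding g(2) using subgroup.one_closed[OF P(1)] by (rule imageI)
    then have "r \<otimes> (g \<otimes> \<one>) \<in> (\<otimes>) r ` C" by (rule imageI)
    then have "r \<otimes> g \<in> C" using C(2) r Sc[OF g(1)] by simp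
    then obtain x where x: "x \<in> P" "r \<otimes> g = g \<otimes> x" unfolding g(2) by blast
    have c: "r \<in> carrier G" "x \<in> carrier G" "g \<in> carrier G" using r R(2) Sc x P(2) g(1) by blast+
    have "r = g \<otimes> x \<otimes> inv g" using x(2) c by (metis inv_solve_right m_closed)
    then show ?thesis unfolding conjg_def using x(1) by blast
  qed
  then show ?thesis using g(1) by blast
qed

lemma sylD: assumes "sylow_subgroup p P S" shows "subgroup P G" "P \<subseteq> S" "\<exists>a. card P = p ^ a" "\<not> p dvd card S div card P"
  using assms unfolding sylow_subgroup_def by auto

lemma syl_conj:
  assumes p: "prime p" and S: "subgroup S G" and P: "sylow_subgroup p P S" "sylow_subgroup p P' S"
  shows "\<exists>g\<in>S. P' = conjg g P"
proof -
  have le: "card A \<le> card B" if AB: "sylow_subgroup p A S" "sylow_subgroup p B S" for A B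
  proof -
    obtain a where a: "card A = p ^ a" using sylD(3)[OF AB(1)] by blast
    obtain g where g: "g \<in> S" "A \<subseteq> conjg g B"
      using p_subgroup_conj[OF p S sylD(1,2)[OF AB(1)] a sylD(1,2,4)[OF AB(2)]] by blast
    have gc: "g \<in> carrier G" using g(1) subgroup.mem_carrier[OF S] by simp
    have Bc: "B \<subseteq> carrier G" using sub_carrier[OF sylD(1)[OF AB(2)]] .
    have "card A \<le> card (conjg g B)"
      using card_mono[OF fin_sub[OF conjg_subgroup[OF gc sylD(1)[OF AB(2)]]] g(2)] .
    then show ?thesis using card_conjg[OF gc Bc] by simp
  qed
  obtain a where a: "card P' = p ^ a" using sylD(3)[OF P(2)] by blast
  obtain g where g: "g \<in> S" "P' \<subseteq> conjg g P"
    using p_subgroup_conj[OF p S sylD(1,2)[OF P(2)] a sylD(1,2,4)[OF P(1)]] by blast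
  have gc: "g \<in> carrier G" using g(1) subgroup.mem_carrier[OF S] by simp
  have "card P' = card (conjg g P)"
    using le[OF P] le[OF P(2,1)] card_conjg[OF gc sub_carrier[OF sylD(1)[OF P(1)]]] by simp
  then show ?thesis using sub_eq_card[OF g(2) conjg_subgroup[OF gc sylD(1)[OF P(1)]]] g(1) by blast
qed

lemma conjg_subset_self: "subgroup S G \<Longrightarrow> g \<in> S \<Longrightarrow> P \<subseteq> S \<Longrightarrow> conjg g P \<subseteq> S"
  using conjg_mono[of P S g] conjg_self[of S g] by simp

lemma syl_conjg:
  assumes S: "subgroup S G" and P: "sylow_subgroup p P S" and g: "g \<in> S"
  shows "sylow_subgroup p (conjg g P) S"
  unfolding sylow_subgroup_def
  using conjg_subgroup[OF subgroup.mem_carrier[OF S g] sylD(1)[OF P]] conjg_subset_self[OF S g sylD(2)[OF P]]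
    card_conjg[OF subgroup.mem_carrier[OF S g] sub_carrier[OF sylD(1)[OF P]]] sylD(3,4)[OF P] by simp

text \<open>
  The product \<open>R <#> P\<close> is a \<open>p\<close>-group and contains \<open>P\<close> with index prime to \<open>p\<close>.
\<close>
lemma syl_absorb:
  assumes p: "prime p" and S: "subgroup S G" and P: "sylow_subgroup p P S"
    and R: "subgroup R G" "R \<subseteq> S" "card R = p ^ k" "R \<subseteq> Normalizer P"
  shows "R \<subseteq> P"
proof -
  have T: "subgroup (R <#> P) G" by (rule normalizing_mult_subgroup[OF R(1) sylD(1)[OF P] R(4)])
  have TS: "R <#> P \<subseteq> S" unfolding set_mult_def
    using R(2) sylD(2)[OF P] subgroup.m_closed[OF S] by blast
  have PT: "P \<subseteq> R <#> P" using subset_set_mult(2)[OF R(1) sylD(1)[OF P]] .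
  have "\<not> p dvd card (R <#> P) div card P"
  proof
    assume "p dvd card (R <#> P) div card P"
    then have "p * card P dvd card (R <#> P)"
      using card_dvd[OF T sylD(1)[OF P] PT] by (metis dvd_div_mult_self mult_dvd_mono dvd_refl)
    then have "p * card P dvd card S" using card_dvd[OF S T TS] dvd_trans by blast
    then show False using sylD(4)[OF P] card_pos[OF sylD(1)[OF P]] by (metis dvd_div_iff_mult card_dvd[OF S sylD(1,2)[OF P]] less_not_refl)
  qed
  moreover have "\<exists>j. card (R <#> P) div card P = p ^ j"
  proof -
    have "card (R <#> P) dvd card R * card P"
      using set_mult_inter_card[OF R(1) sylD(1)[OF P] fin_sub[OF R(1)] fin_sub[OF sylD(1)[OF P]]] by (metis dvd_triv_left)
    then have "card (R <#> P) div card P dvd p ^ k"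
      using R(3) card_pos[OF sylD(1)[OF P]] card_dvd[OF T sylD(1)[OF P] PT]
      by (metis dvd_div_mult_self dvd_times_right_cancel_iff less_not_refl)
    then show ?thesis using divides_primepow_nat[OF p] by blast
  qed
  ultimately have "card (R <#> P) div card P = 1"
    by (metis dvd_refl dvd_power neq0_conv power_0)
  then have "card P = card (R <#> P)"
    using card_dvd[OF T sylD(1)[OF P] PT] by (metis dvd_mult_div_cancel mult.right_neutral)
  then have "P = R <#> P" using sub_eq_card[OF PT T] by blast
  then show ?thesis using subset_set_mult(1)[OF R(1) sylD(1)[OF P]] by simp
qed

text \<open>
  The Sylow subgroup \<open>P\<close> acts on its conjugates, and \<open>syl_absorb\<close> shows that it fixes only itself.
\<close>
lemma syl_count:
  assumes p: "prime p" and S: "subgroup S G" and P: "sylow_subgroup p P S"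
  shows "card ((\<lambda>g. conjg g P) ` S) mod p = 1"
proof -
  let ?E = "(\<lambda>g. conjg g P) ` S"
  obtain a where a: "card P = p ^ a" using sylD(3)[OF P] by blast
  have Sc: "g \<in> carrier G" if "g \<in> S" for g using subgroup.mem_carrier[OF S] that by simp
  have Ec: "e \<subseteq> carrier G" if "e \<in> ?E" for e
    using that Sc conjg_subset[OF _ sub_carrier[OF sylD(1)[OF P]]] by blast
  have act: "acts G P ?E conjg"
  proof (rule acts_conjg[OF sylD(1)[OF P] Ec])
    show "conjg g e \<in> ?E" if g: "g \<in> P" and e: "e \<in> ?E" for g e
    proof -
      have gS: "g \<in> S" using g sylD(2)[OF P] by blast
      obtain h where h: "h \<in> S" "e = conjg h P" using e by blast
      then have "conjg g e = conjg (g \<otimes> h) P"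
        using conjg_mult[OF Sc Sc sub_carrier[OF sylD(1)[OF P]]] gS by simp
      then show ?thesis using subgroup.m_closed[OF S gS h(1)] by blast
    qed
  qed
  have "{e \<in> ?E. \<forall>g\<in>P. conjg g e = e} = {P}"
  proof (intro equalityI subsetI)
    fix e assume e: "e \<in> {e \<in> ?E. \<forall>g\<in>P. conjg g e = e}"
    then obtain h where h: "h \<in> S" "e = conjg h P" by blast
    have se: "sylow_subgroup p e S" using syl_conjg[OF S P h(1)] h(2) by simp
    have "P \<subseteq> Normalizer e" unfolding Normalizer_def using e sub_carrier[OF sylD(1)[OF P]] by blast
    then have "P \<subseteq> e" using syl_absorb[OF p S se sylD(1,2)[OF P] a] by simp
    moreover have "card P = card e" using h card_conjg[OF Sc sub_carrier[OF sylD(1)[OF P]]] by simp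
    ultimately show "e \<in> {P}" using sub_eq_card[OF _ sylD(1)[OF se]] by blast
  next
    fix e assume "e \<in> {P}"
    moreover have "P \<in> ?E" using conjg_one[OF sub_carrier[OF sylD(1)[OF P]]] subgroup.one_closed[OF S] by (metis image_eqI)
    ultimately show "e \<in> {e \<in> ?E. \<forall>g\<in>P. conjg g e = e}" using conjg_self[OF sylD(1)[OF P]] by blast
  qed
  then show ?thesis using p_group_fixed_points[OF act p a] prime_gt_1_nat[OF p] by simp
qed

lemma syl_conj_class_count: "prime p \<Longrightarrow> sylow_subgroup p P (carrier G) \<Longrightarrow> card (conj_class P) mod p = 1"
  unfolding conj_class_def by (rule syl_count[OF _ subgroup_self])

text \<open>
  A conjugate of \<open>Q\<close> under the whole group is already a conjugate under \<open>M\<close>; the two conjugating elements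
  differ by a normalizing one.
\<close>
lemma frattini:
  assumes M: "M \<lhd> G" and q: "prime q" and Q: "sylow_subgroup q Q M"
  shows "M <#> Normalizer Q = carrier G"
proof (intro equalityI subsetI)
  have Ms: "subgroup M G" using M normal_imp_subgroup by blast
  have Qc: "Q \<subseteq> carrier G" using sub_carrier[OF sylD(1)[OF Q]] .
  show "x \<in> carrier G" if "x \<in> M <#> Normalizer Q" for x
    using that sub_carrier[OF Ms] sub_carrier[OF Normalizer_subgroup[OF Qc]] unfolding set_mult_def by blast
  fix g assume g: "g \<in> carrier G"
  have "conjg g Q \<subseteq> M" using conjg_mono[OF sylD(2)[OF Q], of g] M normal_iff_conjg[OF Ms] g by simp
  then have "sylow_subgroup q (conjg g Q) M" unfolding sylow_subgroup_def
    using conjg_subgroup[OF g sylD(1)[OF Q]] card_conjg[OF g Qc] sylD(3,4)[OF Q] by simp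
  then obtain m where m: "m \<in> M" "conjg g Q = conjg m Q" using syl_conj[OF q Ms Q] by blast
  have mc: "m \<in> carrier G" using m(1) sub_carrier[OF Ms] by blast
  have "conjg (inv m \<otimes> g) Q = Q"
    using conjg_mult[of "inv m" g Q] conjg_inv(1)[OF mc Qc] m g mc Qc by simp
  then have "inv m \<otimes> g \<in> Normalizer Q" unfolding Normalizer_def using g mc by simp
  moreover have "g = m \<otimes> (inv m \<otimes> g)" using g mc by (simp add: m_assoc[symmetric])
  ultimately show "g \<in> M <#> Normalizer Q" unfolding set_mult_def using m(1) by blast
qed

lemma card_FactGroup: "L \<lhd> G \<Longrightarrow> card (carrier (G Mod L)) * card L = card (carrier G)"
  using lagrange[OF normal_imp_subgroup[of L G]] unfolding FactGroup_def order_def by simp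

lemma preimage_card:
  assumes L: "L \<lhd> G" and H: "subgroup H (G Mod L)"
  shows "subgroup (\<Union>H) G" "L \<subseteq> \<Union>H" "card (\<Union>H) = card H * card L"
proof -
  interpret normal L G by fact
  show "subgroup (\<Union>H) G" using factgroup_subgroup_union_subgroup[OF H] .
  have "\<one>\<^bsub>G Mod L\<^esub> \<in> H" using subgroup.one_closed[OF H] .
  then show "L \<subseteq> \<Union>H" unfolding FactGroup_def by auto
  have Hs: "H \<subseteq> rcosets L" using subgroup.subset[OF H] unfolding FactGroup_def by simp
  have "card L * card H = card (\<Union>H)"
  proof (rule card_partition)
    have "rcosets L \<subseteq> Pow (carrier G)" using rcosets_subset_PowG[OF is_subgroup] .
    then show "finite H" using Hs fin finite_Pow_iff finite_subset by (metis (no_types))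
    have "\<Union>H \<subseteq> carrier G" using \<open>subgroup (\<Union>H) G\<close> sub_carrier by blast
    then show "finite (\<Union>H)" using fin finite_subset by blast
    show "card c = card L" if "c \<in> H" for c
      using card_rcosets_equal[of c L] subsetD[OF Hs that] sub_carrier[OF is_subgroup] by simp
    show "c1 \<inter> c2 = {}" if "c1 \<in> H" "c2 \<in> H" "c1 \<noteq> c2" for c1 c2
      using pairwiseD[OF rcos_disjoint[OF is_subgroup], of c1 c2] subsetD[OF Hs that(1)] subsetD[OF Hs that(2)] that(3)
      unfolding disjnt_def by simp
  qed
  then show "card (\<Union>H) = card H * card L" by (simp add: mult.commute)
qed

text \<open>
  Sylow's existence theorem in the quotient by \<open>L\<close>, pulled back to the group.
\<close>
lemma rel_prime_power_subgroup:
  assumes p: "prime p" and L: "L \<lhd> G" and d: "p ^ k * card L dvd card (carrier G)"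
  shows "\<exists>U. subgroup U G \<and> L \<subseteq> U \<and> card U = p ^ k * card L"
proof -
  interpret normal L G by fact
  interpret F: group "G Mod L" by (rule factorgroup_is_group)
  have Lpos: "card L > 0" using card_pos[OF is_subgroup] .
  have "p ^ k dvd card (carrier (G Mod L))" using d Lpos card_FactGroup[OF L] by (metis dvd_times_right_cancel_iff less_not_refl)
  moreover have "fin_group (G Mod L)"
  proof unfold_locales
    show "finite (carrier (G Mod L))" using card_FactGroup[OF L] card_pos[OF subgroup_self]
      by (metis card.infinite mult_0 less_not_refl)
  qed
  ultimately obtain H where "subgroup H (G Mod L)" "card H = p ^ k"
    using fin_group.prime_power_subgroup[OF _ p F.subgroup_self] by blast
  then show ?thesis using preimage_card[OF L] by metis
qed

end

section \<open>Factorizations, cyclic subgroups and subgroups of small index\<close>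

context fin_group
begin

lemma prod_card_iff:
  assumes H: "subgroup H G" and K: "subgroup K G"
  shows "H <#> K = carrier G \<longleftrightarrow> card H * card K = card (carrier G) * card (H \<inter> K)"
proof -
  have pos: "card (H \<inter> K) > 0" using card_pos[OF subgroups_Inter_pair[OF H K]] .
  have sub: "H <#> K \<subseteq> carrier G" using set_mult_closed[OF sub_carrier[OF H] sub_carrier[OF K]] .
  note c = set_mult_inter_card[OF H K fin_sub[OF H] fin_sub[OF K]]
  show ?thesis
  proof
    assume *: "H <#> K = carrier G"
    show "card H * card K = card (carrier G) * card (H \<inter> K)" using c[unfolded *] by (rule sym)
  next
    assume "card H * card K = card (carrier G) * card (H \<inter> K)"
    then have "card (H <#> K) * card (H \<inter> K) = card (carrier G) * card (H \<inter> K)" using c by (rule trans[rotated])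
    then have "card (H <#> K) = card (carrier G)" using pos by (simp only: mult_right_cancel[OF gr_implies_not0[OF pos]])
    then show "H <#> K = carrier G" using sub_eq_card[OF sub subgroup_self] by simp
  qed
qed

lemma prod_mono:
  assumes "H <#> K = carrier G" "H \<subseteq> H'" "H' \<subseteq> carrier G" "K \<subseteq> carrier G"
  shows "H' <#> K = carrier G"
  using set_mult_closed[OF assms(3,4)] mono_set_mult[OF assms(2) subset_refl[of K], of G] assms(1) by (intro equalityI) auto

text \<open>
  An element \<open>g\<close> can be replaced by its component in \<open>K\<close>, which the product absorbs. Consequently
  adjacency in the comaximal graph depends only on the conjugacy class of each vertex.
\<close>
lemma prod_conjg:
  assumes H: "subgroup H G" and K: "subgroup K G" and HK: "H <#> K = carrier G" and g: "g \<in> carrier G"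
  shows "conjg g H <#> K = carrier G"
proof (intro equalityI subsetI)
  have Hc: "h \<in> carrier G" if "h \<in> H" for h using that subgroup.mem_carrier[OF H] by simp
  have Kc: "h \<in> carrier G" if "h \<in> K" for h using that subgroup.mem_carrier[OF K] by simp
  show "x \<in> carrier G" if "x \<in> conjg g H <#> K" for x
    using that conjg_subset[OF g sub_carrier[OF H]] sub_carrier[OF K] unfolding set_mult_def by blast
  fix y assume y: "y \<in> carrier G"
  have "g \<in> K <#> H" using set_mult_eq_carrier_commute[OF H K HK] g by simp
  then obtain k h where kh: "k \<in> K" "h \<in> H" "g = k \<otimes> h" unfolding set_mult_def by blast
  have cg: "conjg g H = conjg k H"
    unfolding kh(3) conjg_mult[OF Kc[OF kh(1)] Hc[OF kh(2)] sub_carrier[OF H]] conjg_self[OF H kh(2)] ..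
  have "inv k \<otimes> y \<in> H <#> K" using HK Kc[OF kh(1)] y by simp
  then obtain a b where ab: "a \<in> H" "b \<in> K" "inv k \<otimes> y = a \<otimes> b" unfolding set_mult_def by blast
  have c: "k \<in> carrier G" "a \<in> carrier G" "b \<in> carrier G" using Hc Kc kh ab by auto
  have "y = k \<otimes> (inv k \<otimes> y)" using c y by (simp add: m_assoc[symmetric])
  also have "\<dots> = k \<otimes> (a \<otimes> b)" using ab(3) by simp
  also have "\<dots> = (k \<otimes> a \<otimes> inv k) \<otimes> (k \<otimes> b)"
  proof -
    have "(k \<otimes> a \<otimes> inv k) \<otimes> (k \<otimes> b) = k \<otimes> a \<otimes> (inv k \<otimes> k \<otimes> b)" using c by (simp only: m_assoc m_closed inv_closed)
    then show ?thesis using c by (simp add: m_assoc)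
  qed
  finally have "y = (k \<otimes> a \<otimes> inv k) \<otimes> (k \<otimes> b)" .
  moreover have "k \<otimes> a \<otimes> inv k \<in> conjg k H" unfolding conjg_def using ab(1) by blast
  then have "k \<otimes> a \<otimes> inv k \<in> conjg g H" unfolding cg .
  ultimately show "y \<in> conjg g H <#> K" unfolding set_mult_def
    using subgroup.m_closed[OF K kh(1) ab(2)] \<open>k \<otimes> a \<otimes> inv k \<in> conjg g H\<close> by blast
qed

lemma index_pow_mem:
  assumes L: "L \<lhd> G" and n: "n * card L = card (carrier G)" and z: "z \<in> carrier G"
  shows "z [^] n \<in> L"
proof -
  interpret normal L G by fact
  interpret F: group "G Mod L" by (rule factorgroup_is_group)
  interpret h: group_hom G "G Mod L" "\<lambda>a. L #> a"
    by unfold_locales (rule r_coset_hom_Mod)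
  have "n = order (G Mod L)" using n card_FactGroup[OF L] card_pos[OF is_subgroup] unfolding order_def by (metis mult_right_cancel less_not_refl)
  then have "(L #> z) [^]\<^bsub>G Mod L\<^esub> n = \<one>\<^bsub>G Mod L\<^esub>"
    using F.pow_order_eq_1[of "L #> z"] h.hom_closed[OF z] by simp
  then have "L #> (z [^] n) = L" using h.hom_nat_pow[OF z, of n] unfolding FactGroup_def by simp
  then show ?thesis using rcos_self[OF nat_pow_closed[OF z, of n] is_subgroup] by simp
qed

lemma normal_mult_subgroup:
  assumes "N \<lhd> G" "subgroup H G" shows "subgroup (H <#> N) G"
  by (rule normalizing_mult_subgroup[OF assms(2) normal_imp_subgroup[OF assms(1)]])
    (use assms normal_iff_Normalizer[OF normal_imp_subgroup[OF assms(1)]] sub_carrier in auto)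

lemma prime_index_prod:
  assumes M: "M \<lhd> G" "prime p" "card M * p = card (carrier G)" and K: "subgroup K G" "\<not> K \<subseteq> M"
  shows "M <#> K = carrier G"
proof -
  have Ms: "subgroup M G" using M(1) normal_imp_subgroup by blast
  have S: "subgroup (K <#> M) G" by (rule normal_mult_subgroup[OF M(1) K(1)])
  have sub: "M \<subseteq> K <#> M" "K \<subseteq> K <#> M" using subset_set_mult[OF K(1) Ms] by auto
  obtain d where d: "card (K <#> M) = card M * d" using card_dvd[OF S Ms sub(1)] by blast
  then have "d dvd p" using card_dvd_carrier[OF S] M(3) card_pos[OF Ms] by (metis nat_mult_dvd_cancel_disj less_not_refl)
  moreover have "d \<noteq> 1"
  proof
    assume "d = 1"
    then have "M = K <#> M" using sub_eq_card[OF sub(1) S] d by simp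
    then show False using sub(2) K(2) by simp
  qed
  ultimately have "d = p" using M(2) prime_nat_iff by blast
  then have "K <#> M = carrier G" using sub_eq_card[OF sub_carrier[OF S] subgroup_self] d M(3) by simp
  then show ?thesis using set_mult_eq_carrier_commute[OF K(1) Ms] by simp
qed

lemma gen_sub: "x \<in> carrier G \<Longrightarrow> subgroup (generate G {x}) G"
  by (rule generate_is_subgroup) simp

lemma gen_in: "x \<in> generate G {x}"
  by (rule generate.incl) simp

lemma gen_subset: "subgroup H G \<Longrightarrow> x \<in> H \<Longrightarrow> generate G {x} \<subseteq> H"
  by (rule generate_subgroup_incl) auto

lemma ord_pos: "x \<in> carrier G \<Longrightarrow> ord x > 0"
  using ord_ge_1[OF fin] by force

lemma gen_elem: "x \<in> carrier G \<Longrightarrow> y \<in> generate G {x} \<Longrightarrow> \<exists>n::nat. y = x [^] n"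
  using generate_pow_nat[of x] ord_pos[of x] by auto

lemma pow_mem: "subgroup H G \<Longrightarrow> x \<in> H \<Longrightarrow> x [^] (n::nat) \<in> H"
proof (induction n)
  case 0 then show ?case using subgroup.one_closed by simp
next
  case (Suc n) then show ?case using subgroup.m_closed by simp
qed

text \<open>
  By Bezout the exponents \<open>m\<close> and \<open>n\<close> combine to 1.
\<close>
lemma pow_coprime_mem:
  assumes H: "subgroup H G" and x: "x \<in> carrier G" and m: "x [^] (m::nat) \<in> H" "x [^] (n::nat) \<in> H" and c: "coprime m n"
  shows "x \<in> H"
proof -
  have Hi: "y [^] (k::int) \<in> H" if "y \<in> H" for y k
    by (cases k rule: int_cases2) (use that subgroup.mem_carrier[OF H] pow_mem[OF H] subgroup.m_inv_closed[OF H] in \<open>auto simp: int_pow_neg_int int_pow_int\<close>)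
  obtain a b where ab: "int m * a + int n * b = 1"
    using bezout_int[of "int m" "int n"] c by (metis coprime_iff_gcd_eq_1 coprime_int_iff mult.commute)
  have "x = x [^] (int m * a + int n * b)" using ab x by (simp add: int_pow_1)
  also have "\<dots> = (x [^] (int m)) [^] a \<otimes> (x [^] (int n)) [^] b"
    using x by (simp add: int_pow_mult int_pow_pow)
  also have "\<dots> \<in> H" using Hi m by (intro subgroup.m_closed[OF H]) (simp_all add: int_pow_int)
  finally show ?thesis .
qed

text \<open>
  The \<open>p\<close>-part of an element outside \<open>M\<close> stays outside \<open>M\<close>, as the quotient has order \<open>p\<close>.
\<close>
lemma p_element_outside:
  assumes M: "M \<lhd> G" "prime p" "card M * p = card (carrier G)" and K: "subgroup K G" "\<not> K \<subseteq> M"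
  shows "\<exists>x\<in>K. x \<notin> M \<and> (\<exists>k. ord x = p ^ k)"
proof -
  have Ms: "subgroup M G" using M(1) normal_imp_subgroup by blast
  obtain z where z: "z \<in> K" "z \<notin> M" using K(2) by blast
  have zc: "z \<in> carrier G" using z(1) subgroup.mem_carrier[OF K(1)] by simp
  define k m where "k = multiplicity p (ord z)" and "m = ord z div p ^ k"
  have oz: "ord z = p ^ k * m" unfolding k_def m_def by (rule dvd_mult_div_cancel[OF multiplicity_dvd, symmetric])
  have pm: "\<not> p dvd m" unfolding m_def k_def
    by (rule multiplicity_decompose) (use ord_pos[OF zc] M(2) in auto)
  have mpos: "m > 0" using oz ord_pos[OF zc] by (cases m) auto
  let ?x = "z [^] m"
  have "ord ?x = p ^ k" using ord_pow_gen[OF zc, of m] oz mpos by (simp add: gcd_mult_left)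
  moreover have "?x \<in> K" using pow_mem[OF K(1) z(1)] .
  moreover have "?x \<notin> M"
  proof
    assume "?x \<in> M"
    moreover have "z [^] p \<in> M" using index_pow_mem[OF M(1) _ zc, of p] M(3) by (simp add: mult.commute)
    moreover have "coprime m p" using pm M(2) by (metis coprime_commute prime_imp_coprime_nat)
    ultimately show False using pow_coprime_mem[OF Ms zc] z(2) by blast
  qed
  ultimately show ?thesis by blast
qed

lemma exists_maximal:
  assumes H: "subgroup H G" "H \<noteq> carrier G"
  shows "\<exists>W. subgroup W G \<and> H \<subseteq> W \<and> W \<noteq> carrier G \<and> (\<forall>U. subgroup U G \<longrightarrow> W \<subseteq> U \<longrightarrow> U \<noteq> carrier G \<longrightarrow> U = W)"
proof -
  define A where "A = {W. subgroup W G \<and> H \<subseteq> W \<and> W \<noteq> carrier G}"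
  have "A \<subseteq> Pow (carrier G)" unfolding A_def using sub_carrier by blast
  then have "finite A" by (rule finite_subset) (simp add: fin)
  moreover have "H \<in> A" using H unfolding A_def by simp
  ultimately have "\<exists>W\<in>A. H \<subseteq> W \<and> (\<forall>U\<in>A. W \<subseteq> U \<longrightarrow> W = U)"
    by (rule finite_has_maximal2)
  then obtain W where W: "W \<in> A" "\<forall>U\<in>A. W \<subseteq> U \<longrightarrow> W = U" by blast
  have "subgroup W G" "H \<subseteq> W" "W \<noteq> carrier G" using W(1) unfolding A_def by auto
  moreover have "U = W" if "subgroup U G" "W \<subseteq> U" "U \<noteq> carrier G" for U
  proof -
    have "U \<in> A" using that \<open>H \<subseteq> W\<close> unfolding A_def by simp
    then show ?thesis using W(2) that(2) by blast
  qed
  ultimately show ?thesis by blast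
qed

text \<open>
  The quotient by \<open>N\<close> contains a subgroup of prime order, whose preimage is everything by maximality.
\<close>
lemma normal_maximal_prime_index:
  assumes N: "N \<lhd> G" "N \<noteq> carrier G" and m: "\<And>U. subgroup U G \<Longrightarrow> N \<subseteq> U \<Longrightarrow> U \<noteq> carrier G \<Longrightarrow> U = N"
  shows "\<exists>p. prime p \<and> card N * p = card (carrier G)"
proof -
  have Ns: "subgroup N G" using N normal_imp_subgroup by blast
  obtain n where n: "card (carrier G) = card N * n" using card_dvd_carrier[OF Ns] by blast
  have "n \<noteq> 1" using N(2) sub_eq_card[OF sub_carrier[OF Ns] subgroup_self] n by auto
  then obtain p where p: "prime p" "p dvd n" using prime_factor_nat by blast
  have "p ^ 1 * card N dvd card (carrier G)" using p(2) n by (simp add: mult.commute)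
  then obtain U where U: "subgroup U G" "N \<subseteq> U" "card U = p ^ 1 * card N"
    using rel_prime_power_subgroup[OF p(1) N(1)] by blast
  have "U \<noteq> N" using U(3) card_pos[OF Ns] prime_gt_1_nat[OF p(1)] by auto
  then have "U = carrier G" using m U by blast
  then show ?thesis using U(3) p(1) by (metis mult.commute power_one_right)
qed

text \<open>
  Modulo \<open>L\<close> this says that normalizers grow in \<open>q\<close>-groups. A Sylow \<open>q\<close>-subgroup \<open>R\<close> of \<open>W\<close> acts on the cosets of
  \<open>W\<close>. Their number is divisible by \<open>q\<close> and the coset \<open>W\<close> is fixed, so another coset is fixed as well. The
  corresponding conjugate contains \<open>R\<close> and \<open>L\<close>, and these two generate a subgroup whose index in \<open>W\<close> is both a power
  of \<open>q\<close> and prime to \<open>q\<close>.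
\<close>
lemma normalizer_grows:
  assumes L: "L \<lhd> G" and W: "subgroup W G" "L \<subseteq> W" "W \<noteq> carrier G"
    and q: "prime q" "card (carrier G) = q ^ k * card L"
  shows "Normalizer W \<noteq> W"
proof
  assume NW: "Normalizer W = W"
  have Ls: "subgroup L G" using L normal_imp_subgroup by blast
  have Lpos: "card L > 0" using card_pos[OF Ls] .
  obtain R where R: "sylow_subgroup q R W" using syl_exists[OF q(1) W(1)] by blast
  obtain a where a: "card R = q ^ a" using sylD(3)[OF R] by blast
  let ?E = "(\<lambda>g. (\<otimes>) g ` W) ` carrier G"
  have Ws: "W \<subseteq> carrier G" using sub_carrier[OF W(1)] .
  have act: "acts G R ?E (\<lambda>g C. (\<otimes>) g ` C)"
    by (rule acts_restrict[OF acts_cosets[OF subgroup_self W(1) Ws] sylD(1)[OF R] sub_carrier[OF sylD(1)[OF R]]])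
  obtain w where w: "card W = card L * w" using card_dvd[OF W(1) Ls W(2)] by blast
  have cE: "card ?E * card W = card (carrier G)" by (rule card_cosets[OF subgroup_self W(1) Ws])
  then have "card L * (card ?E * w) = card L * q ^ k" unfolding w q(2) by (simp add: ac_simps)
  then have Ew: "card ?E * w = q ^ k" using Lpos by simp
  then have "card ?E dvd q ^ k" by (metis dvd_triv_left)
  then obtain j where j: "card ?E = q ^ j" using divides_primepow_nat[OF q(1)] by blast
  have "j \<noteq> 0"
  proof
    assume "j = 0"
    then have "card W = card (carrier G)" using cE j by simp
    then show False using W(3) sub_eq_card[OF Ws subgroup_self] by simp
  qed
  let ?F = "{e \<in> ?E. \<forall>g\<in>R. (\<otimes>) g ` e = e}"
  have "card ?E mod q = card ?F mod q" by (rule p_group_fixed_points[OF act q(1) a])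
  moreover have "q dvd card ?E" using j \<open>j \<noteq> 0\<close> by simp
  ultimately have qF: "q dvd card ?F" by (simp add: dvd_eq_mod_eq_0)
  have WE: "W \<in> ?E" using coset_eq_self[OF W(1) one_closed] subgroup.one_closed[OF W(1)] by (metis image_eqI one_closed)
  have WF: "W \<in> ?F" using WE coset_eq_self[OF W(1)] sylD(2)[OF R] Ws by blast
  have "?F \<noteq> {W}" using qF prime_gt_1_nat[OF q(1)] by auto
  then obtain C where C: "C \<in> ?F" "C \<noteq> W" using WF by blast
  then obtain g where g: "g \<in> carrier G" "C = (\<otimes>) g ` W" by blast
  have gW: "g \<notin> W" using C(2) g coset_eq_self[OF W(1) g(1)] by simp
  have RW: "R \<subseteq> conjg g W"
  proof
    fix r assume r: "r \<in> R"
    have rc: "r \<in> carrier G" using r sub_carrier[OF sylD(1)[OF R]] by blast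
    have "(\<otimes>) r ` C = C" using C(1) r by blast
    moreover have "g \<otimes> \<one> \<in> C" unfolding g(2) using subgroup.one_closed[OF W(1)] by (rule imageI)
    ultimately have "r \<otimes> (g \<otimes> \<one>) \<in> C" by blast
    then obtain x where x: "x \<in> W" "r \<otimes> g = g \<otimes> x" using g by auto
    then have "r = g \<otimes> x \<otimes> inv g" using rc g(1) Ws by (metis inv_solve_right m_closed subsetD)
    then show "r \<in> conjg g W" unfolding conjg_def using x(1) by blast
  qed
  have LW: "L \<subseteq> conjg g W"
    using conjg_mono[OF W(2), of g] L normal_iff_conjg[OF Ls] g(1) by simp
  let ?T = "W \<inter> conjg g W"
  have gWs: "subgroup (conjg g W) G" by (rule conjg_subgroup[OF g(1) W(1)])
  have T: "subgroup ?T G" by (rule subgroups_Inter_pair[OF W(1) gWs])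
  obtain t where t: "card W = card ?T * t" using card_dvd[OF W(1) T] by blast
  obtain l where l: "card ?T = card L * l" using card_dvd[OF T Ls] W(2) LW by blast
  obtain s where s: "card ?T = card R * s" using card_dvd[OF T sylD(1)[OF R]] sylD(2)[OF R] RW by blast
  have "w = l * t" using w t l Lpos by simp
  then have "t dvd q ^ k" using Ew by (metis dvd_mult_left dvd_triv_right mult.commute mult.assoc)
  then obtain i where i: "t = q ^ i" using divides_primepow_nat[OF q(1)] by blast
  have "card W div card R = s * t" using t s card_pos[OF sylD(1)[OF R]] by simp
  then have "\<not> q dvd t" using sylD(4)[OF R] by (metis dvd_mult)
  then have "i = 0" using i by (metis dvd_power neq0_conv)
  then have "?T = W" using sub_eq_card[of ?T W] W(1) t i by simp
  then have "W \<subseteq> conjg g W" by blast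
  then have "W = conjg g W" using sub_eq_card[OF _ gWs] card_conjg[OF g(1) Ws] by simp
  then have "g \<in> Normalizer W" unfolding Normalizer_def using g(1) by simp
  then show False using NW gW by simp
qed

lemma rel_p_group_prime_index:
  assumes L: "L \<lhd> G" "L \<noteq> carrier G" and q: "prime q" "card (carrier G) = q ^ k * card L"
  shows "\<exists>N p. N \<lhd> G \<and> L \<subseteq> N \<and> prime p \<and> card N * p = card (carrier G)"
proof -
  obtain W where W: "subgroup W G" "L \<subseteq> W" "W \<noteq> carrier G"
    "\<And>U. subgroup U G \<Longrightarrow> W \<subseteq> U \<Longrightarrow> U \<noteq> carrier G \<Longrightarrow> U = W"
    using exists_maximal[OF normal_imp_subgroup[OF L(1)] L(2)] by blast
  have "Normalizer W = carrier G"
    using normalizer_grows[OF L(1) W(1,2,3) q] W(4)[OF Normalizer_subgroup[OF sub_carrier[OF W(1)]] subset_Normalizer[OF W(1)]] by blast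
  then have "W \<lhd> G" using normal_iff_Normalizer[OF W(1)] by simp
  then show ?thesis using normal_maximal_prime_index[OF _ W(3,4)] W(2) by blast
qed

text \<open>
  Numbering \<open>E\<close> turns an action into a homomorphism to a symmetric group.
\<close>
lemma perm_rep:
  assumes a: "acts G (carrier G) E f" and n: "card E = n"
  shows "\<exists>\<phi> \<beta>. bij_betw \<beta> E {1..n} \<and> \<phi> \<in> hom G (sym_group n) \<and> (\<forall>g\<in>carrier G. \<forall>e\<in>E. \<phi> g (\<beta> e) = \<beta> (f g e))"
proof -
  note d = actsD[OF a]
  obtain h where h: "bij_betw h {1..n} E" using ex_bij_betw_nat_finite_1[OF d(3)] n by blast
  define \<beta> where "\<beta> = the_inv_into {1..n} h"
  have b: "bij_betw \<beta> E {1..n}" unfolding \<beta>_def by (rule bij_betw_the_inv_into[OF h])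
  have bh: "\<beta> (h i) = i" "h i \<in> E" if "i \<in> {1..n}" for i
    using the_inv_into_f_f[OF bij_betw_imp_inj_on[OF h] that] bij_betwE[OF h] that unfolding \<beta>_def by auto
  have hb: "h (\<beta> e) = e" "\<beta> e \<in> {1..n}" if "e \<in> E" for e
    using f_the_inv_into_f_bij_betw[OF h, of e] bij_betwE[OF b] that unfolding \<beta>_def by auto
  define \<phi> where "\<phi> g i = (if i \<in> {1..n} then \<beta> (f g (h i)) else i)" for g i
  have mul: "\<phi> (g \<otimes> g') = \<phi> g \<circ> \<phi> g'" if "g \<in> carrier G" "g' \<in> carrier G" for g g'
  proof
    fix i show "\<phi> (g \<otimes> g') i = (\<phi> g \<circ> \<phi> g') i"
    proof (cases "i \<in> {1..n}")
      case True
      then show ?thesis unfolding \<phi>_def comp_def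
        using that d(4)[OF that(2) bh(2)[OF True]] d(6)[OF that bh(2)[OF True]] hb by simp
    next
      case False
      then have "\<phi> x i = i" for x unfolding \<phi>_def by (rule if_not_P)
      then show ?thesis by simp
    qed
  qed
  have one: "\<phi> \<one> = id" by (rule ext) (simp add: \<phi>_def d(5) bh)
  have inv: "\<phi> g \<circ> \<phi> (inv g) = id" "\<phi> (inv g) \<circ> \<phi> g = id" if "g \<in> carrier G" for g
    using mul[of g "inv g"] mul[of "inv g" g] one that by simp_all
  have "\<phi> g permutes {1..n}" if g: "g \<in> carrier G" for g
  proof -
    have "bij (\<phi> g)" by (rule o_bij[OF inv(2,1)[OF g]])
    moreover have "\<forall>i. i \<notin> {1..n} \<longrightarrow> \<phi> g i = i" by (simp add: \<phi>_def)
    ultimately show ?thesis unfolding permutes_def bij_iff by blast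
  qed
  then have "\<phi> \<in> hom G (sym_group n)"
    unfolding hom_def sym_group_carrier sym_group_mult using mul by (auto simp: sym_group_def)
  moreover have "\<phi> g (\<beta> e) = \<beta> (f g e)" if "g \<in> carrier G" "e \<in> E" for g e
    unfolding \<phi>_def using hb[OF that(2)] by simp
  ultimately show ?thesis using b by blast
qed

lemma hom_image_card:
  assumes "group_hom G H \<phi>"
  shows "card (\<phi> ` carrier G) * card (kernel G H \<phi>) = card (carrier G)"
proof -
  interpret gh: group_hom G H \<phi> by fact
  have a: "acts G (carrier G) (\<phi> ` carrier G) (\<lambda>g e. \<phi> g \<otimes>\<^bsub>H\<^esub> e)"
    unfolding acts_def
  proof (intro conjI ballI)
    show "subgroup (carrier G) G" by (rule subgroup_self)
    show "finite (carrier G)" "finite (\<phi> ` carrier G)" using fin by simp_all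
    show "\<phi> g \<otimes>\<^bsub>H\<^esub> e \<in> \<phi> ` carrier G" if g: "g \<in> carrier G" and "e \<in> \<phi> ` carrier G" for g e
    proof -
      obtain x where x: "x \<in> carrier G" "e = \<phi> x" using \<open>e \<in> \<phi> ` carrier G\<close> by blast
      then have "\<phi> g \<otimes>\<^bsub>H\<^esub> e = \<phi> (g \<otimes> x)" using gh.hom_mult g by simp
      then show ?thesis using m_closed[OF g x(1)] by (metis image_eqI)
    qed
    show "\<phi> \<one> \<otimes>\<^bsub>H\<^esub> e = e" if "e \<in> \<phi> ` carrier G" for e
      using that gh.hom_closed by auto
    show "\<phi> (g \<otimes> h) \<otimes>\<^bsub>H\<^esub> e = \<phi> g \<otimes>\<^bsub>H\<^esub> (\<phi> h \<otimes>\<^bsub>H\<^esub> e)"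
      if "g \<in> carrier G" "h \<in> carrier G" "e \<in> \<phi> ` carrier G" for g h e
    proof -
      have "e \<in> carrier H" using that(3) gh.hom_closed by auto
      then show ?thesis using gh.hom_mult[OF that(1,2)] gh.hom_closed[OF that(1)] gh.hom_closed[OF that(2)]
        by (simp add: gh.H.m_assoc)
    qed
  qed
  have e: "\<one>\<^bsub>H\<^esub> \<in> \<phi> ` carrier G" using gh.hom_one one_closed by (metis image_eqI)
  have "(\<lambda>g. \<phi> g \<otimes>\<^bsub>H\<^esub> \<one>\<^bsub>H\<^esub>) ` carrier G = \<phi> ` carrier G"
    by (rule image_cong) (simp_all add: gh.hom_closed)
  moreover have "{g \<in> carrier G. \<phi> g \<otimes>\<^bsub>H\<^esub> \<one>\<^bsub>H\<^esub> = \<one>\<^bsub>H\<^esub>} = kernel G H \<phi>"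
    unfolding kernel_def using gh.hom_closed by auto
  ultimately show ?thesis using orbit_stabilizer[OF a e] by simp
qed

text \<open>
  The quotient by the kernel embeds into a symmetric group, which bounds its order by Lagrange.
\<close>
lemma action_kernel:
  assumes a: "acts G (carrier G) E f"
  defines "K \<equiv> {g \<in> carrier G. \<forall>e\<in>E. f g e = e}"
  shows "K \<lhd> G" "\<exists>d. d * card K = card (carrier G) \<and> d dvd fact (card E)"
proof -
  obtain \<phi> \<beta> where b: "bij_betw \<beta> E {1..card E}" and h: "\<phi> \<in> hom G (sym_group (card E))"
    and c: "\<And>g e. g \<in> carrier G \<Longrightarrow> e \<in> E \<Longrightarrow> \<phi> g (\<beta> e) = \<beta> (f g e)"
    using perm_rep[OF a refl] by blast
  have gh: "group_hom G (sym_group (card E)) \<phi>"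
    using h sym_group_is_group by (simp add: group_hom_def group_hom_axioms_def)
  interpret gh: group_hom G "sym_group (card E)" \<phi> by fact
  have K: "kernel G (sym_group (card E)) \<phi> = K"
  proof -
    have "\<phi> g = id \<longleftrightarrow> (\<forall>e\<in>E. f g e = e)" if g: "g \<in> carrier G" for g
    proof
      assume "\<phi> g = id"
      then have "\<beta> (f g e) = \<beta> e" if "e \<in> E" for e using c[OF g that] by simp
      then show "\<forall>e\<in>E. f g e = e" using b actsD(4)[OF a g] unfolding bij_betw_def inj_on_def by blast
    next
      assume f: "\<forall>e\<in>E. f g e = e"
      have p: "\<phi> g permutes {1..card E}" using gh.hom_closed[OF g] unfolding sym_group_carrier .
      show "\<phi> g = id"
      proof
        fix i show "\<phi> g i = id i"
        proof (cases "i \<in> {1..card E}")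
          case True
          then obtain e where e: "e \<in> E" "i = \<beta> e" using b unfolding bij_betw_def by blast
          then show ?thesis using c[OF g e(1)] f by simp
        next
          case False then show ?thesis using permutes_not_in[OF p] by simp
        qed
      qed
    qed
    then show ?thesis unfolding kernel_def K_def sym_group_one by blast
  qed
  show "K \<lhd> G" using gh.normal_kernel K by simp
  have "card (\<phi> ` carrier G) dvd fact (card E)"
  proof -
    have "subgroup (\<phi> ` carrier G) (sym_group (card E))" by (rule gh.img_is_subgroup)
    then have "card (rcosets\<^bsub>sym_group (card E)\<^esub> (\<phi> ` carrier G)) * card (\<phi> ` carrier G) = fact (card E)"
      using gh.H.lagrange unfolding order_def sym_group_card_carrier by simp
    then show ?thesis by (metis dvd_triv_right)
  qed
  then show "\<exists>d. d * card K = card (carrier G) \<and> d dvd fact (card E)"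
    using hom_image_card[OF gh] K by auto
qed

text \<open>
  The core of \<open>U\<close> is the kernel of the action on the cosets of \<open>U\<close>.
\<close>
lemma normal_core:
  assumes U: "subgroup U G" and n: "card U * n = card (carrier G)"
  shows "\<exists>K d. K \<lhd> G \<and> K \<subseteq> U \<and> d * card K = card (carrier G) \<and> d dvd fact n \<and> n dvd d \<and>
     (\<forall>N. N \<lhd> G \<longrightarrow> N \<subseteq> U \<longrightarrow> N \<subseteq> K)"
proof -
  define E where "E = (\<lambda>g. (\<otimes>) g ` U) ` carrier G"
  have Us: "U \<subseteq> carrier G" using sub_carrier[OF U] .
  have a: "acts G (carrier G) E (\<lambda>g C. (\<otimes>) g ` C)" unfolding E_def by (rule acts_cosets[OF subgroup_self U Us])
  have "card E * card U = card (carrier G)" unfolding E_def by (rule card_cosets[OF subgroup_self U Us])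
  then have cE: "card E = n" using n card_pos[OF U] by (metis mult.commute mult_left_cancel less_not_refl)
  define K where "K = {g \<in> carrier G. \<forall>e\<in>E. (\<otimes>) g ` e = e}"
  have WE: "U \<in> E" unfolding E_def using coset_eq_self[OF U one_closed] subgroup.one_closed[OF U] by (metis image_eqI one_closed)
  have KU: "K \<subseteq> U"
  proof
    fix x assume "x \<in> K"
    then have x: "x \<in> carrier G" "\<forall>e\<in>E. (\<otimes>) x ` e = e" unfolding K_def by simp_all
    show "x \<in> U" using coset_eq_self[OF U x(1)] bspec[OF x(2) WE] by (rule iffD1)
  qed
  obtain d where d: "d * card K = card (carrier G)" "d dvd fact n"
    using action_kernel(2)[OF a] unfolding cE K_def[symmetric] by blast
  have Kn: "K \<lhd> G" unfolding K_def by (rule action_kernel(1)[OF a])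
  have nd: "n dvd d"
  proof -
    obtain u where "card U = card K * u" using card_dvd[OF U normal_imp_subgroup[OF Kn] KU] by blast
    then have "card K * (u * n) = card K * d" using d(1) n by (simp add: ac_simps)
    then have "u * n = d" using card_pos[OF normal_imp_subgroup[OF Kn]] by simp
    then show ?thesis by (metis dvd_triv_right)
  qed
  have NK: "N \<subseteq> K" if N: "N \<lhd> G" "N \<subseteq> U" for N
  proof
    fix x assume x: "x \<in> N"
    have xc: "x \<in> carrier G" using x N(2) Us by blast
    have fx: "(\<otimes>) x ` ((\<otimes>) g ` U) = (\<otimes>) g ` U" if g: "g \<in> carrier G" for g
    proof -
      have "inv g \<otimes> x \<otimes> g \<in> N" using N(1) x g by (simp add: normal.inv_op_closed1)
      then have iU: "inv g \<otimes> x \<otimes> g \<in> U" using N(2) by blast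
      have "(\<otimes>) x ` ((\<otimes>) g ` U) = (\<otimes>) g ` ((\<otimes>) (inv g \<otimes> x \<otimes> g) ` U)"
        unfolding image_image
      proof (rule image_cong[OF refl])
        fix u assume "u \<in> U"
        then have u: "u \<in> carrier G" using Us by blast
        have "g \<otimes> (inv g \<otimes> x \<otimes> g \<otimes> u) = g \<otimes> (inv g \<otimes> (x \<otimes> (g \<otimes> u)))" using u xc g by (simp add: m_assoc)
        also have "\<dots> = x \<otimes> (g \<otimes> u)" using u xc g by (simp add: m_assoc[symmetric])
        finally show "x \<otimes> (g \<otimes> u) = g \<otimes> (inv g \<otimes> x \<otimes> g \<otimes> u)" by simp
      qed
      also have "(\<otimes>) (inv g \<otimes> x \<otimes> g) ` U = U" using coset_eq_self[OF U, of "inv g \<otimes> x \<otimes> g"] iU xc g by simp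
      finally show ?thesis .
    qed
    have "\<forall>e\<in>E. (\<otimes>) x ` e = e" unfolding E_def using fx by (intro ballI) (elim imageE, simp only:)
    then show "x \<in> K" using xc unfolding K_def by simp
  qed
  have "\<forall>N. N \<lhd> G \<longrightarrow> N \<subseteq> U \<longrightarrow> N \<subseteq> K" using NK by simp
  then show ?thesis using Kn KU d nd by (intro exI[of _ K] exI[of _ d] conjI)
qed

text \<open>
  Let \<open>d\<close> be the index of the core of \<open>U\<close>; it divides \<open>n!\<close> and is a multiple of \<open>n\<close>. Index 2 is normal. For \<open>n = 3\<close>
  the value \<open>d = 3\<close> is a normal subgroup of prime index, and \<open>d = 6\<close> yields a subgroup of index 2. For \<open>n = 4\<close> the possible \<open>d\<close>
  are 4, 8, 12 and 24, and a Sylow 2-subgroup of the quotient, or one half of it, has index 2 or 3. All subgroups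
  constructed contain \<open>L\<close>, so the statement also applies to the quotient by \<open>L\<close>.
\<close>
lemma no_small_index:
  assumes L: "L \<lhd> G" and no_prime_index: "\<And>N p. N \<lhd> G \<Longrightarrow> L \<subseteq> N \<Longrightarrow> prime p \<Longrightarrow> card N * p = card (carrier G) \<Longrightarrow> False"
    and U: "subgroup U G" "L \<subseteq> U" "card U * n = card (carrier G)"
  shows "n \<notin> {2, 3, 4}"
proof -
  have core: "\<exists>K d. K \<lhd> G \<and> L \<subseteq> K \<and> d * card K = card (carrier G) \<and> d dvd fact n \<and> n dvd d"
    if U: "subgroup U G" "L \<subseteq> U" "card U * n = card (carrier G)" for U n
  proof -
    obtain K d where K: "K \<lhd> G" "d * card K = card (carrier G)" "d dvd fact n" "n dvd d"
      "\<forall>N. N \<lhd> G \<longrightarrow> N \<subseteq> U \<longrightarrow> N \<subseteq> K"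
      using normal_core[OF U(1,3)] by (elim exE conjE)
    have "L \<subseteq> K" using K(5) L U(2) by simp
    then show ?thesis using K(1-4) by (intro exI[of _ K] exI[of _ d] conjI)
  qed
  have n2: False if U: "subgroup U G" "L \<subseteq> U" "card U * 2 = card (carrier G)" for U
  proof -
    obtain K d where K: "K \<lhd> G" "L \<subseteq> K" "d * card K = card (carrier G)" "d dvd fact 2" "2 dvd d" using core[OF U] by (elim exE conjE)
    have "d = 2" using K(4,5) by (simp add: dvd_antisym)
    then show False using no_prime_index[OF K(1,2), of 2] K(3) by simp
  qed
  have red: "\<exists>V. subgroup V G \<and> L \<subseteq> V \<and> card V * m = card (carrier G)"
    if K: "K \<lhd> G" "L \<subseteq> K" "d * card K = card (carrier G)" and p: "prime p" "d = p ^ k * m" for K d p k m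
  proof -
    have "card (carrier G) = m * (p ^ k * card K)" using K(3) p(2) by (simp add: ac_simps)
    then have "p ^ k * card K dvd card (carrier G)" by (metis dvd_triv_right)
    then obtain V where "subgroup V G" "K \<subseteq> V" "card V = p ^ k * card K"
      using rel_prime_power_subgroup[OF p(1) K(1)] by blast
    then show ?thesis using K(2,3) p(2) by (metis dual_order.trans mult.assoc mult.commute)
  qed
  have n3: False if U: "subgroup U G" "L \<subseteq> U" "card U * 3 = card (carrier G)" for U
  proof -
    obtain K d where K: "K \<lhd> G" "L \<subseteq> K" "d * card K = card (carrier G)" "d dvd fact 3" "3 dvd d" using core[OF U] by (elim exE conjE)
    have "d \<le> 6" "d \<noteq> 0" using K(4) dvd_imp_le[of d "fact 3"] by (auto simp: fact_numeral intro: ccontr)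
    then have "d = 3 \<or> d = 6" using K(5) by presburger
    then show False
    proof
      assume "d = 3" then show False using no_prime_index[OF K(1,2), of 3] K(3) by simp
    next
      assume "d = 6"
      then show False using red[OF K(1,2,3), of 3 1 2] n2 by auto
    qed
  qed
  have n4: False if U: "subgroup U G" "L \<subseteq> U" "card U * 4 = card (carrier G)" for U
  proof -
    obtain K d where K: "K \<lhd> G" "L \<subseteq> K" "d * card K = card (carrier G)" "d dvd fact 4" "4 dvd d" using core[OF U] by (elim exE conjE)
    have d24: "d dvd 24" using K(4) by (simp add: fact_numeral)
    then have "d \<le> 24" "d \<noteq> 0" using dvd_imp_le[of d 24] by (simp, intro notI) simp
    then have "d = 4 \<or> d = 8 \<or> d = 12 \<or> d = 16 \<or> d = 20 \<or> d = 24" using K(5) by presburger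
    then have "d = 2 ^ 1 * 2 \<or> d = 2 ^ 2 * 2 \<or> d = 2 ^ 2 * 3 \<or> d = 2 ^ 3 * 3" using d24 by auto
    then show False
    proof (elim disjE)
      assume "d = 2 ^ 1 * 2" then show False using red[OF K(1,2,3) two_is_prime_nat, of 1 2] n2 by auto
    next
      assume "d = 2 ^ 2 * 2" then show False using red[OF K(1,2,3) two_is_prime_nat, of 2 2] n2 by auto
    next
      assume "d = 2 ^ 2 * 3" then show False using red[OF K(1,2,3) two_is_prime_nat, of 2 3] n3 by auto
    next
      assume "d = 2 ^ 3 * 3" then show False using red[OF K(1,2,3) two_is_prime_nat, of 3 3] n3 by auto
    qed
  qed
  show ?thesis using n2 n3 n4 U by auto
qed

end

section \<open>Groups whose comaximal subgroup graph has parts of sizes 5 and 12\<close>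

context group begin
definition proper_nontriv :: "'a set set" where
  "proper_nontriv = {H. subgroup H G \<and> H \<noteq> {\<one>} \<and> H \<noteq> carrier G}"
end

text \<open>
  The properties of the graph of $A_5$ that determine the group. The parts are not ordered by size, because below the part
  that contains a given normal subgroup has to be called \<open>X\<close>. The bound 17 lies just above the number 16 of isolated
  vertices that the last surviving family of other groups can have.
\<close>
locale bipartite_comax = fin_group +
  fixes X Y :: "'a set set"
  assumes XV: "X \<subseteq> proper_nontriv" and YV: "Y \<subseteq> proper_nontriv" and XY_disj: "X \<inter> Y = {}"
    and edge: "\<And>H K. H \<in> proper_nontriv \<Longrightarrow> K \<in> proper_nontriv \<Longrightarrow>
      H <#> K = carrier G \<longleftrightarrow> (H \<in> X \<and> K \<in> Y) \<or> (H \<in> Y \<and> K \<in> X)"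
    and XY_card: "card X = 5 \<and> card Y = 12 \<or> card X = 12 \<and> card Y = 5"
    and isolated_dvd: "5 dvd card (proper_nontriv - X - Y)"
    and isolated_ge: "17 \<le> card (proper_nontriv - X - Y)"
begin

lemma swap: "bipartite_comax G Y X"
proof -
  have "proper_nontriv - Y - X = proper_nontriv - X - Y" by blast
  then show ?thesis
    using XV YV XY_disj edge XY_card isolated_dvd isolated_ge
    by unfold_locales auto
qed

lemma proper_nontrivD: "H \<in> proper_nontriv \<Longrightarrow> subgroup H G" "H \<in> proper_nontriv \<Longrightarrow> H \<noteq> {\<one>}" "H \<in> proper_nontriv \<Longrightarrow> H \<noteq> carrier G"
  unfolding proper_nontriv_def by auto

lemma proper_nontrivI: "subgroup H G \<Longrightarrow> H \<noteq> {\<one>} \<Longrightarrow> H \<noteq> carrier G \<Longrightarrow> H \<in> proper_nontriv"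
  unfolding proper_nontriv_def by auto

lemma fin_XY: "finite X" "finite Y"
  using XY_card card_gt_0_iff by (metis zero_neq_numeral card.infinite)+

end

text \<open>
  If \<open>M\<close> is not isolated, the part that contains it may be called \<open>X\<close>. The lemmas \<open>Y_I\<close> and \<open>YD\<close> then identify the
  other part with the proper subgroups outside \<open>M\<close>.
\<close>
locale comax_prime_index = bipartite_comax +
  fixes M p
  assumes M: "M \<lhd> G" and p: "prime p" and Mp: "card M * p = card (carrier G)" and MX: "M \<in> X"
begin

lemma Ms: "subgroup M G" using M normal_imp_subgroup by blast

lemma M_neq: "M \<noteq> carrier G" "M \<in> proper_nontriv"
proof -
  show "M \<in> proper_nontriv" using MX XV by blast
  then show "M \<noteq> carrier G" by (rule proper_nontrivD(3))
qed

lemma M_conjg: "g \<in> carrier G \<Longrightarrow> conjg g M = M"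
  using M normal_iff_conjg[OF Ms] by simp

lemma Y_I: assumes "subgroup H G" "H \<noteq> carrier G" "\<not> H \<subseteq> M" shows "H \<in> Y"
proof -
  have "H \<noteq> {\<one>}" using assms(3) subgroup.one_closed[OF Ms] by blast
  then have HV: "H \<in> proper_nontriv" using proper_nontrivI assms by simp
  have "M <#> H = carrier G" using prime_index_prod[OF M p Mp assms(1,3)] .
  then show ?thesis using edge[OF M_neq(2) HV] MX XY_disj by blast
qed

lemma YD: assumes "H \<in> Y" shows "subgroup H G" "H \<noteq> carrier G" "\<not> H \<subseteq> M" "H \<in> proper_nontriv"
proof -
  show HV: "H \<in> proper_nontriv" using assms YV by blast
  show s: "subgroup H G" and "H \<noteq> carrier G" using proper_nontrivD[OF HV] by auto
  show "\<not> H \<subseteq> M"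
  proof
    assume HM: "H \<subseteq> M"
    have "M <#> H \<subseteq> M" unfolding set_mult_def using HM subgroup.m_closed[OF Ms] by blast
    moreover have "M <#> H = carrier G" using edge[OF M_neq(2) HV] MX assms by simp
    ultimately show False using M_neq sub_carrier[OF Ms] by blast
  qed
qed

lemma Y_mono: "H \<in> Y \<Longrightarrow> subgroup K G \<Longrightarrow> H \<subseteq> K \<Longrightarrow> K \<noteq> carrier G \<Longrightarrow> K \<in> Y"
  using Y_I YD(3) by (meson order_trans)

lemma XD: assumes "H \<in> X" shows "subgroup H G" "H \<subseteq> M" "H \<in> proper_nontriv"
proof -
  show HV: "H \<in> proper_nontriv" using assms XV by blast
  show s: "subgroup H G" by (rule proper_nontrivD(1)[OF HV])
  show "H \<subseteq> M"
  proof (rule ccontr)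
    assume "\<not> H \<subseteq> M"
    then have "H \<in> Y" using Y_I s proper_nontrivD(3)[OF HV] by blast
    then show False using assms XY_disj by blast
  qed
qed

lemma XY_prod: "H \<in> X \<Longrightarrow> K \<in> Y \<Longrightarrow> H <#> K = carrier G"
  using edge[OF XD(3) YD(4)] by blast

lemma YY_prod: "H \<in> Y \<Longrightarrow> K \<in> Y \<Longrightarrow> H <#> K \<noteq> carrier G"
  using edge[OF YD(4) YD(4)] XY_disj by blast

lemma X_I: "H \<in> proper_nontriv \<Longrightarrow> K \<in> Y \<Longrightarrow> H <#> K = carrier G \<Longrightarrow> H \<in> X"
  using edge[OF _ YD(4), of H K] XY_disj by blast

lemma Y_conj_class: assumes y: "y \<in> Y" shows "conj_class y \<subseteq> Y"
proof
  fix e assume "e \<in> conj_class y"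
  then obtain g where g: "g \<in> carrier G" "e = conjg g y" unfolding conj_class_def by blast
  have yc: "y \<subseteq> carrier G" using sub_carrier[OF YD(1)[OF y]] .
  show "e \<in> Y"
  proof (rule Y_I)
    show "subgroup e G" using g conjg_subgroup[OF _ YD(1)[OF y]] by simp
    have "card e \<noteq> card (carrier G)"
      using card_conjg[OF g(1) yc] g(2) YD(2)[OF y] sub_eq_card[OF yc subgroup_self] by auto
    then show "e \<noteq> carrier G" by blast
    show "\<not> e \<subseteq> M"
    proof
      assume "e \<subseteq> M"
      then have "conjg (inv g) e \<subseteq> conjg (inv g) M" by (rule conjg_mono)
      then have "y \<subseteq> M" using conjg_inv(1)[OF g(1) yc] g(2) M_conjg[of "inv g"] g(1) by simp
      then show False using YD(3)[OF y] by simp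
    qed
  qed
qed

lemma pow_p_M: "x \<in> carrier G \<Longrightarrow> x [^] p \<in> M"
  using index_pow_mem[OF M, of p x] Mp by (simp add: mult.commute)

text \<open>
  Elements of order prime to \<open>p\<close> vanish in the quotient of order \<open>p\<close>.
\<close>
lemma coprime_order_in_M:
  assumes S: "subgroup S G" and c: "coprime (card S) p" shows "S \<subseteq> M"
proof
  fix u assume u: "u \<in> S"
  have uc: "u \<in> carrier G" using u subgroup.mem_carrier[OF S] by simp
  have "u [^] card S = \<one>"
  proof -
    have "ord u dvd card S"
      using card_dvd[OF S gen_sub[OF uc] gen_subset[OF S u]] generate_pow_card[OF uc] by simp
    then show ?thesis using pow_eq_id[OF uc] by simp
  qed
  then have "u [^] card S \<in> M" using subgroup.one_closed[OF Ms] by simp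
  then show "u \<in> M" using pow_coprime_mem[OF Ms uc _ pow_p_M[OF uc] c] by simp
qed

end

context fin_group begin

lemma coprime_inter:
  assumes "subgroup H G" "subgroup K G" "coprime (card H) (card K)" shows "H \<inter> K = {\<one>}"
proof -
  have I: "subgroup (H \<inter> K) G" using subgroups_Inter_pair assms by blast
  have "card (H \<inter> K) dvd card H" "card (H \<inter> K) dvd card K"
    using card_dvd[OF assms(1) I] card_dvd[OF assms(2) I] by auto
  then have "card (H \<inter> K) = 1" using assms(3) by (metis coprime_common_divisor_nat)
  then obtain z where "H \<inter> K = {z}" using card_1_singletonE by blast
  then show ?thesis using subgroup.one_closed[OF I] by auto
qed

lemma Normalizer_singleton:
  assumes "u \<in> carrier G" shows "g \<in> Normalizer {u} \<longleftrightarrow> g \<in> carrier G \<and> g \<otimes> u = u \<otimes> g"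
proof -
  have "g \<otimes> u \<otimes> inv g = u \<longleftrightarrow> g \<otimes> u = u \<otimes> g" if "g \<in> carrier G"
    using that assms by (metis inv_solve_right' m_closed)
  then show ?thesis unfolding Normalizer_def conjg_def by auto
qed

lemma ord_dvd_card: "subgroup S G \<Longrightarrow> u \<in> S \<Longrightarrow> u [^] card S = \<one>"
proof -
  assume S: "subgroup S G" and u: "u \<in> S"
  have uc: "u \<in> carrier G" using u subgroup.mem_carrier[OF S] by simp
  have "ord u dvd card S"
    using card_dvd[OF S gen_sub[OF uc] gen_subset[OF S u]] generate_pow_card[OF uc] by simp
  then show ?thesis using pow_eq_id[OF uc] by simp
qed

text \<open>
  The components are powers of the product \<open>u \<otimes> c\<close>, by the Chinese remainder theorem.
\<close>
lemma coprime_split: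
  assumes Q: "subgroup Q G" and C: "subgroup C G" and cop: "coprime (card Q) (card C)"
    and comm: "\<And>u c. u \<in> Q \<Longrightarrow> c \<in> C \<Longrightarrow> c \<otimes> u = u \<otimes> c"
    and S: "subgroup S G" and s: "u \<otimes> c \<in> S" "u \<in> Q" "c \<in> C"
  shows "u \<in> S" "c \<in> S"
proof -
  have uc: "u \<in> carrier G" "c \<in> carrier G" using s subgroup.mem_carrier[OF Q] subgroup.mem_carrier[OF C] by auto
  have pw: "(u \<otimes> c) [^] n = u [^] n \<otimes> c [^] n" for n :: nat
    using pow_mult_distrib[OF _ uc, of n] comm[OF s(2,3)] by simp
  obtain n where n: "[n = 1] (mod card Q)" "[n = 0] (mod card C)"
    using binary_chinese_remainder_nat[OF cop] by blast
  have "c [^] n = \<one>"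
  proof -
    obtain k where "n = card C * k" using n(2) by (auto simp: cong_0_iff)
    then show ?thesis using ord_dvd_card[OF C s(3)] uc(2) by (simp add: nat_pow_pow[symmetric])
  qed
  moreover have "u [^] n = u"
  proof -
    have "u [^] n = u [^] (1::nat)"
    proof -
      have "[n = 1] (mod ord u)"
      proof -
        have "ord u dvd card Q" using pow_eq_id[OF uc(1)] ord_dvd_card[OF Q s(2)] by simp
        then show ?thesis using n(1) cong_dvd_modulus_nat by blast
      qed
      then have "int (ord u) dvd int 1 - int n" unfolding cong_iff_dvd_diff cong_int_iff[symmetric] by (metis dvd_diff_commute)
      then show ?thesis using int_pow_eq[OF uc(1), of "int n" "int 1"] by (simp only: int_pow_int)
    qed
    then show ?thesis using uc by simp
  qed
  ultimately have "(u \<otimes> c) [^] n = u" using pw uc by simp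
  then show u: "u \<in> S" using pow_mem[OF S s(1)] by metis
  have "c = inv u \<otimes> (u \<otimes> c)" using uc by (simp add: m_assoc[symmetric])
  then show "c \<in> S" using subgroup.m_closed[OF S subgroup.m_inv_closed[OF S u] s(1)] by simp
qed

end

section \<open>A central p-th power is impossible\<close>

context comax_prime_index begin

text \<open>
  The group \<open>M\<close> is the direct product of \<open>Q\<close> and the group \<open>C\<close> generated by the \<open>p\<close>-th power of \<open>x\<close>, and the orders of the
  factors are coprime. Hence a subgroup \<open>S\<close> of \<open>M\<close> is given by its intersection with \<open>Q\<close> and its product with \<open>Q\<close>. The products
  are the subgroups between \<open>Q\<close> and \<open>M\<close>, and these are exactly the five members of \<open>X\<close>. So \<open>M\<close> has a multiple of five
  subgroups. On the other hand the subgroups of \<open>M\<close> are the trivial one, the five in \<open>X\<close> and the isolated vertices, and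
  the latter are also a multiple of five in number.
\<close>
lemma direct_product_impossible:
  assumes X5: "card X = 5" and Q: "Q \<lhd> G" and x: "x \<in> carrier G" "x \<notin> M" "ord x = p ^ a"
    and cop: "coprime (card Q) p" and QP: "Q <#> generate G {x} = carrier G"
    and Pne: "generate G {x} \<noteq> carrier G" and cen: "\<And>u. u \<in> Q \<Longrightarrow> x [^] p \<in> Normalizer {u}"
  shows False
proof -
  define P where "P = generate G {x}"
  define C where "C = generate G {x [^] p}"
  have Qs: "subgroup Q G" using Q normal_imp_subgroup by blast
  have Ps: "subgroup P G" unfolding P_def by (rule gen_sub[OF x(1)])
  have xP: "x \<in> P" unfolding P_def by (rule gen_in)
  have cP: "card P = p ^ a" unfolding P_def using generate_pow_card[OF x(1)] x(3) by simp
  have PY: "P \<in> Y" using Y_I[OF Ps] Pne xP x(2) unfolding P_def by blast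
  have Cs: "subgroup C G" unfolding C_def by (rule gen_sub[OF nat_pow_closed[OF x(1)]])
  have CM: "C \<subseteq> M" unfolding C_def by (rule gen_subset[OF Ms pow_p_M[OF x(1)]])
  have CP: "C \<subseteq> P" unfolding C_def by (rule gen_subset[OF Ps pow_mem[OF Ps xP]])
  have QM: "Q \<subseteq> M" by (rule coprime_order_in_M[OF Qs cop])
  have QPi: "Q \<inter> P = {\<one>}"
    by (rule coprime_inter[OF Qs Ps]) (use cop cP in simp)
  have cG: "card (carrier G) = card Q * card P"
    using QP prod_card_iff[OF Qs Ps] QPi unfolding P_def by simp
  have Qne: "Q \<noteq> {\<one>}"
  proof
    assume "Q = {\<one>}"
    then have "card P = card (carrier G)" using cG by simp
    then show False using Pne sub_eq_card[OF sub_carrier[OF Ps] subgroup_self] unfolding P_def by simp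
  qed
  have comm: "c \<otimes> u = u \<otimes> c" if u: "u \<in> Q" and c: "c \<in> C" for u c
  proof -
    have uc: "u \<in> carrier G" using u subgroup.mem_carrier[OF Qs] by simp
    have "C \<subseteq> Normalizer {u}" unfolding C_def
      by (rule gen_subset[OF Normalizer_subgroup cen[OF u]]) (use uc in simp)
    then show ?thesis using Normalizer_singleton[OF uc] c by blast
  qed
  have copQC: "coprime (card Q) (card C)"
  proof -
    have "card C dvd p ^ a" using card_dvd[OF Ps Cs CP] cP by simp
    then show ?thesis using cop by (meson coprime_divisors coprime_power_right_iff dvd_refl)
  qed
  have QC1: "Q \<inter> C = {\<one>}" by (rule coprime_inter[OF Qs Cs copQC])
  have Mdec: "\<exists>u\<in>Q. \<exists>c\<in>C. m = u \<otimes> c" if m: "m \<in> M" for m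
  proof -
    have "m \<in> Q <#> P" using m sub_carrier[OF Ms] QP unfolding P_def by blast
    then obtain u y where uy: "u \<in> Q" "y \<in> P" "m = u \<otimes> y" unfolding set_mult_def by blast
    have c: "u \<in> carrier G" "y \<in> carrier G" using uy subgroup.mem_carrier[OF Qs] subgroup.mem_carrier[OF Ps] by auto
    have "y = inv u \<otimes> m" using c uy(3) by (simp add: m_assoc[symmetric])
    then have yM: "y \<in> M" using subgroup.m_closed[OF Ms subgroup.m_inv_closed[OF Ms] m] QM uy(1) by blast
    obtain n where n: "y = x [^] (n::nat)" using gen_elem[OF x(1)] uy(2) unfolding P_def by blast
    have "p dvd n"
    proof (rule ccontr)
      assume "\<not> p dvd n"
      then have "coprime n p" using p by (metis coprime_commute prime_imp_coprime_nat)
      then show False using pow_coprime_mem[OF Ms x(1) _ pow_p_M[OF x(1)]] yM n x(2) by blast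
    qed
    then obtain k where "n = p * k" by blast
    then have "y = (x [^] p) [^] k" using n x(1) by (simp add: nat_pow_pow)
    then have "y \<in> C" using pow_mem[OF Cs gen_in[of "x [^] p", folded C_def]] by simp
    then show ?thesis using uy by blast
  qed
  have Xiff: "T \<in> X \<longleftrightarrow> subgroup T G \<and> Q \<subseteq> T \<and> T \<subseteq> M" for T
  proof
    assume T: "T \<in> X"
    have Ts: "subgroup T G" and TM: "T \<subseteq> M" using XD[OF T] by auto
    have TP: "card T * card P = card Q * card P * card (T \<inter> P)"
      using XY_prod[OF T PY] prod_card_iff[OF Ts Ps] cG by simp
    then have cT: "card T = card Q * card (T \<inter> P)" using card_pos[OF Ps] by (simp add: ac_simps)
    have R: "subgroup (T <#> Q) G" by (rule normal_mult_subgroup[OF Q Ts])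
    have I: "subgroup (T \<inter> Q) G" by (rule subgroups_Inter_pair[OF Ts Qs])
    obtain e where e: "card Q = card (T \<inter> Q) * e" using card_dvd[OF Qs I] by blast
    have "card (T <#> Q) * card (T \<inter> Q) = card T * e * card (T \<inter> Q)"
      using set_mult_inter_card[OF Ts Qs fin_sub[OF Ts] fin_sub[OF Qs]] e by (simp add: ac_simps)
    then have "card (T <#> Q) = card T * e" using card_pos[OF I] by simp
    then have "card T * e dvd card Q * p ^ a" using card_dvd_carrier[OF R] cG cP by simp
    then have "card Q * (card (T \<inter> P) * e) dvd card Q * p ^ a" using cT by (simp add: ac_simps)
    then have "card (T \<inter> P) * e dvd p ^ a" using card_pos[OF Qs] by simp
    then have "e dvd p ^ a" by (rule dvd_mult_right)
    moreover have "e dvd card Q" using e by simp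
    ultimately have "e = 1" using cop by (meson coprime_common_divisor_nat coprime_power_right_iff)
    then have "T \<inter> Q = Q" using sub_eq_card[of "T \<inter> Q" Q] Qs e by simp
    then show "subgroup T G \<and> Q \<subseteq> T \<and> T \<subseteq> M" using Ts TM by blast
  next
    assume T: "subgroup T G \<and> Q \<subseteq> T \<and> T \<subseteq> M"
    have "T \<in> proper_nontriv"
    proof (rule proper_nontrivI)
      show "subgroup T G" using T by simp
      show "T \<noteq> {\<one>}" using T Qne subgroup.one_closed[OF Qs] by blast
      show "T \<noteq> carrier G" using T M_neq sub_carrier[OF Ms] by blast
    qed
    moreover have "T <#> P = carrier G"
      by (rule prod_mono[of Q]) (use QP T sub_carrier Ps in \<open>auto simp: P_def\<close>)
    ultimately show "T \<in> X" using X_I[OF _ PY] by blast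
  qed
  define SM where "SM = {S. subgroup S G \<and> S \<subseteq> M}"
  define SQ where "SQ = {U. subgroup U G \<and> U \<subseteq> Q}"
  have finS: "finite SM" "finite SQ"
  proof -
    have "SM \<subseteq> Pow (carrier G)" "SQ \<subseteq> Pow (carrier G)" unfolding SM_def SQ_def using sub_carrier by auto
    then show "finite SM" "finite SQ" using fin finite_subset finite_Pow_iff by (metis (no_types))+
  qed
  have dec: "\<exists>u c. u \<in> S \<and> u \<in> Q \<and> c \<in> S \<and> c \<in> C \<and> s = u \<otimes> c" if S: "S \<in> SM" and s: "s \<in> S" for S s
  proof -
    have Ss: "subgroup S G" "s \<in> M" using S s unfolding SM_def by auto
    obtain u c where uc: "u \<in> Q" "c \<in> C" "s = u \<otimes> c" using Mdec[OF Ss(2)] by blast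
    have "u \<otimes> c \<in> S" using s uc by simp
    from coprime_split[OF Qs Cs copQC comm Ss(1) this uc(1,2)] show ?thesis using uc by blast
  qed
  \<comment> \<open>The inverse map uses that \<open>T\<close> is the product of \<open>T \<inter> C\<close> and \<open>Q\<close>, by the modular law.\<close>
  let ?f = "\<lambda>S. (S \<inter> Q, S <#> Q)" and ?g = "\<lambda>(U, T). (T \<inter> C) <#> U"
  have "bij_betw ?f SM (SQ \<times> X)"
  proof (rule bij_betw_byWitness[where f' = ?g])
    show "?f ` SM \<subseteq> SQ \<times> X"
    proof
      fix z assume "z \<in> ?f ` SM"
      then obtain S where S: "subgroup S G" "S \<subseteq> M" and z: "z = (S \<inter> Q, S <#> Q)" unfolding SM_def by blast
      have "S \<inter> Q \<in> SQ" unfolding SQ_def using subgroups_Inter_pair[OF S(1) Qs] by blast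
      moreover have "S <#> Q \<in> X" unfolding Xiff
      proof (intro conjI)
        show "subgroup (S <#> Q) G" by (rule normal_mult_subgroup[OF Q S(1)])
        show "Q \<subseteq> S <#> Q" by (rule subset_set_mult(2)[OF S(1) Qs])
        show "S <#> Q \<subseteq> M" unfolding set_mult_def using S(2) QM subgroup.m_closed[OF Ms] by blast
      qed
      ultimately show "z \<in> SQ \<times> X" using z by simp
    qed
    show "?g ` (SQ \<times> X) \<subseteq> SM"
    proof
      fix z assume "z \<in> ?g ` (SQ \<times> X)"
      then obtain U T where U: "subgroup U G" "U \<subseteq> Q" and T: "T \<in> X" and z: "z = (T \<inter> C) <#> U"
        unfolding SQ_def by auto
      have T': "subgroup T G" "T \<subseteq> M" using Xiff T by auto
      have TC: "subgroup (T \<inter> C) G" by (rule subgroups_Inter_pair[OF T'(1) Cs])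
      have "T \<inter> C \<subseteq> Normalizer U"
      proof
        fix c assume c: "c \<in> T \<inter> C"
        have cc: "c \<in> carrier G" using c subgroup.mem_carrier[OF Cs] by blast
        have "c \<otimes> u \<otimes> inv c = u" if "u \<in> U" for u
        proof -
          have "u \<in> carrier G" "c \<otimes> u = u \<otimes> c" using that U comm c subgroup.mem_carrier[OF U(1)] by auto
          then show ?thesis using cc by (simp add: m_assoc)
        qed
        then have "conjg c U = U" unfolding conjg_def by simp
        then show "c \<in> Normalizer U" unfolding Normalizer_def using cc by simp
      qed
      then have "subgroup z G" unfolding z by (rule normalizing_mult_subgroup[OF TC U(1)])
      moreover have "z \<subseteq> M" unfolding z set_mult_def using T'(2) U(2) QM subgroup.m_closed[OF Ms] by blast
      ultimately show "z \<in> SM" unfolding SM_def by simp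
    qed
    show "\<forall>S\<in>SM. ?g (?f S) = S"
    proof
      fix S assume S: "S \<in> SM"
      have Ss: "subgroup S G" using S unfolding SM_def by simp
      have "((S <#> Q) \<inter> C) <#> (S \<inter> Q) = S"
      proof (intro equalityI subsetI)
        fix s assume s: "s \<in> S"
        obtain u c where uc: "u \<in> S" "u \<in> Q" "c \<in> S" "c \<in> C" "s = u \<otimes> c" using dec[OF S s] by blast
        have "s = c \<otimes> u" using comm[OF uc(2,4)] uc(5) by simp
        moreover have "c \<in> (S <#> Q) \<inter> C" using uc(3,4) subset_set_mult(1)[OF Ss Qs] by blast
        ultimately show "s \<in> ((S <#> Q) \<inter> C) <#> (S \<inter> Q)" unfolding set_mult_def using uc(1,2) by blast
      next
        fix s assume "s \<in> ((S <#> Q) \<inter> C) <#> (S \<inter> Q)"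
        then obtain y v where yv: "y \<in> S <#> Q" "y \<in> C" "v \<in> S" "s = y \<otimes> v" unfolding set_mult_def[of _ "(S <#> Q) \<inter> C"] by blast
        then obtain t q where tq: "t \<in> S" "q \<in> Q" "y = t \<otimes> q" unfolding set_mult_def by blast
        obtain u c where uc: "u \<in> S" "u \<in> Q" "c \<in> S" "c \<in> C" "t = u \<otimes> c" using dec[OF S tq(1)] by blast
        have cc: "u \<in> carrier G" "c \<in> carrier G" "q \<in> carrier G" "y \<in> carrier G"
          using uc tq yv subgroup.mem_carrier[OF Qs] subgroup.mem_carrier[OF Cs] by auto
        have "y = u \<otimes> q \<otimes> c" using tq(3) uc(5) comm[OF tq(2) uc(4)] cc by (simp add: m_assoc)
        then have "y \<otimes> inv c = u \<otimes> q" using cc by (simp add: m_assoc)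
        moreover have "u \<otimes> q \<in> Q" using subgroup.m_closed[OF Qs uc(2) tq(2)] .
        moreover have "y \<otimes> inv c \<in> C" using subgroup.m_closed[OF Cs yv(2) subgroup.m_inv_closed[OF Cs uc(4)]] .
        ultimately have "y \<otimes> inv c \<in> Q \<inter> C" by simp
        then have "y \<otimes> inv c = \<one>" using QC1 by simp
        then have "y = c" using cc by (metis inv_solve_right' l_one one_closed)
        then show "s \<in> S" using subgroup.m_closed[OF Ss uc(3) yv(3)] yv(4) by simp
      qed
      then show "?g (?f S) = S" by simp
    qed
    show "\<forall>z\<in>SQ \<times> X. ?f (?g z) = z"
    proof
      fix z assume "z \<in> SQ \<times> X"
      then obtain U T where U: "subgroup U G" "U \<subseteq> Q" and T: "T \<in> X" and z: "z = (U, T)"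
        unfolding SQ_def by auto
      have T': "subgroup T G" "T \<subseteq> M" "Q \<subseteq> T" using Xiff T by auto
      have TC: "subgroup (T \<inter> C) G" by (rule subgroups_Inter_pair[OF T'(1) Cs])
      have 1: "((T \<inter> C) <#> U) \<inter> Q = U"
      proof (intro equalityI subsetI)
        fix s assume "s \<in> ((T \<inter> C) <#> U) \<inter> Q"
        then obtain c u where cu: "c \<in> C" "u \<in> U" "s = c \<otimes> u" "s \<in> Q" unfolding set_mult_def by blast
        have cc: "c \<in> carrier G" "u \<in> carrier G" using cu subgroup.mem_carrier[OF Cs] subgroup.mem_carrier[OF U(1)] by auto
        have "c = s \<otimes> inv u" using cu(3) cc by (simp add: m_assoc)
        then have "c \<in> Q" using subgroup.m_closed[OF Qs cu(4) subgroup.m_inv_closed[OF Qs]] U(2) cu(2) by blast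
        then have "c = \<one>" using cu(1) QC1 by blast
        then show "s \<in> U" using cu cc by simp
      next
        fix s assume s: "s \<in> U"
        then show "s \<in> ((T \<inter> C) <#> U) \<inter> Q" using subset_set_mult(2)[OF TC U(1)] U(2) by blast
      qed
      have 2: "((T \<inter> C) <#> U) <#> Q = T"
      proof (intro equalityI subsetI)
        fix s assume "s \<in> ((T \<inter> C) <#> U) <#> Q"
        then obtain c u q where cu: "c \<in> T" "u \<in> U" "q \<in> Q" "s = c \<otimes> u \<otimes> q" unfolding set_mult_def by blast
        then show "s \<in> T" using subgroup.m_closed[OF T'(1)] T'(3) U(2) by blast
      next
        fix s assume s: "s \<in> T"
        have "T \<in> SM" unfolding SM_def using T' by simp
        then obtain u c where uc: "u \<in> T" "u \<in> Q" "c \<in> T" "c \<in> C" "s = u \<otimes> c" using dec s by blast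
        have "s = c \<otimes> u" using comm[OF uc(2,4)] uc(5) by simp
        moreover have "c \<in> (T \<inter> C) <#> U" using uc subset_set_mult(1)[OF TC U(1)] by blast
        ultimately show "s \<in> ((T \<inter> C) <#> U) <#> Q" unfolding set_mult_def[of _ _ Q] using uc(2) by blast
      qed
      show "?f (?g z) = z" using z 1 2 by simp
    qed
  qed
  from bij_betw_same_card[OF this] have "card SM = card SQ * 5"
    by (simp only: card_cartesian_product X5)
  moreover have "card SM = 1 + 5 + card (proper_nontriv - X - Y)"
  proof -
    have SMeq: "SM = {{\<one>}} \<union> X \<union> (proper_nontriv - X - Y)"
    proof (intro equalityI subsetI)
      fix S assume "S \<in> SM"
      then have S: "subgroup S G" "S \<subseteq> M" unfolding SM_def by auto
      have "S \<notin> Y" using YD(3) S by blast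
      moreover have "S \<noteq> carrier G" using S M_neq sub_carrier[OF Ms] by blast
      ultimately show "S \<in> {{\<one>}} \<union> X \<union> (proper_nontriv - X - Y)" using proper_nontrivI[OF S(1)] by blast
    next
      fix S assume "S \<in> {{\<one>}} \<union> X \<union> (proper_nontriv - X - Y)"
      then consider "S = {\<one>}" | "S \<in> X" | "S \<in> proper_nontriv" "S \<notin> Y" by blast
      then show "S \<in> SM"
      proof cases
        case 1 then show ?thesis unfolding SM_def using triv_subgroup subgroup.one_closed[OF Ms] by simp
      next
        case 2 then show ?thesis unfolding SM_def using XD by simp
      next
        case 3 then show ?thesis unfolding SM_def using proper_nontrivD[OF 3(1)] Y_I by blast
      qed
    qed
    have fI: "finite (proper_nontriv - X - Y)" by (rule card_ge_0_finite) (use isolated_ge in linarith)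
    have one: "{\<one>} \<notin> X" "{\<one>} \<notin> proper_nontriv" using XV unfolding proper_nontriv_def by auto
    have "card (insert {\<one>} X \<union> (proper_nontriv - X - Y)) = card (insert {\<one>} X) + card (proper_nontriv - X - Y)"
      by (rule card_Un_disjoint) (use fI fin_XY one in auto)
    then show ?thesis unfolding SMeq using X5 fin_XY one by simp
  qed
  ultimately have "card SQ * 5 = 6 + card (proper_nontriv - X - Y)" by simp
  then show False using isolated_dvd by presburger
qed

end

section \<open>Proper normal subgroups lie inside M\<close>

context fin_group begin

lemma pow_ord_dvd: "subgroup H G \<Longrightarrow> x \<in> carrier G \<Longrightarrow> x [^] (p::nat) \<in> H \<Longrightarrow> x \<notin> H \<Longrightarrow> prime p \<Longrightarrow> x [^] (n::nat) \<in> H \<longleftrightarrow> p dvd n"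
proof
  assume H: "subgroup H G" and x: "x \<in> carrier G" "x [^] p \<in> H" "x \<notin> H" and p: "prime p"
  {
    assume n: "x [^] n \<in> H"
    show "p dvd n"
    proof (rule ccontr)
      assume "\<not> p dvd n"
      then have "coprime n p" using p by (metis coprime_commute prime_imp_coprime_nat)
      then show False using pow_coprime_mem[OF H x(1) n x(2)] x(3) by simp
    qed
  }
  {
    assume "p dvd n"
    then obtain k where "n = p * k" by blast
    then show "x [^] n \<in> H" using pow_mem[OF H x(2), of k] x(1) by (simp add: nat_pow_pow)
  }
qed

text \<open>
  The number of conjugates is the index of the normalizer, which contains \<open>L\<close>.
\<close>
lemma card_conj_class_ge5:
  assumes L: "L \<lhd> G" and no_prime_index: "\<And>N p. N \<lhd> G \<Longrightarrow> L \<subseteq> N \<Longrightarrow> prime p \<Longrightarrow> card N * p = card (carrier G) \<Longrightarrow> False"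
    and U: "subgroup U G" "L \<subseteq> U" "\<not> U \<lhd> G"
  shows "5 \<le> card (conj_class U)"
proof -
  have Uc: "U \<subseteq> carrier G" using sub_carrier[OF U(1)] .
  have cm: "card (Normalizer U) * card (conj_class U) = card (carrier G)" using card_conj_class[OF Uc] by (simp add: mult.commute)
  have 1: "card (conj_class U) \<notin> {2, 3, 4}"
  proof (rule no_small_index[OF L _ Normalizer_subgroup[OF Uc]])
    show "L \<subseteq> Normalizer U" using U(2) subset_Normalizer[OF U(1)] by blast
    show "card (Normalizer U) * card (conj_class U) = card (carrier G)" by (rule cm)
    show False if "N \<lhd> G" "L \<subseteq> N" "prime p" "card N * p = card (carrier G)" for N p
      using that by (rule no_prime_index)
  qed
  have "card (conj_class U) \<noteq> 0" using fin_conj_class self_in_conj_class[OF Uc] by (metis card_0_eq empty_iff)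
  moreover have "card (conj_class U) \<noteq> 1"
  proof
    assume "card (conj_class U) = 1"
    then have "card (Normalizer U) = card (carrier G)" using card_conj_class[OF Uc] by simp
    then have "Normalizer U = carrier G" using sub_eq_card[OF sub_carrier[OF Normalizer_subgroup[OF Uc]] subgroup_self] by simp
    then show False using normal_iff_Normalizer[OF U(1)] U(3) by simp
  qed
  ultimately show ?thesis using 1 by auto
qed

lemma conj_class_disjoint:
  assumes "A \<subseteq> carrier G" "B \<subseteq> carrier G" "card A \<noteq> card B" shows "conj_class A \<inter> conj_class B = {}"
  using conj_class_card[OF assms(1)] conj_class_card[OF assms(2)] assms(3) by fastforce

lemma exists_maximal_normal:
  assumes L: "L \<lhd> G" "L \<noteq> carrier G"
  shows "\<exists>K. K \<lhd> G \<and> L \<subseteq> K \<and> K \<noteq> carrier G \<and> (\<forall>U. U \<lhd> G \<longrightarrow> K \<subseteq> U \<longrightarrow> U \<noteq> carrier G \<longrightarrow> U = K)"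
proof -
  define A where "A = {W. W \<lhd> G \<and> L \<subseteq> W \<and> W \<noteq> carrier G}"
  have "A \<subseteq> Pow (carrier G)" unfolding A_def using sub_carrier normal_imp_subgroup by blast
  then have "finite A" by (rule finite_subset) (simp add: fin)
  moreover have "L \<in> A" using L unfolding A_def by simp
  ultimately have "\<exists>W\<in>A. L \<subseteq> W \<and> (\<forall>U\<in>A. W \<subseteq> U \<longrightarrow> W = U)"
    by (rule finite_has_maximal2)
  then obtain W where W: "W \<in> A" "\<forall>U\<in>A. W \<subseteq> U \<longrightarrow> W = U" by blast
  have w: "W \<lhd> G" "L \<subseteq> W" "W \<noteq> carrier G" using W(1) unfolding A_def by auto
  moreover have "U = W" if "U \<lhd> G" "W \<subseteq> U" "U \<noteq> carrier G" for U
  proof -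
    have "U \<in> A" using that w(2) unfolding A_def by simp
    then show ?thesis using W(2) that(2) by blast
  qed
  ultimately show ?thesis by blast
qed

end

context comax_prime_index begin

text \<open>
  An element \<open>z\<close> outside both subgroups generates the group, since otherwise the cyclic subgroup it generates is in \<open>Y\<close> and
  multiplies to the group with \<open>L\<close>, another member of \<open>Y\<close>. A cyclic group is excluded by
  \<open>direct_product_impossible\<close>, applied to its \<open>p\<close>-part and its complement.
\<close>
lemma two_prime_index_impossible_five:
  assumes X5: "card X = 5" and L: "L \<lhd> G" "prime p'" "card L * p' = card (carrier G)" "\<not> L \<subseteq> M"
  shows False
proof -
  have Ls: "subgroup L G" using L(1) normal_imp_subgroup by blast
  have Lne: "L \<noteq> carrier G"
    using L(3) prime_gt_1_nat[OF L(2)] card_pos[OF Ls] by auto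
  have LY: "L \<in> Y" by (rule Y_I[OF Ls Lne L(4)])
  have nML: "\<not> M \<subseteq> L"
  proof
    assume "M \<subseteq> L"
    then have "M <#> L \<subseteq> L" unfolding set_mult_def using subgroup.m_closed[OF Ls] by blast
    then show False using XY_prod[OF MX LY] Lne sub_carrier[OF Ls] by blast
  qed
  obtain a b where ab: "a \<in> M" "a \<notin> L" "b \<in> L" "b \<notin> M" using nML L(4) by blast
  \<comment> \<open>A group is not the union of two proper subgroups.\<close>
  define z where "z = a \<otimes> b"
  have abc: "a \<in> carrier G" "b \<in> carrier G" using ab sub_carrier Ms Ls by blast+
  have zc: "z \<in> carrier G" unfolding z_def using abc by simp
  have zM: "z \<notin> M"
  proof
    assume "z \<in> M"
    then have "inv a \<otimes> z \<in> M" using subgroup.m_closed[OF Ms subgroup.m_inv_closed[OF Ms ab(1)]] by blast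
    moreover have "inv a \<otimes> z = b" unfolding z_def using abc by (simp add: m_assoc[symmetric])
    ultimately show False using ab by simp
  qed
  have zL: "z \<notin> L"
  proof
    assume "z \<in> L"
    then have "z \<otimes> inv b \<in> L" using subgroup.m_closed[OF Ls _ subgroup.m_inv_closed[OF Ls ab(3)]] by blast
    moreover have "z \<otimes> inv b = a" unfolding z_def using abc by (simp add: m_assoc)
    ultimately show False using ab by simp
  qed
  have Z: "generate G {z} = carrier G"
  proof (rule ccontr)
    assume ne: "generate G {z} \<noteq> carrier G"
    have "generate G {z} \<in> Y" by (rule Y_I[OF gen_sub[OF zc] ne]) (use gen_in zM in blast)
    moreover have "L <#> generate G {z} = carrier G"
      by (rule prime_index_prod[OF L(1-3) gen_sub[OF zc]]) (use gen_in zL in blast)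
    ultimately show False using YY_prod[OF LY] by blast
  qed
  have cG: "card (carrier G) = ord z" using generate_pow_card[OF zc] Z by simp
  have zpL: "z [^] p' \<in> L" using index_pow_mem[OF L(1) _ zc, of p'] L(3) by (simp add: mult.commute)
  have powM: "z [^] n \<in> M \<longleftrightarrow> p dvd n" for n :: nat by (rule pow_ord_dvd[OF Ms zc pow_p_M[OF zc] zM p])
  have powL: "z [^] n \<in> L \<longleftrightarrow> p' dvd n" for n :: nat by (rule pow_ord_dvd[OF Ls zc zpL zL L(2)])
  have elem: "\<exists>n::nat. y = z [^] n" if "y \<in> carrier G" for y using gen_elem[OF zc, of y] that Z by simp
  have pp: "p \<noteq> p'"
  proof
    assume "p = p'"
    obtain n where "b = z [^] (n::nat)" using elem[OF abc(2)] by blast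
    then show False using powM[of n] powL[of n] ab(3,4) \<open>p = p'\<close> by simp
  qed
  define k m where "k = multiplicity p (ord z)" and "m = ord z div p ^ k"
  have oz: "ord z = p ^ k * m" unfolding k_def m_def by (rule dvd_mult_div_cancel[OF multiplicity_dvd, symmetric])
  have pm: "\<not> p dvd m" unfolding m_def k_def
    by (rule multiplicity_decompose) (use ord_pos[OF zc] p in auto)
  have mpos: "m > 0" using oz ord_pos[OF zc] by (cases m) auto
  have kpos: "p ^ k > 0" using prime_gt_0_nat[OF p] by simp
  define x where "x = z [^] m"
  define Q where "Q = generate G {z [^] (p ^ k)}"
  have xc: "x \<in> carrier G" unfolding x_def using zc by simp
  have ox: "ord x = p ^ k" unfolding x_def using ord_pow_gen[OF zc, of m] oz mpos by (simp add: gcd_mult_left)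
  have "ord (z [^] (p ^ k)) = m"
  proof -
    have "ord (z [^] (p ^ k)) = ord z div gcd (ord z) (p ^ k)" 
      using ord_pow_gen[OF zc, of "p ^ k"] by (simp only: if_not_P[OF gr_implies_not0[OF kpos]])
    also have "gcd (ord z) (p ^ k) = p ^ k" unfolding oz by (simp add: gcd_nat.absorb2)
    also have "ord z div p ^ k = m" by (simp only: m_def)
    finally show ?thesis .
  qed
  then have oQ: "card Q = m" unfolding Q_def using generate_pow_card[OF nat_pow_closed[OF zc, of "p ^ k"]] by simp
  have cop: "coprime m p" using pm p by (metis coprime_commute prime_imp_coprime_nat)
  have Qs: "subgroup Q G" unfolding Q_def by (rule gen_sub[OF nat_pow_closed[OF zc]])
  have comm: "y \<otimes> w = w \<otimes> y" if y: "y \<in> carrier G" and w: "w \<in> carrier G" for y w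
  proof -
    obtain i where "y = z [^] (i::nat)" using elem[OF y] by blast
    moreover obtain j where "w = z [^] (j::nat)" using elem[OF w] by blast
    ultimately show ?thesis using zc by (simp add: nat_pow_mult add.commute)
  qed
  have Qn: "Q \<lhd> G" unfolding normal_inv_iff
  proof (intro conjI ballI Qs)
    fix y h assume y: "y \<in> carrier G" and h: "h \<in> Q"
    have hc: "h \<in> carrier G" using h subgroup.mem_carrier[OF Qs] by simp
    have "y \<otimes> h \<otimes> inv y = h" using comm[OF y hc] y hc by (simp add: m_assoc)
    then show "y \<otimes> h \<otimes> inv y \<in> Q" using h by simp
  qed
  have Ps: "subgroup (generate G {x}) G" by (rule gen_sub[OF xc])
  have cP: "card (generate G {x}) = p ^ k" using generate_pow_card[OF xc] ox by simp
  have "Q \<inter> generate G {x} = {\<one>}" by (rule coprime_inter[OF Qs Ps]) (use cop cP oQ in simp)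
  then have QP: "Q <#> generate G {x} = carrier G"
    using prod_card_iff[OF Qs Ps] cP oQ cG oz by simp
  have "p' dvd p ^ k * m" using L(3) cG oz by (metis dvd_triv_right)
  then have "p' dvd m" using L(2) p pp by (metis prime_dvd_mult_iff prime_dvd_power primes_dvd_imp_eq)
  then have "x \<in> L" unfolding x_def using powL by simp
  then have "generate G {x} \<subseteq> L" by (rule gen_subset[OF Ls])
  then have Pne: "generate G {x} \<noteq> carrier G" using Lne sub_carrier[OF Ls] by blast
  show False
  proof (rule direct_product_impossible[OF X5 Qn xc _ ox _ QP Pne])
    show "x \<notin> M" unfolding x_def using powM pm by simp
    show "coprime (card Q) p" using oQ cop by simp
    fix u assume u: "u \<in> Q"
    have uc: "u \<in> carrier G" using u subgroup.mem_carrier[OF Qs] by simp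
    then show "x [^] p \<in> Normalizer {u}" using comm[OF nat_pow_closed[OF xc] uc] xc by (simp add: Normalizer_singleton)
  qed
qed

text \<open>
  Exactly one of the two parts has five members. If it is \<open>Y\<close>, the roles of \<open>M\<close> and \<open>L\<close> are exchanged.
\<close>
lemma prime_index_normal_unique:
  assumes L: "L \<lhd> G" "prime p'" "card L * p' = card (carrier G)" "\<not> L \<subseteq> M"
  shows False
proof (cases "card X = 5")
  case True then show ?thesis using two_prime_index_impossible_five L by blast
next
  case False
  then have Y5: "card Y = 5" using XY_card by blast
  have Ls: "subgroup L G" using L(1) normal_imp_subgroup by blast
  have Lne: "L \<noteq> carrier G"
    using L(3) prime_gt_1_nat[OF L(2)] card_pos[OF Ls] by auto
  have LY: "L \<in> Y" by (rule Y_I[OF Ls Lne L(4)])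
  have nML: "\<not> M \<subseteq> L"
  proof
    assume "M \<subseteq> L"
    then have "M <#> L \<subseteq> L" unfolding set_mult_def using subgroup.m_closed[OF Ls] by blast
    then show False using XY_prod[OF MX LY] Lne sub_carrier[OF Ls] by blast
  qed
  have "comax_prime_index G Y X L p'"
    by (intro comax_prime_index.intro swap comax_prime_index_axioms.intro L(1-3) LY)
  from comax_prime_index.two_prime_index_impossible_five[OF this Y5 M p Mp nML] show False .
qed

text \<open>
  Subgroups of different orders are not conjugate.
\<close>
lemma three_classes:
  assumes Y: "A \<in> Y" "B \<in> Y" "C \<in> Y" and d: "card A \<noteq> card B" "card A \<noteq> card C" "card B \<noteq> card C"
  shows "card (conj_class A) + card (conj_class B) + card (conj_class C) \<le> 12"
proof -
  have c: "A \<subseteq> carrier G" "B \<subseteq> carrier G" "C \<subseteq> carrier G" using YD(1) Y sub_carrier by blast+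
  have "conj_class A \<inter> conj_class B = {}" "(conj_class A \<union> conj_class B) \<inter> conj_class C = {}"
    using conj_class_disjoint[OF c(1,2) d(1)] conj_class_disjoint[OF c(1,3) d(2)] conj_class_disjoint[OF c(2,3) d(3)] by auto
  then have "card (conj_class A \<union> conj_class B \<union> conj_class C) = card (conj_class A) + card (conj_class B) + card (conj_class C)"
    using fin_conj_class by (simp add: card_Un_disjoint)
  moreover have "card (conj_class A \<union> conj_class B \<union> conj_class C) \<le> card Y"
    by (rule card_mono[OF fin_XY(2)]) (use Y_conj_class Y in auto)
  ultimately show ?thesis using XY_card by auto
qed

text \<open>
  Enlarge a normal subgroup outside \<open>M\<close> to a maximal normal one \<open>L\<close>. By \<open>prime_index_normal_unique\<close> the simple quotient by
  \<open>L\<close> has no prime order. The preimage of each of its Sylow subgroups is a proper subgroup outside \<open>M\<close> with at least five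
  conjugates. Two primes are not enough, because then two such preimages multiply to the group although both are in
  \<open>Y\<close>; three primes give 15 members of \<open>Y\<close>.
\<close>
lemma normal_sub_M:
  assumes L0: "L0 \<lhd> G" "L0 \<noteq> carrier G"
  shows "L0 \<subseteq> M"
proof (rule ccontr)
  assume nL0: "\<not> L0 \<subseteq> M"
  obtain L where L: "L \<lhd> G" "L0 \<subseteq> L" "L \<noteq> carrier G"
    and max: "\<And>U. U \<lhd> G \<Longrightarrow> L \<subseteq> U \<Longrightarrow> U \<noteq> carrier G \<Longrightarrow> U = L"
    using exists_maximal_normal[OF L0] by blast
  have Ls: "subgroup L G" using L(1) normal_imp_subgroup by blast
  have nL: "\<not> L \<subseteq> M" using nL0 L(2) by blast
  have no_prime_index: False if N: "N \<lhd> G" "L \<subseteq> N" "prime q" "card N * q = card (carrier G)" for N q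
    using prime_index_normal_unique[OF N(1,3,4)] nL N(2) by blast
  obtain n where n: "card (carrier G) = card L * n" using card_dvd_carrier[OF Ls] by blast
  have Lpos: "card L > 0" using card_pos[OF Ls] .
  have nne: "n \<noteq> 1" using n L(3) sub_eq_card[OF sub_carrier[OF Ls] subgroup_self] by auto
  have npos: "n > 0" using n card_pos[OF subgroup_self] by (cases n) auto
  have rel: "\<exists>U k m. U \<in> Y \<and> L \<subseteq> U \<and> card U = q ^ k * card L \<and> k \<noteq> 0 \<and> n = q ^ k * m \<and> \<not> q dvd m \<and> m \<noteq> 1 \<and> 5 \<le> card (conj_class U)"
    if q: "prime q" "q dvd n" for q
  proof -
    define k m where "k = multiplicity q n" and "m = n div q ^ k"
    have nm: "n = q ^ k * m" unfolding k_def m_def by (rule dvd_mult_div_cancel[OF multiplicity_dvd, symmetric])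
    have qm: "\<not> q dvd m" unfolding m_def k_def
      by (rule multiplicity_decompose) (use npos q in auto)
    have k0: "k \<noteq> 0"
    proof
      assume "k = 0" then show False using nm qm q(2) by simp
    qed
    have "card (carrier G) = (q ^ k * card L) * m" using n nm by (simp add: ac_simps)
    then have "q ^ k * card L dvd card (carrier G)" by (rule dvdI)
    then obtain U where U: "subgroup U G" "L \<subseteq> U" "card U = q ^ k * card L"
      using rel_prime_power_subgroup[OF q(1) L(1)] by blast
    have Une: "U \<noteq> carrier G"
    proof
      assume "U = carrier G"
      then have "card (carrier G) = q ^ k * card L" using U(3) by simp
      then show False using rel_p_group_prime_index[OF L(1,3) q(1)] no_prime_index by blast
    qed
    have "U \<noteq> L"
    proof
      assume "U = L"
      then have "q ^ k = 1" using U(3) Lpos by simp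
      then show False using k0 prime_gt_1_nat[OF q(1)] by simp
    qed
    then have nU: "\<not> U \<lhd> G" using max[of U] U(2) Une by blast
    have U5: "5 \<le> card (conj_class U)"
    proof (rule card_conj_class_ge5[OF L(1) _ U(1,2) nU])
      show False if "N \<lhd> G" "L \<subseteq> N" "prime p" "card N * p = card (carrier G)" for N p
        using that by (rule no_prime_index)
    qed
    have UY: "U \<in> Y" by (rule Y_I[OF U(1) Une]) (use nL U(2) in blast)
    have m1: "m \<noteq> 1"
    proof
      assume "m = 1"
      then have "card U = card (carrier G)" using U(3) n nm by (simp add: mult.commute)
      then show False using Une sub_eq_card[OF sub_carrier[OF U(1)] subgroup_self] by simp
    qed
    show ?thesis using UY U(2,3) k0 nm qm m1 U5 by (intro exI[of _ U] exI[of _ k] exI[of _ m] conjI)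
  qed
  have ppne: "q ^ k * card L \<noteq> q' ^ k' * card L" if "prime q" "prime q'" "q \<noteq> q'" "k \<noteq> 0" for q q' k k'
  proof
    assume "q ^ k * card L = q' ^ k' * card L"
    then have "q ^ k = q' ^ k'" using Lpos by simp
    then have "q dvd q' ^ k'" using that(4) by (metis dvd_power neq0_conv)
    then have "q dvd q'" using prime_dvd_power[OF that(1)] by blast
    then show False using that(1-3) primes_dvd_imp_eq by blast
  qed
  obtain q1 where q1: "prime q1" "q1 dvd n" using prime_factor_nat[OF nne] by blast
  obtain U1 k1 m1 where U1: "U1 \<in> Y" "L \<subseteq> U1" "card U1 = q1 ^ k1 * card L" "k1 \<noteq> 0" "n = q1 ^ k1 * m1" "\<not> q1 dvd m1" "m1 \<noteq> 1" "5 \<le> card (conj_class U1)"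
    using rel[OF q1] by (elim exE conjE)
  obtain q2 where q2: "prime q2" "q2 dvd m1" using prime_factor_nat[OF U1(7)] by blast
  have q12: "q1 \<noteq> q2" using U1(6) q2(2) by blast
  have "q2 dvd n" using q2(2) U1(5) by simp
  from rel[OF q2(1) this] obtain U2 k2 m2 where U2: "U2 \<in> Y" "L \<subseteq> U2" "card U2 = q2 ^ k2 * card L" "k2 \<noteq> 0" "n = q2 ^ k2 * m2" "\<not> q2 dvd m2" "m2 \<noteq> 1" "5 \<le> card (conj_class U2)"
    by (elim exE conjE)
  \<comment> \<open>If the index of \<open>L\<close> had only the prime divisors \<open>q1\<close> and \<open>q2\<close>, then \<open>U1\<close> and \<open>U2\<close> would be adjacent.\<close>
  have cop12: "coprime (q1 ^ k1) (q2 ^ k2)"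
    using primes_coprime[OF q1(1) q2(1) q12] by simp
  have "q1 ^ k1 * q2 ^ k2 dvd n"
  proof (rule divides_mult[OF _ _ cop12])
    show "q1 ^ k1 dvd n" by (rule dvdI[OF U1(5)])
    show "q2 ^ k2 dvd n" by (rule dvdI[OF U2(5)])
  qed
  then obtain m3 where m3: "n = q1 ^ k1 * q2 ^ k2 * m3" by blast
  have "m3 \<noteq> 1"
  proof
    assume "m3 = 1"
    have s: "subgroup U1 G" "subgroup U2 G" using YD(1) U1(1) U2(1) by auto
    have I: "subgroup (U1 \<inter> U2) G" by (rule subgroups_Inter_pair[OF s])
    have LI: "L \<subseteq> U1 \<inter> U2" using U1(2) U2(2) by blast
    obtain c where c: "card (U1 \<inter> U2) = card L * c" using card_dvd[OF I Ls LI] by blast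
    have "card L * c dvd card L * q1 ^ k1" "card L * c dvd card L * q2 ^ k2"
      using card_dvd[OF s(1) I] card_dvd[OF s(2) I] c U1(3) U2(3) by (auto simp: mult.commute)
    then have "c dvd q1 ^ k1" "c dvd q2 ^ k2" using Lpos by simp_all
    then have "c = 1" using cop12 by (metis coprime_common_divisor_nat)
    then have "card (U1 \<inter> U2) = card L" using c by simp
    moreover have "card (carrier G) = card L * (q1 ^ k1 * q2 ^ k2)" using n m3 \<open>m3 = 1\<close> by (simp only: mult_1_right)
    ultimately have "card U1 * card U2 = card (carrier G) * card (U1 \<inter> U2)"
      by (simp only: U1(3) U2(3) ac_simps)
    then have "U1 <#> U2 = carrier G" using prod_card_iff[OF s] by (rule iffD2[rotated])
    then show False using YY_prod[OF U1(1) U2(1)] by simp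
  qed
  then obtain q3 where q3: "prime q3" "q3 dvd m3" using prime_factor_nat by blast
  have "m1 = q2 ^ k2 * m3" using m3 U1(5) q1(1) by (simp add: ac_simps prime_gt_0_nat)
  then have q13: "q1 \<noteq> q3" using U1(6) q3(2) by auto
  have "q2 ^ k2 * m2 = q2 ^ k2 * (q1 ^ k1 * m3)" using m3 U2(5) by (simp add: ac_simps)
  then have "m2 = q1 ^ k1 * m3" using prime_gt_0_nat[OF q2(1)] by simp
  then have q23: "q2 \<noteq> q3" using U2(6) q3(2) by auto
  have "q3 dvd n" using q3(2) m3 by simp
  from rel[OF q3(1) this] obtain U3 k3 m4 where U3: "U3 \<in> Y" "L \<subseteq> U3" "card U3 = q3 ^ k3 * card L" "k3 \<noteq> 0" "n = q3 ^ k3 * m4" "\<not> q3 dvd m4" "m4 \<noteq> 1" "5 \<le> card (conj_class U3)"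
    by (elim exE conjE)
  have "card (conj_class U1) + card (conj_class U2) + card (conj_class U3) \<le> 12"
    by (rule three_classes[OF U1(1) U2(1) U3(1)])
      (simp_all only: U1(3) U2(3) U3(3) ppne[OF q1(1) q2(1) q12 U1(4)] ppne[OF q1(1) q3(1) q13 U1(4)] ppne[OF q2(1) q3(1) q23 U2(4)] not_False_eq_True)
  then show False using U1(8) U2(8) U3(8) by linarith
qed

end

section \<open>A cyclic Sylow subgroup with a normal complement\<close>

text \<open>
  The exceptions to prime powers in this range are 6, 10 and 12.
\<close>
lemma index_cases:
  fixes r :: nat
  assumes "2 < r" "r \<le> 12"
  shows "(\<exists>q k. prime q \<and> r = q ^ k \<and> k \<noteq> 0) \<or> (\<exists>q. even r \<and> r \<ge> 6 \<and> prime q \<and> q \<noteq> 2 \<and> q dvd r)"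
proof -
  have "r = 3 \<or> r = 4 \<or> r = 5 \<or> r = 6 \<or> r = 7 \<or> r = 8 \<or> r = 9 \<or> r = 10 \<or> r = 11 \<or> r = 12" using assms by presburger
  then show ?thesis
  proof (elim disjE)
    assume "r = 3" then show ?thesis by (intro disjI1 exI[of _ 3] exI[of _ "1::nat"]) simp
  next
    assume "r = 4" then show ?thesis by (intro disjI1 exI[of _ 2] exI[of _ "2::nat"]) simp
  next
    assume "r = 5" then show ?thesis by (intro disjI1 exI[of _ 5] exI[of _ "1::nat"]) simp
  next
    assume "r = 6" then show ?thesis by (intro disjI2 exI[of _ 3]) simp
  next
    assume "r = 7" then show ?thesis by (intro disjI1 exI[of _ 7] exI[of _ "1::nat"]) simp
  next
    assume "r = 8" then show ?thesis by (intro disjI1 exI[of _ 2] exI[of _ "3::nat"]) simp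
  next
    assume "r = 9" then show ?thesis by (intro disjI1 exI[of _ 3] exI[of _ "2::nat"]) simp
  next
    assume "r = 10" then show ?thesis by (intro disjI2 exI[of _ 5]) simp
  next
    assume "r = 11" then show ?thesis by (intro disjI1 exI[of _ 11] exI[of _ "1::nat"]) simp
  next
    assume "r = 12" then show ?thesis by (intro disjI2 exI[of _ 3]) simp
  qed
qed

context comax_prime_index begin

lemma carrier_not_sub_M: "\<not> carrier G \<subseteq> M"
  using subset_antisym[OF sub_carrier[OF Ms]] M_neq(1) by auto

lemma Y_not_normal: "y \<in> Y \<Longrightarrow> \<not> y \<lhd> G"
  using normal_sub_M[of y] YD(2,3)[of y] by blast

lemma Normalizer_Y: assumes y: "y \<in> Y" shows "Normalizer y \<in> Y"
proof -
  have s: "subgroup y G" using YD(1)[OF y] .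
  have "Normalizer y \<noteq> carrier G" using Y_not_normal[OF y] normal_iff_Normalizer[OF s] by simp
  then show ?thesis using Y_mono[OF y Normalizer_subgroup[OF sub_carrier[OF s]] subset_Normalizer[OF s]] by simp
qed

text \<open>
  A \<open>p\<close>-element \<open>x\<close> of \<open>y\<close> outside \<open>M\<close> fixes the vertex \<open>y\<close>. If there are at most \<open>p\<close> conjugates, all orbits of \<open>x\<close> on
  them are trivial, so the kernel of the action on the class is a normal subgroup outside \<open>M\<close>, that is, everything.
\<close>
lemma card_conj_class_Y: assumes y: "y \<in> Y" shows "p + 1 \<le> card (conj_class y)"
proof (rule ccontr)
  assume "\<not> p + 1 \<le> card (conj_class y)"
  then have le: "card (conj_class y) \<le> p" by simp
  have s: "subgroup y G" "y \<subseteq> carrier G" using YD(1)[OF y] sub_carrier by auto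
  obtain x k where x: "x \<in> y" "x \<notin> M" "ord x = p ^ k"
    using p_element_outside[OF M p Mp s(1) YD(3)[OF y]] by blast
  have xc: "x \<in> carrier G" using x(1) s by blast
  define R where "R = generate G {x}"
  have R: "subgroup R G" "R \<subseteq> y" "card R = p ^ k"
    unfolding R_def using gen_sub[OF xc] gen_subset[OF s(1) x(1)] generate_pow_card[OF xc] x(3) by auto
  have sub: "e \<subseteq> carrier G" if "e \<in> conj_class y" for e using conj_class_subgroup[OF s(1) that] sub_carrier by blast
  have aG: "acts G (carrier G) (conj_class y) conjg"
    by (rule acts_conjg[OF subgroup_self sub conj_class_conjg[OF s(2)]])
  have aR: "acts G R (conj_class y) conjg" by (rule acts_restrict[OF aG R(1) sub_carrier[OF R(1)]])
  define F where "F = {e \<in> conj_class y. \<forall>g\<in>R. conjg g e = e}"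
  have m: "card (conj_class y) mod p = card F mod p" unfolding F_def by (rule p_group_fixed_points[OF aR p R(3)])
  have FC: "F \<subseteq> conj_class y" unfolding F_def by simp
  have yF: "y \<in> F" unfolding F_def using self_in_conj_class[OF s(2)] conjg_self[OF s(1)] R(2) by auto
  have "card F > 0" using yF FC fin_conj_class by (metis card_gt_0_iff empty_iff finite_subset)
  moreover have "card F \<le> card (conj_class y)" by (rule card_mono[OF fin_conj_class FC])
  ultimately have "card F = card (conj_class y)"
  proof (cases "card (conj_class y) = p")
    case True
    then have "p dvd card F" using m by (simp add: mod_eq_0_iff_dvd)
    then show ?thesis using \<open>card F > 0\<close> \<open>card F \<le> card (conj_class y)\<close> True dvd_imp_le[of p "card F"] by simp
  next
    case False
    then show ?thesis using m le \<open>card F \<le> card (conj_class y)\<close> by simp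
  qed
  then have "F = conj_class y" using card_subset_eq[OF fin_conj_class FC] by simp
  then have fx: "conjg x e = e" if "e \<in> conj_class y" for e using that gen_in[of x] unfolding F_def R_def by blast
  \<comment> \<open>The element \<open>x\<close> fixes the whole class, so it lies in the kernel of the action on the class.\<close>
  define J where "J = {g \<in> carrier G. \<forall>e\<in>conj_class y. conjg g e = e}"
  have Jn: "J \<lhd> G" unfolding J_def by (rule action_kernel(1)[OF aG])
  have "x \<in> J" unfolding J_def using xc fx by simp
  then have "J = carrier G" using normal_sub_M[OF Jn] x(2) by blast
  then have "\<forall>g\<in>carrier G. conjg g y = y" using self_in_conj_class[OF s(2)] unfolding J_def by blast
  then have "y \<lhd> G" using normal_iff_conjg[OF s(1)] by simp
  then show False using Y_not_normal[OF y] by simp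
qed

lemma card_Y_le: "card Y \<le> 12" using XY_card by auto

lemma Y_nonempty: "\<exists>y. y \<in> Y"
proof -
  have "card Y \<noteq> 0" using XY_card by auto
  then show ?thesis by (metis card.empty ex_in_conv)
qed

text \<open>
  Were the group a \<open>p\<close>-group, a maximal member of \<open>Y\<close> would be normal.
\<close>
lemma syl_p_Y: assumes P: "sylow_subgroup p P (carrier G)" shows "P \<in> Y"
proof (rule Y_I)
  have Ps: "subgroup P G" by (rule sylD(1)[OF P])
  show "subgroup P G" by fact
  show "\<not> P \<subseteq> M"
  proof
    assume PM: "P \<subseteq> M"
    obtain c where c: "card M = card P * c" using card_dvd[OF Ms Ps PM] by blast
    have "card (carrier G) = card P * (c * p)" using Mp c by (simp add: ac_simps)
    then have "card (carrier G) div card P = c * p" using card_pos[OF Ps] by simp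
    then show False using sylD(4)[OF P] by simp
  qed
  show "P \<noteq> carrier G"
  proof
    assume PG: "P = carrier G"
    obtain a where a: "card P = p ^ a" using sylD(3)[OF P] by blast
    obtain y where y: "y \<in> Y" using Y_nonempty by blast
    obtain W where W: "subgroup W G" "y \<subseteq> W" "W \<noteq> carrier G"
      "\<And>U. subgroup U G \<Longrightarrow> W \<subseteq> U \<Longrightarrow> U \<noteq> carrier G \<Longrightarrow> U = W"
      using exists_maximal[OF YD(1,2)[OF y]] by blast
    have WY: "W \<in> Y" by (rule Y_mono[OF y W(1,2,3)])
    have "Normalizer W = W" using W(4)[OF _ subset_Normalizer[OF W(1)]] YD(1,2)[OF Normalizer_Y[OF WY]] by simp
    moreover have "Normalizer W \<noteq> W"
    proof (rule normalizer_grows[OF _ W(1) _ W(3) p])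
      show "{\<one>} \<lhd> G" by (rule one_is_normal)
      show "{\<one>} \<subseteq> W" using subgroup.one_closed[OF W(1)] by simp
      show "card (carrier G) = p ^ a * card {\<one>}" using a PG by simp
    qed
    ultimately show False by simp
  qed
qed

lemma prime_pow_outside: "prime q \<Longrightarrow> q \<noteq> p \<Longrightarrow> coprime (q ^ b) p"
  using primes_coprime[OF _ p] by simp

lemma syl_q_sub_M: assumes q: "prime q" "q \<noteq> p" and S: "sylow_subgroup q S (carrier G)"
  shows "S \<subseteq> M" "sylow_subgroup q S M"
proof -
  obtain b where b: "card S = q ^ b" using sylD(3)[OF S] by blast
  show SM: "S \<subseteq> M" by (rule coprime_order_in_M[OF sylD(1)[OF S]]) (use prime_pow_outside[OF q] b in simp)
  obtain c where c: "card M = card S * c" using card_dvd[OF Ms sylD(1)[OF S] SM] by blast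
  have "card (carrier G) = card S * (c * p)" using Mp c by (simp add: ac_simps)
  then have "card (carrier G) div card S = c * p" using card_pos[OF sylD(1)[OF S]] by simp
  then have "\<not> q dvd c" using sylD(4)[OF S] dvd_mult2[of q c p] by (intro notI) simp
  then have "\<not> q dvd card M div card S" unfolding c using card_pos[OF sylD(1)[OF S]] by simp
  then show "sylow_subgroup q S M" unfolding sylow_subgroup_def using sylD(1,3)[OF S] SM by (intro conjI)
qed

text \<open>
  Otherwise the Frattini argument places the whole group inside \<open>M\<close>.
\<close>
lemma syl_q_Normalizer: assumes q: "prime q" "q \<noteq> p" and S: "sylow_subgroup q S (carrier G)"
  shows "\<not> Normalizer S \<subseteq> M"
proof
  assume *: "Normalizer S \<subseteq> M"
  have MN: "M <#> Normalizer S = carrier G" by (rule frattini[OF M q(1) syl_q_sub_M(2)[OF q S]])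
  have "M <#> Normalizer S \<subseteq> M" unfolding set_mult_def using * subgroup.m_closed[OF Ms] by blast
  then have "carrier G \<subseteq> M" unfolding MN .
  then show False using carrier_not_sub_M by simp
qed

text \<open>
  The Sylow subgroup \<open>S\<close> for \<open>q\<close> is normalized by a \<open>p\<close>-element \<open>x\<close> outside \<open>M\<close>; the product of \<open>S\<close> with the group generated by
  \<open>x\<close> is proper because its order is prime to \<open>q'\<close>.
\<close>
lemma mixed_member:
  assumes q: "prime q" "q \<noteq> p" "q dvd card (carrier G)"
    and q': "prime q'" "q' \<noteq> p" "q' \<noteq> q" "q' dvd card (carrier G)"
  shows "\<exists>y b c. y \<in> Y \<and> card y = q ^ b * p ^ c \<and> b \<noteq> 0 \<and> \<not> q ^ Suc b dvd card (carrier G)"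
proof -
  obtain S where S: "sylow_subgroup q S (carrier G)" using syl_exists[OF q(1) subgroup_self] by blast
  obtain b where b: "card S = q ^ b" using sylD(3)[OF S] by blast
  have Ss: "subgroup S G" by (rule sylD(1)[OF S])
  have nq: "\<not> q ^ Suc b dvd card (carrier G)"
  proof
    assume "q ^ Suc b dvd card (carrier G)"
    then obtain e where "card (carrier G) = q ^ Suc b * e" by blast
    then have "card (carrier G) = card S * (q * e)" using b by (simp add: ac_simps)
    then have "card (carrier G) div card S = q * e" using card_pos[OF Ss] by simp
    then show False using sylD(4)[OF S] by simp
  qed
  have "b \<noteq> 0"
  proof
    assume "b = 0" then show False using nq q(3) by simp
  qed
  have NS: "subgroup (Normalizer S) G" by (rule Normalizer_subgroup[OF sub_carrier[OF Ss]])
  obtain x c where x: "x \<in> Normalizer S" "x \<notin> M" "ord x = p ^ c"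
    using p_element_outside[OF M p Mp NS syl_q_Normalizer[OF q(1,2) S]] by blast
  have xc: "x \<in> carrier G" using x(1) NormalizerD(1) by blast
  have Rs: "subgroup (generate G {x}) G" by (rule gen_sub[OF xc])
  have cR: "card (generate G {x}) = p ^ c" using generate_pow_card[OF xc] x(3) by simp
  define y where "y = generate G {x} <#> S"
  have ys: "subgroup y G" unfolding y_def
    by (rule normalizing_mult_subgroup[OF Rs Ss gen_subset[OF NS x(1)]])
  have "generate G {x} \<inter> S = {\<one>}"
    by (rule coprime_inter[OF Rs Ss]) (use cR b primes_coprime[OF p q(1)] q(2) in simp)
  then have cy: "card y = q ^ b * p ^ c"
    using set_mult_inter_card[OF Rs Ss fin_sub[OF Rs] fin_sub[OF Ss]] cR b unfolding y_def by simp
  have "y \<noteq> carrier G"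
  proof
    assume "y = carrier G"
    then have "q' dvd q ^ b * p ^ c" using q'(4) cy by simp
    then have "q' dvd q ^ b \<or> q' dvd p ^ c" by (rule prime_dvd_multD[OF q'(1)])
    then have "q' dvd q \<or> q' dvd p" using prime_dvd_power[OF q'(1)] by blast
    then show False using primes_dvd_imp_eq[OF q'(1) q(1)] primes_dvd_imp_eq[OF q'(1) p] q'(2,3) by auto
  qed
  moreover have "\<not> y \<subseteq> M" using subset_set_mult(1)[OF Rs Ss] gen_in[of x] x(2) unfolding y_def by blast
  ultimately have "y \<in> Y" using Y_I[OF ys] by blast
  then show ?thesis using cy \<open>b \<noteq> 0\<close> nq by blast
qed

text \<open>
  Let \<open>N\<close> be a maximal subgroup above a Sylow \<open>p\<close>-subgroup, and \<open>r\<close> its index, which equals the number of its conjugates.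
  If \<open>r\<close> is 6, 10 or 12, two primes other than \<open>p\<close> divide the order of the group, and \<open>mixed_member\<close> provides
  two further classes in \<open>Y\<close>, of sizes at least \<open>p + 1\<close>; together with \<open>r\<close> this exceeds 12.
  If \<open>r\<close> is a power of \<open>q\<close>, a Sylow \<open>q\<close>-subgroup \<open>S\<close> is transitive on the cosets of \<open>N\<close>, so \<open>S\<close> is in \<open>X\<close>.
  By completeness of the bipartite graph \<open>S\<close> multiplies to the group with every member of \<open>Y\<close>: with the cyclic group
  generated by a \<open>p\<close>-element outside \<open>M\<close>, and with the normalizer of \<open>S\<close> if the latter is proper. The second is absurd as
  the normalizer contains \<open>S\<close>.
\<close>
lemma cyclic_sylow_complement:
  shows "\<exists>q Q b x a. prime q \<and> q \<noteq> p \<and> Q \<lhd> G \<and> card Q = q ^ b \<and> x \<in> carrier G \<and> x \<notin> M \<and> ord x = p ^ a \<and>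
    Q <#> generate G {x} = carrier G \<and> Q \<in> X \<and> sylow_subgroup p (generate G {x}) (carrier G)"
proof -
  obtain P where P: "sylow_subgroup p P (carrier G)" using syl_exists[OF p subgroup_self] by blast
  have PY: "P \<in> Y" by (rule syl_p_Y[OF P])
  have Ps: "subgroup P G" by (rule sylD(1)[OF P])
  obtain N where N: "subgroup N G" "P \<subseteq> N" "N \<noteq> carrier G"
      "\<And>U. subgroup U G \<Longrightarrow> N \<subseteq> U \<Longrightarrow> U \<noteq> carrier G \<Longrightarrow> U = N"
    using exists_maximal[OF YD(1,2)[OF PY]] by blast
  have NY: "N \<in> Y" by (rule Y_mono[OF PY N(1,2,3)])
  have NN: "Normalizer N = N" using N(4)[OF _ subset_Normalizer[OF N(1)]] YD(1,2)[OF Normalizer_Y[OF NY]] by simp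
  define r where "r = card (conj_class N)"
  have rN: "card (carrier G) = r * card N" using card_conj_class[OF sub_carrier[OF N(1)]] NN unfolding r_def by simp
  have rge: "p + 1 \<le> r" unfolding r_def by (rule card_conj_class_Y[OF NY])
  have rle: "r \<le> 12" unfolding r_def using card_mono[OF fin_XY(2) Y_conj_class[OF NY]] card_Y_le by linarith
  have pr: "\<not> p dvd r"
  proof
    assume "p dvd r"
    obtain c where "card N = card P * c" using card_dvd[OF N(1) Ps N(2)] by blast
    then have "card (carrier G) = card P * (r * c)" using rN by (simp add: ac_simps)
    then have "card (carrier G) div card P = r * c" using card_pos[OF Ps] by simp
    then show False using sylD(4)[OF P] \<open>p dvd r\<close> by simp
  qed
  have p2: "p \<ge> 2" using prime_ge_2_nat[OF p] .
  have "(\<exists>q k. prime q \<and> r = q ^ k \<and> k \<noteq> 0) \<or> (\<exists>q. even r \<and> r \<ge> 6 \<and> prime q \<and> q \<noteq> 2 \<and> q dvd r)"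
    by (rule index_cases) (use rge rle p2 in auto)
  then show ?thesis
  proof
    assume "\<exists>q. even r \<and> r \<ge> 6 \<and> prime q \<and> q \<noteq> 2 \<and> q dvd r"
    then obtain q where q: "even r" "r \<ge> 6" "prime q" "q \<noteq> 2" "q dvd r" by blast
    have qp: "q \<noteq> p" "2 \<noteq> p" using pr q by blast+
    have qG: "q dvd card (carrier G)" "2 dvd card (carrier G)" using rN q by simp_all
    obtain y2 b2 c2 where y2: "y2 \<in> Y" "card y2 = 2 ^ b2 * p ^ c2" "b2 \<noteq> 0" "\<not> 2 ^ Suc b2 dvd card (carrier G)"
      using mixed_member[OF two_is_prime_nat qp(2) qG(2) q(3) qp(1) q(4) qG(1)] by blast
    obtain yq bq cq where yq: "yq \<in> Y" "card yq = q ^ bq * p ^ cq" "bq \<noteq> 0" "\<not> q ^ Suc bq dvd card (carrier G)"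
      using mixed_member[OF q(3) qp(1) qG(1) two_is_prime_nat qp(2) q(4)[symmetric] qG(2)] by blast
    have nn: "card N \<noteq> q' ^ b' * p ^ c'" if q': "q' dvd r" and nd: "\<not> q' ^ Suc b' dvd card (carrier G)" for q' b' c'
    proof
      assume e: "card N = q' ^ b' * p ^ c'"
      have "q' ^ Suc b' dvd r * card N" unfolding e by (simp add: mult_dvd_mono q')
      then show False using nd rN by simp
    qed
    have "card y2 \<noteq> card yq"
    proof
      assume e: "card y2 = card yq"
      have "even (card y2)" unfolding y2(2) using y2(3) by simp
      then have "even (q ^ bq * p ^ cq)" unfolding e yq(2) .
      then have "2 dvd q ^ bq \<or> 2 dvd p ^ cq" by (rule prime_dvd_multD[OF two_is_prime_nat])
      then have "2 dvd q \<or> 2 dvd p" using prime_dvd_power[OF two_is_prime_nat] by blast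
      then show False using primes_dvd_imp_eq[OF two_is_prime_nat q(3)] primes_dvd_imp_eq[OF two_is_prime_nat p] q(4) qp(2) by auto
    qed
    then have "card (conj_class N) + card (conj_class y2) + card (conj_class yq) \<le> 12"
      using three_classes[OF NY y2(1) yq(1)] nn[OF q(1) y2(4), of c2] nn[OF q(5) yq(4), of cq] y2(2) yq(2) by simp
    then show ?thesis using q(2) card_conj_class_Y[OF y2(1)] card_conj_class_Y[OF yq(1)] qp(2) p2 unfolding r_def by linarith
  next
    assume "\<exists>q k. prime q \<and> r = q ^ k \<and> k \<noteq> 0"
    then obtain q k where q: "prime q" "r = q ^ k" "k \<noteq> 0" by blast
    have qr: "q dvd r" using q by simp
    have qp: "q \<noteq> p" using pr qr by blast
    have qG: "q dvd card (carrier G)" using qr rN by simp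
    obtain S where S: "sylow_subgroup q S (carrier G)" using syl_exists[OF q(1) subgroup_self] by blast
    obtain b where b: "card S = q ^ b" using sylD(3)[OF S] by blast
    have Ss: "subgroup S G" by (rule sylD(1)[OF S])
    obtain m where m: "card (carrier G) = card S * m" using card_dvd_carrier[OF Ss] by blast
    have qm: "\<not> q dvd m" using sylD(4)[OF S] m card_pos[OF Ss] by simp
    have q0: "q > 0" using prime_gt_0_nat[OF q(1)] .
    have b0: "b \<noteq> 0"
    proof
      assume "b = 0" then show False using qm m b qG by simp
    qed
    \<comment> \<open>The intersection has index at least \<open>q ^ k\<close> in \<open>S\<close>, as \<open>N\<close> lacks this factor of the order.\<close>
    have SN: "S <#> N = carrier G"
    proof -
      have I: "subgroup (S \<inter> N) G" by (rule subgroups_Inter_pair[OF Ss N(1)])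
      obtain c where c: "card (S \<inter> N) = q ^ c"
        using card_dvd[OF Ss I] b divides_primepow_nat[OF q(1)] by auto
      have "q ^ c dvd card N" using card_dvd[OF N(1) I] c by simp
      then have "q ^ (c + k) dvd card (carrier G)" unfolding rN q(2) by (simp add: power_add mult_dvd_mono mult.commute)
      then have "q ^ (c + k) dvd q ^ b * m" using m b by simp
      moreover have "coprime (q ^ (c + k)) m" using qm q(1) by (simp add: prime_imp_coprime_nat)
      ultimately have "q ^ (c + k) dvd q ^ b" by (simp add: coprime_dvd_mult_left_iff)
      then have ck: "c + k \<le> b" using q(1) by (metis power_dvd_imp_le prime_gt_1_nat)
      have "card (S <#> N) * q ^ c = q ^ b * card N"
        using set_mult_inter_card[OF Ss N(1) fin_sub[OF Ss] fin_sub[OF N(1)]] c b by simp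
      moreover have "q ^ b * card N = q ^ c * (q ^ (b - c - k) * card (carrier G))"
      proof -
        have "q ^ b = q ^ c * (q ^ (b - c - k) * q ^ k)" using ck by (simp flip: power_add)
        then show ?thesis unfolding rN q(2) by (simp add: ac_simps)
      qed
      ultimately have "card (S <#> N) = q ^ (b - c - k) * card (carrier G)" using q0 by (simp add: mult.commute)
      moreover have "q ^ (b - c - k) \<ge> 1" using q0 by simp
      ultimately have ge: "card (carrier G) \<le> card (S <#> N)" by simp
      have sub: "S <#> N \<subseteq> carrier G" by (rule set_mult_closed[OF sub_carrier[OF Ss] sub_carrier[OF N(1)]])
      then have "card (S <#> N) = card (carrier G)" using ge card_mono[OF fin sub] by simp
      then show ?thesis using sub_eq_card[OF sub subgroup_self] by simp
    qed
    have SV: "S \<in> proper_nontriv"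
    proof (rule proper_nontrivI[OF Ss])
      show "S \<noteq> {\<one>}"
      proof
        assume "S = {\<one>}" then have "q ^ b = 1" using b by simp
        then show False using b0 prime_gt_1_nat[OF q(1)] by simp
      qed
      show "S \<noteq> carrier G" using syl_q_sub_M(1)[OF q(1) qp S] carrier_not_sub_M by auto
    qed
    have SX: "S \<in> X" by (rule X_I[OF SV NY SN])
    have Sn: "S \<lhd> G"
    proof (rule ccontr)
      assume "\<not> S \<lhd> G"
      then have ne: "Normalizer S \<noteq> carrier G" using normal_iff_Normalizer[OF Ss] by simp
      have NS: "subgroup (Normalizer S) G" by (rule Normalizer_subgroup[OF sub_carrier[OF Ss]])
      have "Normalizer S \<in> Y" by (rule Y_I[OF NS ne syl_q_Normalizer[OF q(1) qp S]])
      then have SNm: "S <#> Normalizer S = carrier G" using XY_prod[OF SX] by simp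
      have "S <#> Normalizer S \<subseteq> Normalizer S" unfolding set_mult_def
        using subset_Normalizer[OF Ss] subgroup.m_closed[OF NS] by blast
      then show False unfolding SNm using ne subset_antisym[OF sub_carrier[OF NS]] by simp
    qed
    obtain x a where x: "x \<in> P" "x \<notin> M" "ord x = p ^ a"
      using p_element_outside[OF M p Mp Ps YD(3)[OF PY]] by blast
    have xc: "x \<in> carrier G" using x(1) sub_carrier[OF Ps] by blast
    have Rs: "subgroup (generate G {x}) G" by (rule gen_sub[OF xc])
    have RP: "generate G {x} \<subseteq> P" by (rule gen_subset[OF Ps x(1)])
    have "generate G {x} \<in> Y"
    proof (rule Y_I[OF Rs])
      show "generate G {x} \<noteq> carrier G" using RP YD(2)[OF PY] subset_antisym[OF sub_carrier[OF Ps]] by auto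
      show "\<not> generate G {x} \<subseteq> M" using gen_in[of x] x(2) by blast
    qed
    then have SR: "S <#> generate G {x} = carrier G" by (rule XY_prod[OF SX])
    have cR: "card (generate G {x}) = p ^ a" using generate_pow_card[OF xc] x(3) by simp
    have "S \<inter> generate G {x} = {\<one>}"
      by (rule coprime_inter[OF Ss Rs]) (use cR b prime_pow_outside[OF q(1) qp, of b] in simp)
    then have "card (carrier G) = q ^ b * p ^ a" using prod_card_iff[OF Ss Rs] SR b cR by simp
    then have "card (carrier G) div card (generate G {x}) = q ^ b" using cR prime_gt_0_nat[OF p] by simp
    moreover have "\<not> p dvd q ^ b"
      using prime_pow_outside[OF q(1) qp, of b] p by (metis coprime_common_divisor_nat dvd_refl not_prime_1)
    ultimately have "sylow_subgroup p (generate G {x}) (carrier G)" unfolding sylow_subgroup_def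
      using Rs sub_carrier[OF Rs] cR by auto
    then show ?thesis using q(1) qp Sn b xc x(2,3) SR SX by blast
  qed
qed

end

section \<open>Conjugacy classes outside M\<close>

context fin_group begin

text \<open>
  By the pigeonhole principle two of the first \<open>m + 1\<close> iterated conjugates of \<open>e\<close> coincide.
\<close>
lemma stab_pow:
  assumes x: "x \<in> carrier G" and E: "finite E" "card E \<le> m" "e \<in> E"
    and sub: "\<And>e. e \<in> E \<Longrightarrow> e \<subseteq> carrier G" and cl: "\<And>e. e \<in> E \<Longrightarrow> conjg x e \<in> E"
  shows "\<exists>d::nat. 1 \<le> d \<and> d \<le> m \<and> x [^] d \<in> Normalizer e"
proof -
  have ec: "e \<subseteq> carrier G" using sub E(3) by blast
  let ?f = "\<lambda>i::nat. conjg (x [^] i) e"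
  have fE: "?f i \<in> E" for i
  proof (induction i)
    case 0 then show ?case using conjg_one[OF ec] E(3) by simp
  next
    case (Suc i)
    have "?f (Suc i) = conjg x (?f i)"
      using conjg_mult[OF x nat_pow_closed[OF x, of i] ec] nat_pow_Suc2[OF x, of i] by simp
    then show ?case using cl[OF Suc] by simp
  qed
  have "card (?f ` {0..m}) \<le> m" using card_mono[OF E(1), of "?f ` {0..m}"] fE E(2) by fastforce
  then have "\<not> inj_on ?f {0..m}" by (intro pigeonhole) simp
  then obtain i j where ij: "i \<le> m" "j \<le> m" "i < j" "?f i = ?f j"
    unfolding inj_on_def by (metis atLeastAtMost_iff nat_neq_iff)
  have "x [^] j = x [^] i \<otimes> x [^] (j - i)" using nat_pow_mult[OF x, of i "j - i"] ij(3) by simp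
  then have "conjg (x [^] i) (conjg (x [^] (j - i)) e) = conjg (x [^] i) e"
    using conjg_mult[OF nat_pow_closed[OF x, of i] nat_pow_closed[OF x, of "j - i"] ec] ij(4) by simp
  then have "conjg (inv (x [^] i)) (conjg (x [^] i) (conjg (x [^] (j - i)) e)) = conjg (inv (x [^] i)) (conjg (x [^] i) e)" by simp
  then have "conjg (x [^] (j - i)) e = e"
    using conjg_inv(1)[OF nat_pow_closed[OF x, of i] ec]
      conjg_inv(1)[OF nat_pow_closed[OF x, of i] conjg_subset[OF nat_pow_closed[OF x, of "j - i"] ec]] by simp
  then have "x [^] (j - i) \<in> Normalizer e" unfolding Normalizer_def using x by simp
  moreover have "1 \<le> j - i" "j - i \<le> m" using ij by auto
  ultimately show ?thesis by blast
qed

lemma conj_class_eq: assumes "H \<subseteq> carrier G" "K \<in> conj_class H" shows "conj_class K = conj_class H"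
proof -
  obtain g where g: "g \<in> carrier G" "K = conjg g H" using assms(2) unfolding conj_class_def by blast
  have Kc: "K \<subseteq> carrier G" using g conjg_subset assms(1) by simp
  have "conj_class K \<subseteq> conj_class H"
  proof
    fix e assume "e \<in> conj_class K"
    then obtain h where "h \<in> carrier G" "e = conjg h K" unfolding conj_class_def by blast
    then show "e \<in> conj_class H" using conj_class_conjg[OF assms] by simp
  qed
  moreover have "conj_class H \<subseteq> conj_class K"
  proof
    fix e assume "e \<in> conj_class H"
    then obtain h where h: "h \<in> carrier G" "e = conjg h H" unfolding conj_class_def by blast
    have "H \<in> conj_class K" unfolding conj_class_def using g conjg_inv(1)[OF g(1) assms(1)] by (metis image_eqI inv_closed)
    then show "e \<in> conj_class K" using conj_class_conjg[OF Kc _ h(1)] h(2) by simp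
  qed
  ultimately show ?thesis by blast
qed

end

text \<open>
  The situation reached in \<open>cyclic_sylow_complement\<close>: the group is the semidirect product of the normal \<open>q\<close>-group \<open>Q\<close> and the
  cyclic \<open>p\<close>-group generated by \<open>x\<close>.
\<close>
locale comax_cyclic_sylow = comax_prime_index +
  fixes q b a :: nat and Q x
  assumes q: "prime q" and qp: "q \<noteq> p" and Qn: "Q \<lhd> G" and cQ: "card Q = q ^ b"
    and xc: "x \<in> carrier G" and xM: "x \<notin> M" and ox: "ord x = p ^ a"
    and QPg: "Q <#> generate G {x} = carrier G" and QX: "Q \<in> X"
    and Psyl0: "sylow_subgroup p (generate G {x}) (carrier G)"
begin

definition P where "P = generate G {x}"

lemma QP: "Q <#> P = carrier G" using QPg unfolding P_def .
lemma Psyl: "sylow_subgroup p P (carrier G)" using Psyl0 unfolding P_def .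
lemma Ps: "subgroup P G" by (rule sylD(1)[OF Psyl])
lemma Pc: "P \<subseteq> carrier G" by (rule sub_carrier[OF Ps])
lemma xP: "x \<in> P" unfolding P_def by (rule gen_in)
lemma cP: "card P = p ^ a" unfolding P_def using generate_pow_card[OF xc] ox by simp
lemma PY: "P \<in> Y" by (rule syl_p_Y[OF Psyl])
lemma Qs: "subgroup Q G" using Qn normal_imp_subgroup by blast
lemma cop: "coprime (card Q) p" unfolding cQ by (rule prime_pow_outside[OF q qp])
lemma QP1: "Q \<inter> P = {\<one>}" by (rule coprime_inter[OF Qs Ps]) (use cop cP in simp)

lemma cG: "card (carrier G) = q ^ b * p ^ a"
  using prod_card_iff[OF Qs Ps] QP QP1 cQ cP by simp

lemma pa_pos: "p ^ a > 0" using prime_gt_0_nat[OF p] by simp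
lemma qb_pos: "q ^ b > 0" using prime_gt_0_nat[OF q] by simp

lemma Y_order: assumes y: "y \<in> Y" shows "card y = p ^ a * card (Q \<inter> y)"
proof -
  have "q ^ b * card y = q ^ b * (p ^ a * card (Q \<inter> y))"
    using XY_prod[OF QX y] prod_card_iff[OF Qs YD(1)[OF y]] cG cQ by (simp add: ac_simps)
  then show ?thesis by (simp only: mult_left_cancel[OF gr_implies_not0[OF qb_pos]])
qed

text \<open>
  Members of \<open>Y\<close> contain a full \<open>p\<close>-part, since they multiply to the group with \<open>Q\<close>.
\<close>
lemma conj_class_power: assumes y: "y \<in> Y" shows "\<exists>i. card (conj_class y) = q ^ i"
proof -
  have ys: "subgroup y G" by (rule YD(1)[OF y])
  have yc: "y \<subseteq> carrier G" by (rule sub_carrier[OF ys])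
  have "card y dvd card (Normalizer y)" by (rule card_dvd[OF Normalizer_subgroup[OF yc] ys subset_Normalizer[OF ys]])
  then have "p ^ a dvd card (Normalizer y)" unfolding Y_order[OF y] by (rule dvd_mult_left)
  then obtain t where t: "card (Normalizer y) = p ^ a * t" by (rule dvdE)
  have "p ^ a * (card (conj_class y) * t) = p ^ a * q ^ b" using card_conj_class[OF yc] t cG by (simp add: ac_simps)
  then have "card (conj_class y) * t = q ^ b" by (simp only: mult_left_cancel[OF gr_implies_not0[OF pa_pos]])
  then have "card (conj_class y) dvd q ^ b" by (metis dvd_triv_left)
  then show ?thesis using divides_primepow_nat[OF q] by blast
qed

lemma conj_class_ge3: "y \<in> Y \<Longrightarrow> 3 \<le> card (conj_class y)"
  using card_conj_class_Y[of y] prime_ge_2_nat[OF p] by linarith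

lemma q_dvd_Y: "q dvd card Y"
proof (rule orbits_dvd_card)
  show "acts G (carrier G) Y conjg"
  proof (rule acts_conjg[OF subgroup_self])
    show "e \<subseteq> carrier G" if "e \<in> Y" for e by (rule sub_carrier[OF YD(1)[OF that]])
    show "conjg g e \<in> Y" if "g \<in> carrier G" "e \<in> Y" for g e
      using Y_conj_class[OF that(2)] that(1) unfolding conj_class_def by blast
  qed
  fix y assume y: "y \<in> Y"
  obtain i where i: "card (conj_class y) = q ^ i" using conj_class_power[OF y] by blast
  have "i \<noteq> 0"
  proof
    assume "i = 0" then show False using conj_class_ge3[OF y] i by simp
  qed
  then show "q dvd card ((\<lambda>g. conjg g y) ` carrier G)" using i unfolding conj_class_def by simp
qed

lemma x_pow_ord: "x [^] (p ^ a) = \<one>" using pow_ord_eq_1[OF xc] ox by simp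

lemma pow_stab:
  assumes H: "subgroup H G" and d: "x [^] d \<in> H" "\<not> p dvd d" shows "x \<in> H"
proof (rule pow_coprime_mem[OF H xc d(1)])
  show "x [^] (p ^ a) \<in> H" using x_pow_ord subgroup.one_closed[OF H] by simp
  have "coprime d p" using d(2) p by (metis coprime_commute prime_imp_coprime_nat)
  then show "coprime d (p ^ a)" by simp
qed

text \<open>
  If \<open>z\<close> normalizes every Sylow \<open>p\<close>-subgroup, it lies in all of them. So \<open>z\<close> and its conjugate by \<open>u\<close> both lie in \<open>P\<close>, and
  their quotient lies in \<open>P\<close> and in \<open>Q\<close>.
\<close>
lemma centralize:
  assumes z: "z \<in> P" and f: "\<And>e. e \<in> conj_class P \<Longrightarrow> z \<in> Normalizer e" and u: "u \<in> Q"
  shows "z \<in> Normalizer {u}"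
proof -
  have uc: "u \<in> carrier G" "z \<in> carrier G" using u subgroup.mem_carrier[OF Qs] z Pc by auto
  define e where "e = conjg u P"
  have eC: "e \<in> conj_class P" unfolding e_def conj_class_def using uc by blast
  have es: "sylow_subgroup p e (carrier G)" unfolding e_def by (rule syl_conjg[OF subgroup_self Psyl uc(1)])
  have Zs: "subgroup (generate G {z}) G" by (rule gen_sub[OF uc(2)])
  have "card (generate G {z}) dvd p ^ a" using card_dvd[OF Ps Zs gen_subset[OF Ps z]] cP by simp
  then obtain j where j: "card (generate G {z}) = p ^ j" using divides_primepow_nat[OF p] by blast
  have "generate G {z} \<subseteq> Normalizer e"
    by (rule gen_subset[OF Normalizer_subgroup f[OF eC]]) (rule sub_carrier[OF sylD(1)[OF es]])
  then have "generate G {z} \<subseteq> e" by (rule syl_absorb[OF p subgroup_self es Zs sub_carrier[OF Zs] j])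
  then have "z \<in> e" using gen_in by blast
  then obtain w where w: "w \<in> P" "z = u \<otimes> w \<otimes> inv u" unfolding e_def conjg_def by blast
  have wc: "w \<in> carrier G" using w(1) Pc by blast
  have "w \<otimes> inv z \<in> P" using subgroup.m_closed[OF Ps w(1) subgroup.m_inv_closed[OF Ps z]] .
  moreover have "w \<otimes> inv z \<in> Q"
  proof -
    have "w = inv u \<otimes> z \<otimes> u" using w(2) uc wc by (simp add: m_assoc inv_solve_left)
    then have "w \<otimes> inv z = inv u \<otimes> (z \<otimes> u \<otimes> inv z)" using uc by (simp add: m_assoc)
    moreover have "z \<otimes> u \<otimes> inv z \<in> Q" using Qn u uc by (simp add: normal_inv_iff)
    ultimately show ?thesis using subgroup.m_closed[OF Qs subgroup.m_inv_closed[OF Qs u]] by simp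
  qed
  ultimately have "w \<otimes> inv z = \<one>" using QP1 by blast
  then have "w = z" using uc wc by (metis inv_solve_right' l_one one_closed)
  then have "z \<otimes> u = u \<otimes> z" using w(2) uc by (metis inv_solve_right m_closed)
  then show ?thesis using Normalizer_singleton[OF uc(1)] uc(2) by simp
qed

lemma no_centralizing_power:
  assumes X5: "card X = 5" and c: "\<And>u. u \<in> Q \<Longrightarrow> x [^] p \<in> Normalizer {u}" shows False
  by (rule direct_product_impossible[OF X5 Qn xc xM ox cop QPg _ c]) (use YD(2)[OF PY] in \<open>simp_all add: P_def\<close>)

lemma fixes_others:
  assumes x': "x \<in> Normalizer N" and N: "N \<subseteq> carrier G" and m: "card (conj_class N) \<le> m + 1" and e: "e \<in> conj_class N"
  shows "e = N \<or> (\<exists>d. 1 \<le> d \<and> d \<le> m \<and> x [^] d \<in> Normalizer e)"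
proof (cases "e = N")
  case False
  have "\<exists>d. 1 \<le> d \<and> d \<le> m \<and> x [^] d \<in> Normalizer e"
  proof (rule stab_pow[OF xc])
    have NC: "N \<in> conj_class N" by (rule self_in_conj_class[OF N])
    show "finite (conj_class N - {N})" using fin_conj_class by simp
    show "card (conj_class N - {N}) \<le> m" using m fin_conj_class NC by simp
    show "e \<in> conj_class N - {N}" using e False by simp
    show sub: "e' \<subseteq> carrier G" if "e' \<in> conj_class N - {N}" for e'
      using that conjg_subset[OF _ N] unfolding conj_class_def by blast
    show "conjg x e' \<in> conj_class N - {N}" if e': "e' \<in> conj_class N - {N}" for e'
    proof -
      have "conjg x e' \<noteq> N"
      proof
        assume "conjg x e' = N"
        then have "conjg x e' = conjg x N" using NormalizerD(2)[OF x'] by simp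
        then have "conjg (inv x) (conjg x e') = conjg (inv x) (conjg x N)" by simp
        then have "e' = N" using conjg_inv(1)[OF xc] N sub[OF e'] by simp
        then show False using e' by simp
      qed
      then show ?thesis using conj_class_conjg[OF N _ xc] e' by simp
    qed
  qed
  then show ?thesis by simp
qed simp

text \<open>
  The element \<open>x\<close> fixes \<open>N\<close> and permutes the at most \<open>p\<close> other conjugates, so \<open>stab_pow\<close> gives an exponent between 1 and
  \<open>p\<close>; an exponent smaller than \<open>p\<close> is prime to the order of \<open>x\<close>.
\<close>
lemma pth_power_fixes:
  assumes x': "x \<in> Normalizer N" and N: "N \<subseteq> carrier G" and m: "card (conj_class N) \<le> p + 1" and e: "e \<in> conj_class N"
  shows "x [^] p \<in> Normalizer e"
proof -
  have es: "subgroup (Normalizer e) G"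
    by (rule Normalizer_subgroup) (use e conjg_subset[OF _ N] in \<open>auto simp: conj_class_def\<close>)
  show ?thesis
    using fixes_others[OF x' N m e]
  proof (elim disjE exE conjE)
    assume "e = N" then show ?thesis using pow_mem[OF es] x' by simp
  next
    fix d assume d: "1 \<le> d" "d \<le> p" "x [^] d \<in> Normalizer e"
    show ?thesis
    proof (cases "p dvd d")
      case True
      then have "d = p" using d dvd_imp_le[of p d] by simp
      then show ?thesis using d by simp
    next
      case False
      then show ?thesis using pow_mem[OF es pow_stab[OF es d(3)]] by simp
    qed
  qed
qed

lemma xNmP: "x \<in> Normalizer P" using subset_Normalizer[OF Ps] xP by blast

lemma few_sylows_impossible:
  assumes X5: "card X = 5" and n: "card (conj_class P) = p + 1" shows False
proof (rule no_centralizing_power[OF X5])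
  fix u assume u: "u \<in> Q"
  show "x [^] p \<in> Normalizer {u}"
    by (rule centralize[OF pow_mem[OF Ps xP] pth_power_fixes[OF xNmP Pc] u]) (use n in simp_all)
qed

lemma two_classes:
  assumes y: "y \<in> Y" "y \<notin> conj_class P" shows "conj_class P \<inter> conj_class y = {}" "card (conj_class P) + card (conj_class y) \<le> card Y"
proof -
  have yc: "y \<subseteq> carrier G" by (rule sub_carrier[OF YD(1)[OF y(1)]])
  show d: "conj_class P \<inter> conj_class y = {}"
  proof (rule ccontr)
    assume "conj_class P \<inter> conj_class y \<noteq> {}"
    then obtain e where e: "e \<in> conj_class P" "e \<in> conj_class y" by blast
    have "conj_class y = conj_class P" using conj_class_eq[OF Pc e(1)] conj_class_eq[OF yc e(2)] by simp
    then show False using y(2) self_in_conj_class[OF yc] by simp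
  qed
  have "card (conj_class P \<union> conj_class y) \<le> card Y"
    by (rule card_mono[OF fin_XY(2)]) (use Y_conj_class PY y in blast)
  then show "card (conj_class P) + card (conj_class y) \<le> card Y" using card_Un_disjoint[OF fin_conj_class fin_conj_class d] by simp
qed

text \<open>
  The Sylow subgroup \<open>P\<close> is characteristic in its normalizer.
\<close>
lemma Normalizer_Normalizer: "Normalizer (Normalizer P) = Normalizer P"
proof
  have NP: "subgroup (Normalizer P) G" by (rule Normalizer_subgroup[OF Pc])
  show "Normalizer P \<subseteq> Normalizer (Normalizer P)" by (rule subset_Normalizer[OF NP])
  show "Normalizer (Normalizer P) \<subseteq> Normalizer P"
  proof
    fix g assume g: "g \<in> Normalizer (Normalizer P)"
    have gc: "g \<in> carrier G" by (rule NormalizerD(1)[OF g])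
    have "conjg g P \<subseteq> Normalizer P" using conjg_mono[OF subset_Normalizer[OF Ps], of g] NormalizerD(2)[OF g] by simp
    then have "conjg g P \<subseteq> P"
      using syl_absorb[OF p subgroup_self Psyl conjg_subgroup[OF gc Ps] conjg_subset[OF gc Pc], of a] card_conjg[OF gc Pc] cP by simp
    then have "conjg g P = P" using sub_eq_card[OF _ Ps] card_conjg[OF gc Pc] by simp
    then show "g \<in> Normalizer P" unfolding Normalizer_def using gc by simp
  qed
qed

text \<open>
  Here \<open>Y\<close> consists of the nine Sylow subgroups and of one class of three conjugates, so \<open>Q\<close> has order 9 and a conjugate
  \<open>N\<close> of index 3 meets \<open>Q\<close> in a subgroup \<open>U\<close> of order 3. The involution induced by \<open>x\<close> on the two non-trivial elements of
  \<open>U\<close> and on the two non-trivial cosets of \<open>U\<close> in \<open>Q\<close> has trivial square. So the square \<open>z\<close> of \<open>x\<close> acts on \<open>Q\<close> with order dividing 3; as its order is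
  a power of 2, it centralizes \<open>Q\<close>.
\<close>
lemma nine_sylows_impossible:
  assumes X5: "card X = 5" and q3: "q = 3" and p2: "p = 2" and n: "card (conj_class P) = 9" and Y12: "card Y = 12"
  shows False
proof -
  have "Y \<noteq> conj_class P" using n Y12 by auto
  then obtain y where y: "y \<in> Y" "y \<notin> conj_class P" using Y_conj_class[OF PY] by blast
  have yc: "y \<subseteq> carrier G" by (rule sub_carrier[OF YD(1)[OF y(1)]])
  have le: "card (conj_class P) + card (conj_class y) \<le> 12" using two_classes(2)[OF y] Y12 by simp
  then have C3: "card (conj_class y) = 3" using n conj_class_ge3[OF y(1)] by simp
  have Yeq: "Y = conj_class P \<union> conj_class y"
  proof (rule card_subset_eq[OF fin_XY(2), symmetric])
    show "conj_class P \<union> conj_class y \<subseteq> Y" using Y_conj_class PY y by blast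
    show "card (conj_class P \<union> conj_class y) = card Y" using card_Un_disjoint[OF fin_conj_class fin_conj_class two_classes(1)[OF y]] n C3 Y12 by simp
  qed
  have NPY: "Normalizer P \<in> Y" by (rule Normalizer_Y[OF PY])
  have NPc: "Normalizer P \<subseteq> carrier G" by (rule sub_carrier[OF YD(1)[OF NPY]])
  have cNP: "9 * card (Normalizer P) = card (carrier G)" using card_conj_class[OF Pc] n by simp
  have "Normalizer P \<in> conj_class P"
  proof (rule ccontr)
    assume "Normalizer P \<notin> conj_class P"
    then have "Normalizer P \<in> conj_class y" using NPY Yeq by blast
    then have "conj_class (Normalizer P) = conj_class y" by (rule conj_class_eq[OF yc])
    then have "3 * card (Normalizer P) = card (carrier G)" using card_conj_class[OF NPc] Normalizer_Normalizer C3 by simp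
    then show False using cNP card_pos[OF YD(1)[OF NPY]] by simp
  qed
  then have "card (Normalizer P) = card P" by (rule conj_class_card[OF Pc])
  then have "9 * p ^ a = q ^ b * p ^ a" using cNP cG cP by simp
  then have Q9: "card Q = 9" unfolding cQ by (simp only: mult_right_cancel[OF gr_implies_not0[OF pa_pos]])
  define N0 where "N0 = Normalizer y"
  have N0: "N0 \<in> Y" "card N0 * 3 = card (carrier G)"
    unfolding N0_def using Normalizer_Y[OF y(1)] card_conj_class[OF yc] C3 by simp_all
  have N0s: "subgroup N0 G" by (rule YD(1)[OF N0(1)])
  \<comment> \<open>Replace the subgroup of index 3 by a conjugate that contains \<open>x\<close>.\<close>
  have "\<exists>g\<in>carrier G. P \<subseteq> conjg g N0"
  proof (rule p_subgroup_conj[OF p subgroup_self Ps Pc cP N0s sub_carrier[OF N0s]])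
    have "card (carrier G) div card N0 = 3" using N0(2) card_pos[OF N0s] by (metis nonzero_mult_div_cancel_left less_not_refl)
    then show "\<not> p dvd card (carrier G) div card N0" using p2 by simp
  qed
  then obtain g where g: "g \<in> carrier G" "P \<subseteq> conjg g N0" by blast
  define N where "N = conjg g N0"
  have NY: "N \<in> Y" unfolding N_def using Y_conj_class[OF N0(1)] g(1) unfolding conj_class_def by blast
  have Ns: "subgroup N G" by (rule YD(1)[OF NY])
  have cN: "card N * 3 = card (carrier G)" unfolding N_def using N0(2) card_conjg[OF g(1) sub_carrier[OF N0s]] by simp
  have xN: "x \<in> N" using g(2) xP unfolding N_def by blast
  define U where "U = Q \<inter> N"
  have Us: "subgroup U G" unfolding U_def by (rule subgroups_Inter_pair[OF Qs Ns])
  have UQ: "U \<subseteq> Q" unfolding U_def by simp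
  have cU: "card U = 3"
  proof -
    have e: "card Q * card N = card (carrier G) * card U"
      using XY_prod[OF QX NY] prod_card_iff[OF Qs Ns] unfolding U_def by simp
    have "card N * (3 * card U) = (card N * 3) * card U" by (simp only: mult.assoc)
    also have "\<dots> = card N * 9" unfolding cN e[symmetric] Q9 by (rule mult.commute)
    finally have "card N * (3 * card U) = card N * 9" .
    then show ?thesis using card_pos[OF Ns] by simp
  qed
  have xU: "conjg x U = U"
  proof -
    have "conjg x U \<subseteq> conjg x Q" "conjg x U \<subseteq> conjg x N" by (rule conjg_mono, simp add: U_def)+
    moreover have "conjg x Q = Q" using Qn normal_iff_conjg[OF Qs] xc by simp
    ultimately have "conjg x U \<subseteq> U" using conjg_self[OF Ns xN] unfolding U_def by simp
    then show ?thesis using sub_eq_card[OF _ Us] card_conjg[OF xc sub_carrier[OF Us]] by simp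
  qed
  \<comment> \<open>With two objects to permute, \<open>stab_pow\<close> yields the exponent 1 or 2; either way the square is in the stabilizer.\<close>
  have sq: "x [^] (2::nat) \<in> H" if H: "subgroup H G" and d: "1 \<le> d" "d \<le> 2" "x [^] d \<in> H" for H and d :: nat
  proof (cases "d = 1")
    case True
    then have "x \<in> H" using d xc by simp
    then show ?thesis by (rule pow_mem[OF H])
  next
    case False then have "d = 2" using d by simp
    then show ?thesis using d by simp
  qed
  define z where "z = x [^] (2::nat)"
  have zc: "z \<in> carrier G" unfolding z_def using xc by simp
  have zU: "z \<in> Normalizer {w}" if w: "w \<in> U" for w
  proof (cases "w = \<one>")
    case True then show ?thesis using Normalizer_singleton[of w z] zc by simp
  next
    case False
    have wc: "w \<in> carrier G" using w sub_carrier[OF Us] by blast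
    have inj: "inj_on (\<lambda>w. {w}) (U - {\<one>})" by (rule inj_onI) simp
    have "\<exists>d::nat. 1 \<le> d \<and> d \<le> 2 \<and> x [^] d \<in> Normalizer {w}"
    proof (rule stab_pow[OF xc])
      let ?E = "(\<lambda>w. {w}) ` (U - {\<one>})"
      show "finite ?E" using fin_sub[OF Us] by simp
      show "card ?E \<le> 2" using card_image[OF inj] cU subgroup.one_closed[OF Us] fin_sub[OF Us] by simp
      show "{w} \<in> ?E" using w False by simp
      show "e \<subseteq> carrier G" if "e \<in> ?E" for e using that subgroup.mem_carrier[OF Us] by auto
      show "conjg x e \<in> ?E" if e: "e \<in> ?E" for e
      proof -
        obtain v where v: "v \<in> U" "v \<noteq> \<one>" "e = {v}" using e by blast
        have vc: "v \<in> carrier G" using v(1) sub_carrier[OF Us] by blast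
        have "x \<otimes> v \<otimes> inv x \<in> U" using xU v(1) unfolding conjg_def by blast
        moreover have "x \<otimes> v \<otimes> inv x \<noteq> \<one>"
        proof
          assume "x \<otimes> v \<otimes> inv x = \<one>"
          then have "inv x \<otimes> (x \<otimes> v \<otimes> inv x) \<otimes> x = \<one>" using xc by simp
          moreover have "inv x \<otimes> (x \<otimes> v \<otimes> inv x) \<otimes> x = (inv x \<otimes> x) \<otimes> v \<otimes> (inv x \<otimes> x)"
            using xc vc by (simp only: m_assoc m_closed inv_closed)
          ultimately show False using v(2) xc vc by simp
        qed
        moreover have "conjg x e = {x \<otimes> v \<otimes> inv x}" unfolding v(3) conjg_def by simp
        ultimately show ?thesis by blast
      qed
    qed
    then obtain d :: nat where "1 \<le> d" "d \<le> 2" "x [^] d \<in> Normalizer {w}" by blast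
    then show ?thesis unfolding z_def using sq[OF Normalizer_subgroup[of "{w}"]] wc by simp
  qed
  have zQ: "\<exists>w\<in>U. z \<otimes> u \<otimes> inv z = u \<otimes> w" if u: "u \<in> Q" for u
  proof -
    have uc: "u \<in> carrier G" using u subgroup.mem_carrier[OF Qs] by simp
    define E where "E = (\<lambda>g. (\<otimes>) g ` U) ` Q"
    have cE: "card E * 3 = 9" unfolding E_def using card_cosets[OF Qs Us UQ] cU Q9 by simp
    have finE: "finite E" unfolding E_def using fin_sub[OF Qs] by simp
    have Ecar: "e \<subseteq> carrier G" if e: "e \<in> E" for e
    proof -
      obtain v where v: "v \<in> Q" "e = (\<otimes>) v ` U" using e unfolding E_def by blast
      then show ?thesis using subgroup.mem_carrier[OF Qs] sub_carrier[OF Us] by auto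
    qed
    have cj: "conjg x ((\<otimes>) v ` U) = (\<otimes>) (x \<otimes> v \<otimes> inv x) ` U" if v: "v \<in> Q" for v
    proof -
      have vc: "v \<in> carrier G" using v subgroup.mem_carrier[OF Qs] by simp
      have "conjg x ((\<otimes>) v ` U) = (\<otimes>) (x \<otimes> v \<otimes> inv x) ` conjg x U"
        unfolding conjg_def image_image
      proof (rule image_cong[OF refl])
        fix w assume "w \<in> U"
        then have wc: "w \<in> carrier G" using sub_carrier[OF Us] by blast
        have "x \<otimes> v \<otimes> inv x \<otimes> (x \<otimes> w \<otimes> inv x) = x \<otimes> v \<otimes> (inv x \<otimes> x) \<otimes> w \<otimes> inv x"
          using xc vc wc by (simp only: m_assoc m_closed inv_closed)
        then show "x \<otimes> (v \<otimes> w) \<otimes> inv x = x \<otimes> v \<otimes> inv x \<otimes> (x \<otimes> w \<otimes> inv x)"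
          using xc vc wc by (simp add: m_assoc)
      qed
      then show ?thesis using xU by simp
    qed
    have xQ: "x \<otimes> v \<otimes> inv x \<in> Q" if "v \<in> Q" for v using Qn xc that by (simp add: normal_inv_iff)
    have UE: "U \<in> E" unfolding E_def
      using coset_eq_self[OF Us one_closed] subgroup.one_closed[OF Us] subgroup.one_closed[OF Qs] by (metis image_eqI)
    have "z \<in> Normalizer ((\<otimes>) u ` U)"
    proof (cases "(\<otimes>) u ` U = U")
      case True
      then show ?thesis unfolding z_def
        using pow_mem[OF Normalizer_subgroup[OF sub_carrier[OF Us]], of x 2] xU xc by (simp add: Normalizer_def)
    next
      case False
      have "\<exists>d::nat. 1 \<le> d \<and> d \<le> 2 \<and> x [^] d \<in> Normalizer ((\<otimes>) u ` U)"
      proof (rule stab_pow[OF xc])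
        show "finite (E - {U})" using finE by simp
        show "card (E - {U}) \<le> 2" using finE UE cE by simp
        show "(\<otimes>) u ` U \<in> E - {U}" unfolding E_def using u False by simp
        show "e \<subseteq> carrier G" if "e \<in> E - {U}" for e using that Ecar by blast
        show "conjg x e \<in> E - {U}" if e: "e \<in> E - {U}" for e
        proof -
          obtain v where v: "v \<in> Q" "e = (\<otimes>) v ` U" using e unfolding E_def by blast
          have "conjg x e \<in> E" unfolding v(2) cj[OF v(1)] E_def using xQ[OF v(1)] by simp
          moreover have "conjg x e \<noteq> U"
          proof
            assume "conjg x e = U"
            then have "conjg (inv x) (conjg x e) = conjg (inv x) (conjg x U)" using xU by simp
            then have "e = U" using conjg_inv(1)[OF xc] sub_carrier[OF Us] Ecar e by simp
            then show False using e by simp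
          qed
          ultimately show ?thesis by simp
        qed
      qed
      then obtain d :: nat where "1 \<le> d" "d \<le> 2" "x [^] d \<in> Normalizer ((\<otimes>) u ` U)" by blast
      moreover have "(\<otimes>) u ` U \<subseteq> carrier G" using uc sub_carrier[OF Us] by auto
      ultimately show ?thesis unfolding z_def using sq[OF Normalizer_subgroup] by blast
    qed
    then have "conjg z ((\<otimes>) u ` U) = (\<otimes>) u ` U" by (rule NormalizerD(2))
    moreover have "u \<otimes> \<one> \<in> (\<otimes>) u ` U" using subgroup.one_closed[OF Us] by (rule imageI)
    ultimately have "z \<otimes> (u \<otimes> \<one>) \<otimes> inv z \<in> (\<otimes>) u ` U" unfolding conjg_def by blast
    then show ?thesis using uc by auto
  qed
  show False
  proof (rule no_centralizing_power[OF X5])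
    fix u assume u: "u \<in> Q"
    have uc: "u \<in> carrier G" using u subgroup.mem_carrier[OF Qs] by simp
    obtain w where w: "w \<in> U" "z \<otimes> u \<otimes> inv z = u \<otimes> w" using zQ[OF u] by blast
    have wc: "w \<in> carrier G" using w(1) sub_carrier[OF Us] by blast
    have zu: "z \<otimes> u = u \<otimes> w \<otimes> z" using w(2) uc wc zc by (metis inv_solve_right' m_closed)
    have zw: "z \<otimes> w = w \<otimes> z" using zU[OF w(1)] Normalizer_singleton[OF wc] by simp
    have zwn: "z \<otimes> w [^] n = w [^] n \<otimes> z" for n :: nat
      using pow_mem[OF Normalizer_subgroup[of "{z}"], of w n] Normalizer_singleton[OF zc] zw zc wc by simp
    \<comment> \<open>As \<open>w\<close> is fixed by \<open>z\<close>, the iterates of \<open>z\<close> multiply \<open>u\<close> by the powers of \<open>w\<close>, and \<open>w\<close> has order dividing 3.\<close>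
    have pw: "z [^] n \<otimes> u = u \<otimes> w [^] n \<otimes> z [^] n" for n :: nat
    proof (induction n)
      case 0 then show ?case using uc by simp
    next
      case (Suc n)
      have c: "z [^] n \<in> carrier G" "w [^] n \<in> carrier G" using zc wc by simp_all
      have "z [^] Suc n \<otimes> u = z \<otimes> (z [^] n \<otimes> u)" using nat_pow_Suc2[OF zc] zc uc c by (simp add: m_assoc)
      also have "\<dots> = (z \<otimes> u) \<otimes> (w [^] n \<otimes> z [^] n)" unfolding Suc using zc uc c by (simp add: m_assoc)
      also have "\<dots> = u \<otimes> w \<otimes> (z \<otimes> w [^] n) \<otimes> z [^] n" unfolding zu using zc uc wc c by (simp add: m_assoc)
      also have "\<dots> = u \<otimes> (w \<otimes> w [^] n) \<otimes> (z \<otimes> z [^] n)" unfolding zwn using zc uc wc c by (simp add: m_assoc)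
      finally show ?case unfolding nat_pow_Suc2[OF zc] nat_pow_Suc2[OF wc] .
    qed
    have "w [^] (3::nat) = \<one>" using ord_dvd_card[OF Us w(1)] cU by simp
    then have "z [^] (3::nat) \<otimes> u = u \<otimes> z [^] (3::nat)" using pw[of 3] uc by simp
    then have z3: "z [^] (3::nat) \<in> Normalizer {u}" using Normalizer_singleton[OF uc] zc by simp
    have "z [^] ((2::nat) ^ a) = (x [^] ((2::nat) ^ a)) [^] (2::nat)" unfolding z_def using xc by (simp add: nat_pow_pow mult.commute)
    then have z2: "z [^] ((2::nat) ^ a) = \<one>" using x_pow_ord p2 by simp
    have Nu: "subgroup (Normalizer {u}) G" by (rule Normalizer_subgroup) (use uc in simp)
    have "z \<in> Normalizer {u}"
    proof (rule pow_coprime_mem[OF Nu zc z3])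
      show "z [^] ((2::nat) ^ a) \<in> Normalizer {u}" unfolding z2 by (rule subgroup.one_closed[OF Nu])
      show "coprime (3::nat) (2 ^ a)" by simp
    qed
    then show "x [^] p \<in> Normalizer {u}" using p2 unfolding z_def by simp
  qed
qed

end

section \<open>No normal subgroup of prime index\<close>

context fin_group begin

lemma conj_pow:
  assumes "g \<in> carrier G" "x \<in> carrier G"
  shows "(g \<otimes> x \<otimes> inv g) [^] (n::nat) = g \<otimes> x [^] n \<otimes> inv g"
proof (induction n)
  case 0 then show ?case using assms by simp
next
  case (Suc n)
  have "(g \<otimes> x \<otimes> inv g) [^] Suc n = g \<otimes> x [^] n \<otimes> inv g \<otimes> (g \<otimes> x \<otimes> inv g)" using Suc by simp
  also have "\<dots> = g \<otimes> x [^] n \<otimes> (inv g \<otimes> g) \<otimes> x \<otimes> inv g"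
    using assms by (simp only: m_assoc m_closed inv_closed nat_pow_closed)
  also have "\<dots> = g \<otimes> x [^] Suc n \<otimes> inv g" using assms by (simp add: m_assoc)
  finally show ?case .
qed

end

context comax_cyclic_sylow begin

lemma n_mod: "card (conj_class P) mod p = 1" by (rule syl_conj_class_count[OF p Psyl])

lemma n_le: "card (conj_class P) \<le> card Y" by (rule card_mono[OF fin_XY(2) Y_conj_class[OF PY]])

text \<open>
  The class sizes in \<open>Y\<close> are powers of \<open>q\<close> and at least \<open>p + 1\<close>, and the number of Sylow \<open>p\<close>-subgroups is 1 modulo \<open>p\<close>. As \<open>q\<close>
  divides 12, the number of Sylow subgroups is 4, 8, 3 or 9. The value 8 belongs to \<open>p = 7\<close> and leaves no room for the four
  remaining members; the values 3 and 4 are \<open>p + 1\<close>.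
\<close>
lemma five_twelve_impossible: assumes X5: "card X = 5" and Y12: "card Y = 12" shows False
proof -
  obtain i where i: "card (conj_class P) = q ^ i" using conj_class_power[OF PY] by blast
  have n: "3 \<le> q ^ i" "q ^ i \<le> 12" "p + 1 \<le> q ^ i" "q ^ i mod p = 1"
    using conj_class_ge3[OF PY] n_le Y12 card_conj_class_Y[OF PY] n_mod i by auto
  have "q dvd 2 * 2 * 3" using q_dvd_Y Y12 by simp
  then have "q dvd 2 \<or> q dvd 3" using q by (metis prime_dvd_mult_iff)
  then have q23: "q = 2 \<or> q = 3" using primes_dvd_imp_eq[OF q two_is_prime_nat] primes_dvd_imp_eq[OF q, of 3] by auto
  have i4: "i < 4"
  proof (rule ccontr)
    assume "\<not> i < 4"
    then have "(2::nat) ^ 4 \<le> 2 ^ i" by (intro power_increasing) auto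
    also have "\<dots> \<le> q ^ i" using q23 by (intro power_mono) auto
    finally show False using n by simp
  qed
  have p2: "p \<ge> 2" using prime_ge_2_nat[OF p] .
  from i4 have "i = 0 \<or> i = 1 \<or> i = 2 \<or> i = 3" by presburger
  then have ii: "q = 2 \<and> q ^ i = 4 \<or> q = 2 \<and> q ^ i = 8 \<or> q = 3 \<and> q ^ i = 3 \<or> q = 3 \<and> q ^ i = 9"
    using q23 n by (elim disjE) simp_all
  then show False
  proof (elim disjE conjE)
    assume "q = 2" "q ^ i = 4"
    then have "p = 3" using n p2 qp by auto
    then show False using few_sylows_impossible[OF X5] i \<open>q ^ i = 4\<close> by simp
  next
    assume e: "q = 2" "q ^ i = 8"
    have "p \<in> {2,3,4,5,6,7}" using n p2 e by auto
    then have p7: "p = 7" using n(4) e qp by auto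
    have "Y \<noteq> conj_class P" using i e Y12 by auto
    then obtain y where y: "y \<in> Y" "y \<notin> conj_class P" using Y_conj_class[OF PY] by blast
    then show False using two_classes(2)[OF y] card_conj_class_Y[OF y(1)] i e Y12 p7 by simp
  next
    assume e: "q = 3" "q ^ i = 3"
    then have "p = 2" using n p2 by auto
    then show False using few_sylows_impossible[OF X5] i e by simp
  next
    assume e: "q = 3" "q ^ i = 9"
    have "p \<in> {2,3,4,5,6,7,8}" using n p2 e by auto
    moreover have "p \<noteq> 4" "p \<noteq> 8" using p by auto
    ultimately have "p = 2" using n(4) e qp by auto
    then show False using nine_sylows_impossible[OF X5 e(1) _ _ Y12] i e by simp
  qed
qed

text \<open>
  Now \<open>Q\<close> has order 5, \<open>p = 2\<close>, and \<open>Y\<close> consists of the five Sylow 2-subgroups. An isolated vertex is a 2-group, thus a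
  proper subgroup of a cyclic Sylow 2-subgroup. The fourth powers of the generators lie in all Sylow 2-subgroups. So
  an isolated vertex is either a non-trivial proper subgroup of \<open>P\<close>, and multiplication with \<open>Q\<close> embeds the proper subgroups of \<open>P\<close>
  into the twelve members of \<open>X\<close>, or it is the set of squares of a Sylow 2-subgroup. This leaves at most 11 + 5.
\<close>
lemma twelve_five_impossible: assumes Y5: "card Y = 5" and X12: "card X = 12" shows False
proof -
  obtain i where i: "card (conj_class P) = q ^ i" using conj_class_power[OF PY] by blast
  have n: "3 \<le> q ^ i" "q ^ i \<le> 5" "p + 1 \<le> q ^ i" "q ^ i mod p = 1"
    using conj_class_ge3[OF PY] n_le Y5 card_conj_class_Y[OF PY] n_mod i by auto
  have "prime (5::nat)" by simp
  then have q5: "q = 5" using primes_dvd_imp_eq[OF q, of 5] q_dvd_Y Y5 by simp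
  have "i = 1"
  proof -
    have "i \<noteq> 0" using n(1) by (intro notI) simp
    moreover have "\<not> 2 \<le> i"
    proof
      assume "2 \<le> i"
      then have "(5::nat) ^ 2 \<le> 5 ^ i" by (intro power_increasing) auto
      then show False using n(2) q5 by simp
    qed
    ultimately show ?thesis by simp
  qed
  then have n5: "card (conj_class P) = 5" using i q5 by simp
  have p2: "p = 2"
  proof -
    have "p \<in> {2,3,4}" using n \<open>i = 1\<close> q5 prime_ge_2_nat[OF p] by auto
    moreover have "p \<noteq> 4" using p by auto
    ultimately show ?thesis using n(4) \<open>i = 1\<close> q5 by auto
  qed
  have YC: "conj_class P = Y" by (rule card_subset_eq[OF fin_XY(2) Y_conj_class[OF PY]]) (simp add: n5 Y5)
  have "card (Normalizer P) = card P" by (rule conj_class_card[OF Pc]) (simp add: YC Normalizer_Y[OF PY])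
  then have "5 * p ^ a = q ^ b * p ^ a" using card_conj_class[OF Pc] n5 cG cP by simp
  then have Q5: "card Q = 5" unfolding cQ by (simp only: mult_right_cancel[OF gr_implies_not0[OF pa_pos]])
  have x4: "x [^] (4::nat) \<in> Normalizer e" if e: "e \<in> conj_class P" for e
  proof -
    have es: "subgroup (Normalizer e) G" by (rule Normalizer_subgroup[OF sub_carrier[OF conj_class_subgroup[OF Ps e]]])
    have m: "card (conj_class P) \<le> 4 + 1" using n5 by simp
    show ?thesis
      using fixes_others[OF xNmP Pc m e]
    proof (elim disjE exE conjE)
      assume "e = P" then show ?thesis using pow_mem[OF es] xNmP by simp
    next
      fix d :: nat assume d: "1 \<le> d" "d \<le> 4" "x [^] d \<in> Normalizer e"
      show ?thesis
      proof (cases "p dvd d")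
        case False
        then show ?thesis using pow_mem[OF es pow_stab[OF es d(3)]] by simp
      next
        case True
        then have "d = 2 \<or> d = 4" using d p2 by presburger
        then show ?thesis
        proof
          assume "d = 2"
          then have "(x [^] (2::nat)) [^] (2::nat) \<in> Normalizer e" using pow_mem[OF es] d(3) by simp
          then show ?thesis using xc by (simp add: nat_pow_pow)
        next
          assume "d = 4" then show ?thesis using d by simp
        qed
      qed
    qed
  qed
  have x4P: "(g \<otimes> x \<otimes> inv g) [^] (4::nat) \<in> P" if g: "g \<in> carrier G" for g
  proof -
    define w where "w = g \<otimes> x [^] (4::nat) \<otimes> inv g"
    have wc: "w \<in> carrier G" unfolding w_def using g xc by simp
    have "conjg (inv g) P \<in> conj_class P" unfolding conj_class_def using g by simp
    then have "conjg (x [^] (4::nat)) (conjg (inv g) P) = conjg (inv g) P" using x4 NormalizerD(2) by blast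
    then have "conjg w P = P" unfolding w_def
      using conjg_mult[of "g \<otimes> x [^] (4::nat)" "inv g" P] conjg_mult[of g "x [^] (4::nat)" "conjg (inv g) P"]
        conjg_inv(2)[OF g Pc] g xc Pc conjg_subset[of "inv g" P] by simp
    then have wN: "w \<in> Normalizer P" unfolding Normalizer_def using wc by simp
    have Ws: "subgroup (generate G {w}) G" by (rule gen_sub[OF wc])
    have "w [^] (p ^ a) = \<one>"
    proof -
      have "(x [^] (4::nat)) [^] (p ^ a) = (x [^] (p ^ a)) [^] (4::nat)" using xc by (simp add: nat_pow_pow mult.commute)
      then have "(x [^] (4::nat)) [^] (p ^ a) = \<one>" using x_pow_ord by simp
      then show ?thesis unfolding w_def using conj_pow[OF g nat_pow_closed[OF xc, of 4], of "p ^ a"] g by simp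
    qed
    then have "ord w dvd p ^ a" using pow_eq_id[OF wc] by simp
    then obtain j where "card (generate G {w}) = p ^ j" using generate_pow_card[OF wc] divides_primepow_nat[OF p] by auto
    then have "generate G {w} \<subseteq> P"
      by (rule syl_absorb[OF p subgroup_self Psyl Ws sub_carrier[OF Ws] _ gen_subset[OF Normalizer_subgroup[OF Pc] wN]])
    then have "w \<in> P" using gen_in by blast
    then show ?thesis using conj_pow[OF g xc, of 4] unfolding w_def by simp
  qed
  define A where "A = {T. subgroup T G \<and> T \<subseteq> P \<and> T \<noteq> P}"
  have QV: "Q \<noteq> {\<one>}" using XD(3)[OF QX] proper_nontrivD(2) by blast
  \<comment> \<open>The modular law makes the map \<open>T \<mapsto> T <#> Q\<close> injective.\<close>
  have ded: "(T <#> Q) \<inter> P = T" if T: "T \<in> A" for T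
  proof -
    have Ts: "subgroup T G" "T \<subseteq> P" using T unfolding A_def by auto
    show ?thesis
    proof (intro equalityI subsetI)
      fix s assume "s \<in> T" then show "s \<in> (T <#> Q) \<inter> P" using subset_set_mult(1)[OF Ts(1) Qs] Ts(2) by blast
    next
      fix s assume "s \<in> (T <#> Q) \<inter> P"
      then obtain t u where tu: "t \<in> T" "u \<in> Q" "s = t \<otimes> u" "s \<in> P" unfolding set_mult_def by blast
      have c: "t \<in> carrier G" "u \<in> carrier G" using tu subgroup.mem_carrier[OF Ts(1)] subgroup.mem_carrier[OF Qs] by auto
      have "u = inv t \<otimes> s" using tu(3) c by (simp add: m_assoc[symmetric])
      moreover have "inv t \<otimes> s \<in> P"
        by (rule subgroup.m_closed[OF Ps subgroup.m_inv_closed[OF Ps] tu(4)]) (use tu(1) Ts(2) in blast)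
      ultimately have "u = \<one>" using QP1 tu(2) by blast
      then show "s \<in> T" using tu(1,3) c by simp
    qed
  qed
  have "inj_on (\<lambda>T. T <#> Q) A"
  proof (rule inj_onI)
    fix T T' assume T: "T \<in> A" "T' \<in> A" "T <#> Q = T' <#> Q"
    then have "(T <#> Q) \<inter> P = (T' <#> Q) \<inter> P" by simp
    then show "T = T'" using ded[OF T(1)] ded[OF T(2)] by simp
  qed
  moreover have "(\<lambda>T. T <#> Q) ` A \<subseteq> X"
  proof
    fix z assume "z \<in> (\<lambda>T. T <#> Q) ` A"
    then obtain T where T: "T \<in> A" and z: "z = T <#> Q" by blast
    have Ts: "subgroup T G" "T \<noteq> P" using T unfolding A_def by auto
    have zs: "subgroup z G" unfolding z by (rule normal_mult_subgroup[OF Qn Ts(1)])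
    have Qz: "Q \<subseteq> z" unfolding z by (rule subset_set_mult(2)[OF Ts(1) Qs])
    have "z \<in> proper_nontriv"
    proof (rule proper_nontrivI[OF zs])
      show "z \<noteq> {\<one>}" using Qz QV subgroup.one_closed[OF Qs] by blast
      show "z \<noteq> carrier G" using ded[OF T] Ts(2) Pc unfolding z by auto
    qed
    then show "z \<in> X" by (rule X_I[OF _ PY prod_mono[OF QP Qz sub_carrier[OF zs] Pc]])
  qed
  ultimately have cA: "card A \<le> 12" using card_inj_on_le[OF _ _ fin_XY(1)] X12 by metis
  have finA: "finite A"
    by (rule finite_subset[of _ "Pow P"]) (use fin_sub[OF Ps] in \<open>auto simp: A_def\<close>)
  have oneA: "{\<one>} \<in> A"
  proof -
    have "P \<noteq> {\<one>}" using proper_nontrivD(2)[OF YD(4)[OF PY]] .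
    then show ?thesis unfolding A_def using triv_subgroup subgroup.one_closed[OF Ps] by simp
  qed
  \<comment> \<open>On a cyclic 2-group, the image under squaring is the subgroup of index 2.\<close>
  define sq where "sq = (\<lambda>S. (\<lambda>z. z \<otimes> z) ` S)"
  have sub: "proper_nontriv - X - Y \<subseteq> (A - {{\<one>}}) \<union> sq ` conj_class P"
  proof
    fix S assume S: "S \<in> proper_nontriv - X - Y"
    have Ss: "subgroup S G" and S1: "S \<noteq> {\<one>}" and SV: "S \<in> proper_nontriv" and SX: "S \<notin> X" and SY: "S \<notin> Y"
      using S proper_nontrivD by auto
    have nQS: "\<not> Q \<subseteq> S"
    proof
      assume "Q \<subseteq> S"
      then have "S <#> P = carrier G" by (rule prod_mono[OF QP _ sub_carrier[OF Ss] Pc])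
      then show False using X_I[OF SV PY] SX by simp
    qed
    have Is: "subgroup (S \<inter> Q) G" by (rule subgroups_Inter_pair[OF Ss Qs])
    have "card (S \<inter> Q) dvd 5" using card_dvd[OF Qs Is] Q5 by simp
    moreover have "card (S \<inter> Q) \<noteq> 5"
    proof
      assume "card (S \<inter> Q) = 5"
      then have "S \<inter> Q = Q" using sub_eq_card[OF _ Qs] Q5 by simp
      then show False using nQS by blast
    qed
    ultimately have c1: "card (S \<inter> Q) = 1" using \<open>prime 5\<close> prime_nat_iff by blast
    have SQ: "subgroup (S <#> Q) G" by (rule normal_mult_subgroup[OF Qn Ss])
    have "card S * 5 dvd p ^ a * 5"
      using set_mult_inter_card[OF Ss Qs fin_sub[OF Ss] fin_sub[OF Qs]] c1 Q5 card_dvd_carrier[OF SQ] cG cQ by (simp add: mult.commute)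
    then have "card S dvd p ^ a" by simp
    then obtain j where j: "card S = p ^ j" using divides_primepow_nat[OF p] by blast
    obtain g where g: "g \<in> carrier G" "S \<subseteq> conjg g P"
      using p_subgroup_conj[OF p subgroup_self Ss sub_carrier[OF Ss] j Ps Pc sylD(4)[OF Psyl]] by blast
    define x' where "x' = g \<otimes> x \<otimes> inv g"
    have x'c: "x' \<in> carrier G" unfolding x'_def using g(1) xc by simp
    have x'pw: "x' [^] n = g \<otimes> x [^] n \<otimes> inv g" for n :: nat unfolding x'_def by (rule conj_pow[OF g(1) xc])
    have x'o: "x' [^] ((2::nat) ^ a) = \<one>" using x'pw[of "2 ^ a"] x_pow_ord p2 g(1) by simp
    have el: "\<exists>n::nat. z = x' [^] n" if z: "z \<in> conjg g P" for z
    proof -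
      obtain y where y: "y \<in> P" "z = g \<otimes> y \<otimes> inv g" using z unfolding conjg_def by blast
      obtain n where n: "y = x [^] (n::nat)" using gen_elem[OF xc] y(1) unfolding P_def by blast
      have "z = x' [^] n" unfolding x'pw using y(2) n by simp
      then show ?thesis by blast
    qed
    have gP: "conjg g P \<in> Y" using YC g(1) unfolding conj_class_def by blast
    have x'S: "x' \<notin> S"
    proof
      assume x'S: "x' \<in> S"
      have "conjg g P \<subseteq> S"
      proof
        fix z assume "z \<in> conjg g P"
        then obtain n where "z = x' [^] (n::nat)" using el by blast
        then show "z \<in> S" using pow_mem[OF Ss x'S] by simp
      qed
      then have "S = conjg g P" using g(2) by blast
      then show False using gP SY by simp
    qed
    have odd_pw: "even n" if "x' [^] n \<in> S" for n :: nat
    proof (rule ccontr)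
      assume "odd n"
      have "x' \<in> S"
      proof (rule pow_coprime_mem[OF Ss x'c that])
        show "x' [^] ((2::nat) ^ a) \<in> S" unfolding x'o by (rule subgroup.one_closed[OF Ss])
        show "coprime n (2 ^ a)" using \<open>odd n\<close> by simp
      qed
      then show False using x'S by simp
    qed
    show "S \<in> (A - {{\<one>}}) \<union> sq ` conj_class P"
    proof (cases "\<forall>n::nat. x' [^] n \<in> S \<longrightarrow> 4 dvd n")
      case True
      have "S \<subseteq> P"
      proof
        fix s assume s: "s \<in> S"
        then obtain n where n: "s = x' [^] (n::nat)" using el g(2) by blast
        then obtain k where "n = 4 * k" using True s by blast
        then have "s = (x' [^] (4::nat)) [^] k" using n x'c by (simp add: nat_pow_pow)
        then show "s \<in> P" using pow_mem[OF Ps x4P[OF g(1)]] unfolding x'_def by simp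
      qed
      moreover have "S \<noteq> P" using SY PY by blast
      ultimately show ?thesis unfolding A_def using Ss S1 by simp
    next
      case False
      then obtain n where n: "x' [^] (n::nat) \<in> S" "\<not> 4 dvd n" by blast
      obtain m where m: "n = 2 * m" using odd_pw[OF n(1)] by blast
      have om: "odd m" using m n(2) by auto
      have x2: "x' [^] (2::nat) \<in> S"
      proof (rule pow_coprime_mem[OF Ss nat_pow_closed[OF x'c]])
        show "(x' [^] (2::nat)) [^] m \<in> S" using n(1) m x'c by (simp add: nat_pow_pow)
        have "(x' [^] (2::nat)) [^] ((2::nat) ^ a) = (x' [^] ((2::nat) ^ a)) [^] (2::nat)" using x'c by (simp add: nat_pow_pow mult.commute)
        then show "(x' [^] (2::nat)) [^] ((2::nat) ^ a) \<in> S" using x'o subgroup.one_closed[OF Ss] by simp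
        show "coprime m (2 ^ a)" using om by simp
      qed
      have "S = sq (conjg g P)"
      proof (intro equalityI subsetI)
        fix s assume s: "s \<in> S"
        then obtain k where k: "s = x' [^] (k::nat)" using el g(2) by blast
        then obtain l where l: "k = l + l" using odd_pw[of k] s by (metis evenE mult_2)
        have "s = x' [^] l \<otimes> x' [^] l" using k l x'c by (simp add: nat_pow_mult)
        moreover have "x' [^] l \<in> conjg g P"
          unfolding x'pw conjg_def using pow_mem[OF Ps xP] by blast
        ultimately show "s \<in> sq (conjg g P)" unfolding sq_def by blast
      next
        fix s assume "s \<in> sq (conjg g P)"
        then obtain z where z: "z \<in> conjg g P" "s = z \<otimes> z" unfolding sq_def by blast
        then obtain k where k: "z = x' [^] (k::nat)" using el by blast
        have "s = (x' [^] (2::nat)) [^] k" using z(2) k x'c by (simp add: nat_pow_mult nat_pow_pow mult_2)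
        then show "s \<in> S" using pow_mem[OF Ss x2] by simp
      qed
      then show ?thesis unfolding conj_class_def using g(1) by blast
    qed
  qed
  have "card (proper_nontriv - X - Y) \<le> card ((A - {{\<one>}}) \<union> sq ` conj_class P)"
    by (rule card_mono[OF _ sub]) (use finA fin_conj_class in simp)
  also have "\<dots> \<le> card (A - {{\<one>}}) + card (sq ` conj_class P)" by (rule card_Un_le)
  also have "\<dots> \<le> 11 + 5"
  proof (rule add_mono)
    show "card (A - {{\<one>}}) \<le> 11" using finA oneA cA by simp
    show "card (sq ` conj_class P) \<le> 5" using card_image_le[OF fin_conj_class, of sq P] n5 by simp
  qed
  finally show False using isolated_ge by simp
qed

end

context comax_prime_index begin

lemma impossible: False
proof -
  obtain q Q b x a where *: "prime q" "q \<noteq> p" "Q \<lhd> G" "card Q = q ^ b" "x \<in> carrier G" "x \<notin> M" "ord x = p ^ a"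
    "Q <#> generate G {x} = carrier G" "Q \<in> X" "sylow_subgroup p (generate G {x}) (carrier G)"
    using cyclic_sylow_complement by (elim exE conjE)
  interpret comax_cyclic_sylow G X Y M p q b a Q x
    by (intro comax_cyclic_sylow.intro comax_prime_index_axioms comax_cyclic_sylow_axioms.intro *)
  show False using five_twelve_impossible twelve_five_impossible XY_card by blast
qed

end

context bipartite_comax begin

text \<open>
  Since the graph has an edge, some vertex is outside \<open>M\<close>, and \<open>M\<close> is adjacent to it.
\<close>
lemma no_prime_index_normal:
  assumes M: "M \<lhd> G" and p: "prime p" and Mp: "card M * p = card (carrier G)"
  shows False
proof -
  have Ms: "subgroup M G" using M normal_imp_subgroup by blast
  have Mne: "M \<noteq> carrier G" using Mp prime_gt_1_nat[OF p] card_pos[OF Ms] by auto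
  obtain H K where HK: "H \<in> X" "K \<in> Y"
  proof -
    have "X \<noteq> {}" "Y \<noteq> {}" using XY_card by auto
    then show ?thesis using that by blast
  qed
  have HV: "H \<in> proper_nontriv" "K \<in> proper_nontriv" using HK XV YV by auto
  have prod: "H <#> K = carrier G" using edge[OF HV] HK by simp
  have "\<exists>L\<in>proper_nontriv. \<not> L \<subseteq> M"
  proof (rule ccontr)
    assume "\<not> (\<exists>L\<in>proper_nontriv. \<not> L \<subseteq> M)"
    then have "H \<subseteq> M" "K \<subseteq> M" using HV by auto
    then have "H <#> K \<subseteq> M" unfolding set_mult_def using subgroup.m_closed[OF Ms] by blast
    then show False using prod Mne subset_antisym[OF sub_carrier[OF Ms]] by simp
  qed
  then obtain L where L: "L \<in> proper_nontriv" "\<not> L \<subseteq> M" by blast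
  have MLp: "M <#> L = carrier G" by (rule prime_index_prod[OF M p Mp proper_nontrivD(1)[OF L(1)] L(2)])
  have "M \<noteq> {\<one>}"
  proof
    assume "M = {\<one>}"
    then have "card (carrier G) = p" using Mp by simp
    then have "card L dvd p" using card_dvd_carrier[OF proper_nontrivD(1)[OF L(1)]] by simp
    then have "card L = 1 \<or> card L = card (carrier G)" using p \<open>card (carrier G) = p\<close> prime_nat_iff by blast
    moreover have "card L \<noteq> card (carrier G)" using proper_nontrivD[OF L(1)] sub_eq_card[OF sub_carrier subgroup_self] by blast
    moreover have "card L \<noteq> 1"
    proof
      assume "card L = 1"
      then obtain z where "L = {z}" using card_1_singletonE by blast
      then show False using proper_nontrivD[OF L(1)] subgroup.one_closed by blast
    qed
    ultimately show False by blast
  qed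
  then have "M \<in> proper_nontriv" using proper_nontrivI[OF Ms] Mne by blast
  then have "M \<in> X \<or> M \<in> Y" using edge[OF _ L(1)] MLp by blast
  then show False
  proof
    assume "M \<in> X"
    then have "comax_prime_index G X Y M p" by (intro comax_prime_index.intro bipartite_comax_axioms comax_prime_index_axioms.intro M p Mp)
    then show False by (rule comax_prime_index.impossible)
  next
    assume "M \<in> Y"
    then have "comax_prime_index G Y X M p" by (intro comax_prime_index.intro swap comax_prime_index_axioms.intro M p Mp)
    then show False by (rule comax_prime_index.impossible)
  qed
qed

end

section \<open>Perfect groups of order 60\<close>

text \<open>
  Perfectness enters through the absence of normal subgroups of prime index, and order 12 is the order of a point
  stabilizer in $A_5$.
\<close>
locale perfect60 = fin_group +
  assumes c60: "card (carrier G) = 60"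
    and no_prime_index: "\<And>N p. N \<lhd> G \<Longrightarrow> prime p \<Longrightarrow> card N * p = card (carrier G) \<Longrightarrow> False"
    and ex12: "\<exists>S. subgroup S G \<and> card S = 12"
begin

lemma no_index: assumes "subgroup U G" "card U * n = 60" shows "n \<notin> {2, 3, 4}"
proof (rule no_small_index[OF one_is_normal _ assms(1)])
  show "{\<one>} \<subseteq> U" using subgroup.one_closed[OF assms(1)] by simp
  show "card U * n = card (carrier G)" using assms(2) c60 by simp
  show False if "N \<lhd> G" "{\<one>} \<subseteq> N" "prime p" "card N * p = card (carrier G)" for N p
    by (rule no_prime_index[OF that(1,3,4)])
qed

lemma dvd60: "subgroup U G \<Longrightarrow> card U dvd 60" using card_dvd_carrier c60 by metis

lemma whole: "subgroup U G \<Longrightarrow> card U = 60 \<Longrightarrow> U = carrier G"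
  using sub_eq_card[OF sub_carrier subgroup_self] c60 by simp

lemma sylI: assumes "subgroup P G" "P \<subseteq> S" "card P = p ^ a" "\<not> p dvd card S div p ^ a" shows "sylow_subgroup p P S"
  unfolding sylow_subgroup_def using assms by auto

lemma syl5: "subgroup C G \<Longrightarrow> card C = 5 \<Longrightarrow> sylow_subgroup 5 C (carrier G)"
  by (rule sylI[of _ _ _ 1]) (use sub_carrier c60 in auto)
lemma syl3: "subgroup C G \<Longrightarrow> card C = 3 \<Longrightarrow> sylow_subgroup 3 C (carrier G)"
  by (rule sylI[of _ _ _ 1]) (use sub_carrier c60 in auto)
lemma syl2: "subgroup C G \<Longrightarrow> card C = 4 \<Longrightarrow> sylow_subgroup 2 C (carrier G)"
  by (rule sylI[of _ _ _ 2]) (use sub_carrier c60 in auto)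

lemma exists_sub: 
  "\<exists>C. subgroup C G \<and> card C = 5" "\<exists>C. subgroup C G \<and> card C = 3"
  "\<exists>C. subgroup C G \<and> card C = 4" "\<exists>C. subgroup C G \<and> card C = 2"
  using prime_power_subgroup[of 5 "carrier G" 1] prime_power_subgroup[of 3 "carrier G" 1]
    prime_power_subgroup[of 2 "carrier G" 2] prime_power_subgroup[of 2 "carrier G" 1] subgroup_self c60 by auto

lemma card_mult_normal:
  assumes N: "N \<lhd> G" and H: "subgroup H G" and c: "coprime (card H) (card N)"
  shows "card (H <#> N) = card H * card N"
proof -
  have Ns: "subgroup N G" using N normal_imp_subgroup by blast
  show ?thesis using set_mult_inter_card[OF H Ns fin_sub[OF H] fin_sub[OF Ns]] coprime_inter[OF H Ns c] by simp
qed

text \<open>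
  A product with a Sylow subgroup of order 4 or 5 would have index 3 or 4.
\<close>
lemma not_normal: assumes N: "N \<lhd> G" and c: "card N \<in> {3, 4, 5}" shows False
proof -
  obtain C V where C: "subgroup C G" "card C = 5" and V: "subgroup V G" "card V = 4"
    using exists_sub by blast
  consider "card N = 3" | "card N = 4" | "card N = 5" using c by blast
  then show False
  proof cases
    case 1
    have "coprime (5::nat) 3" by (simp add: coprime_iff_gcd_eq_1 gcd_non_0_nat)
    then show False using card_mult_normal[OF N C(1)] C(2) 1 no_index[OF normal_mult_subgroup[OF N C(1)], of 4] by simp
  next
    case 2
    have "coprime (5::nat) 4" by (simp add: coprime_iff_gcd_eq_1 gcd_non_0_nat)
    then show False using card_mult_normal[OF N C(1)] C(2) 2 no_index[OF normal_mult_subgroup[OF N C(1)], of 3] by simp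
  next
    case 3
    have "coprime (4::nat) 5" by (simp add: coprime_iff_gcd_eq_1 gcd_non_0_nat)
    then show False using card_mult_normal[OF N V(1)] V(2) 3 no_index[OF normal_mult_subgroup[OF N V(1)], of 3] by simp
  qed
qed

lemma Normalizer_proper: assumes s: "subgroup H G" and c: "card H \<in> {3, 4, 5}" shows "card (Normalizer H) \<noteq> 60"
proof
  assume "card (Normalizer H) = 60"
  then have "Normalizer H = carrier G" by (rule whole[OF Normalizer_subgroup[OF sub_carrier[OF s]]])
  then have "H \<lhd> G" using normal_iff_Normalizer[OF s] by simp
  then show False using not_normal c by blast
qed

text \<open>
  The number of conjugates divides 12, is 1 modulo 5 and not 1.
\<close>
lemma order5_class_normalizer: assumes C: "subgroup C G" "card C = 5" shows "card (conj_class C) = 6" "card (Normalizer C) = 10"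
proof -
  have Cc: "C \<subseteq> carrier G" by (rule sub_carrier[OF C(1)])
  have "5 dvd card (Normalizer C)" using card_dvd[OF Normalizer_subgroup[OF Cc] C(1) subset_Normalizer[OF C(1)]] C(2) by simp
  then obtain t where t: "card (Normalizer C) = 5 * t" by blast
  have ct: "card (conj_class C) * t = 12" using card_conj_class[OF Cc] t c60 by (simp add: mult.commute)
  then have "card (conj_class C) dvd 12" by (metis dvd_triv_left)
  then have "card (conj_class C) \<le> 12" by (rule dvd_imp_le) simp
  moreover have "card (conj_class C) mod 5 = 1" by (rule syl_conj_class_count[OF _ syl5[OF C]]) simp
  ultimately have "card (conj_class C) = 1 \<or> card (conj_class C) = 6 \<or> card (conj_class C) = 11" by presburger
  moreover have "card (conj_class C) \<noteq> 11" using \<open>card (conj_class C) dvd 12\<close> by auto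
  moreover have "card (conj_class C) \<noteq> 1" using Normalizer_proper[OF C(1)] C(2) card_conj_class[OF Cc] c60 by auto
  ultimately show 1: "card (conj_class C) = 6" by simp
  then show "card (Normalizer C) = 10" using ct t by simp
qed

text \<open>
  The number of conjugates divides 20, is 1 modulo 3, and is neither 1 nor 4.
\<close>
lemma order3_normalizer: assumes C: "subgroup C G" "card C = 3" shows "card (Normalizer C) = 6"
proof -
  have Cc: "C \<subseteq> carrier G" by (rule sub_carrier[OF C(1)])
  have "3 dvd card (Normalizer C)" using card_dvd[OF Normalizer_subgroup[OF Cc] C(1) subset_Normalizer[OF C(1)]] C(2) by simp
  then obtain t where t: "card (Normalizer C) = 3 * t" by blast
  have ct: "card (conj_class C) * t = 20" using card_conj_class[OF Cc] t c60 by (simp add: mult.commute)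
  then have d: "card (conj_class C) dvd 20" by (metis dvd_triv_left)
  then have "card (conj_class C) \<le> 20" by (rule dvd_imp_le) simp
  moreover have "card (conj_class C) mod 3 = 1" by (rule syl_conj_class_count[OF _ syl3[OF C]]) simp
  ultimately have "card (conj_class C) \<in> {1,4,7,10,13,16,19}" by (simp; presburger)
  moreover have "card (conj_class C) \<noteq> 1" using Normalizer_proper[OF C(1)] C(2) card_conj_class[OF Cc] c60 by auto
  moreover have "card (conj_class C) \<noteq> 4" using no_index[OF Normalizer_subgroup[OF Cc], of 4] card_conj_class[OF Cc] c60 by (auto simp: mult.commute)
  ultimately have "card (conj_class C) = 10" using d by auto
  then show ?thesis using ct t by simp
qed

text \<open>
  The conjugates of \<open>C\<close> under \<open>K\<close> are 1 or 6 in number. Six would make the order of \<open>K\<close> divisible by 30.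
\<close>
lemma proper_order_dvd5:
  assumes K: "subgroup K G" "K \<noteq> carrier G" "5 dvd card K"
  shows "card K \<in> {5, 10}" "\<exists>C. subgroup C G \<and> card C = 5 \<and> C \<subseteq> K \<and> K \<subseteq> Normalizer C"
proof -
  obtain C where C: "subgroup C G" "C \<subseteq> K" "card C = 5"
    using prime_power_subgroup[of 5 K 1] K by auto
  have Cc: "C \<subseteq> carrier G" by (rule sub_carrier[OF C(1)])
  have NC: "subgroup (Normalizer C) G" by (rule Normalizer_subgroup[OF Cc])
  define m where "m = card ((\<lambda>g. conjg g C) ` K)"
  have mK: "m * card (K \<inter> Normalizer C) = card K" unfolding m_def by (rule card_orbit_conjg[OF K(1) Cc])
  obtain k where k: "card K = 5 * k" using K(3) by blast
  have k12: "k dvd 12"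
  proof -
    have "5 * k dvd 5 * 12" using dvd60[OF K(1)] k by simp
    then show ?thesis by (simp only: dvd_times_left_cancel_iff)
  qed
  have "sylow_subgroup 5 C K"
  proof (rule sylI[OF C(1,2), of 5 1])
    have "\<not> 5 dvd k" using k12 dvd_trans[of 5 k 12] by auto
    then show "\<not> 5 dvd card K div 5 ^ 1" using k by simp
  qed (use C in simp)
  then have m5: "m mod 5 = 1" unfolding m_def by (intro syl_count[OF _ K(1)]) simp_all
  have "(\<lambda>g. conjg g C) ` K \<subseteq> conj_class C" unfolding conj_class_def using sub_carrier[OF K(1)] by blast
  then have "m \<le> 6" unfolding m_def using card_mono[OF fin_conj_class] order5_class_normalizer(1)[OF C(1,3)] by metis
  then have "m = 1 \<or> m = 6" using m5 by presburger
  moreover have "m \<noteq> 6"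
  proof
    assume "m = 6"
    then have "6 dvd 5 * k" using mK k by (metis dvd_triv_left)
    then have "6 dvd k" by presburger
    moreover have "k \<le> 12" "k \<noteq> 0" using k12 dvd_imp_le[of k 12] by (simp, intro notI) simp
    ultimately have "k = 6 \<or> k = 12" by presburger
    then show False
    proof
      assume "k = 6" then show False using no_index[OF K(1), of 2] k by simp
    next
      assume "k = 12" then show False using whole[OF K(1)] K(2) k by simp
    qed
  qed
  ultimately have "card (K \<inter> Normalizer C) = card K" using mK by simp
  then have "K \<inter> Normalizer C = K" using sub_eq_card[of "K \<inter> Normalizer C" K] K(1) by simp
  then have KN: "K \<subseteq> Normalizer C" by blast
  then show "\<exists>C. subgroup C G \<and> card C = 5 \<and> C \<subseteq> K \<and> K \<subseteq> Normalizer C" using C by blast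
  have "5 * k dvd 5 * 2" using card_dvd[OF NC K(1) KN] order5_class_normalizer(2)[OF C(1,3)] k by simp
  then have "k dvd 2" by (simp only: dvd_times_left_cancel_iff)
  then have "k = 1 \<or> k = 2" using two_is_prime_nat prime_nat_iff by blast
  then show "card K \<in> {5, 10}" using k by auto
qed

lemma order5_in_normalizer_unique: assumes "subgroup C G" "card C = 5" "subgroup C' G" "card C' = 5" "C' \<subseteq> Normalizer C" shows "C' = C"
proof -
  have "C' \<subseteq> C"
    by (rule syl_absorb[OF _ subgroup_self syl5[OF assms(1,2)] assms(3) sub_carrier[OF assms(3)], of 1])
      (use assms in auto)
  then show ?thesis using sub_eq_card[OF _ assms(1)] assms by simp
qed

definition order12_subs :: "'a set set" where "order12_subs = {H. subgroup H G \<and> card H = 12}"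
definition div5_subs :: "'a set set" where "div5_subs = {K. subgroup K G \<and> K \<noteq> carrier G \<and> 5 dvd card K}"

text \<open>
  Taking normalizers is a bijection from the six subgroups of order 5 to the subgroups of order 10.
\<close>
lemma card_div5_subs: "card div5_subs = 12"
proof -
  obtain C where C: "subgroup C G" "card C = 5" using exists_sub by blast
  define F where "F = {K. subgroup K G \<and> card K = 5}"
  define E where "E = {K. subgroup K G \<and> card K = 10}"
  have FC: "F = conj_class C"
  proof (intro equalityI subsetI)
    fix K assume "K \<in> F"
    then have "sylow_subgroup 5 K (carrier G)" unfolding F_def using syl5 by simp
    then show "K \<in> conj_class C" using syl_conj[OF _ subgroup_self syl5[OF C]] unfolding conj_class_def by auto
  next
    fix K assume "K \<in> conj_class C"
    then show "K \<in> F" unfolding F_def using conj_class_subgroup[OF C(1)] conj_class_card[OF sub_carrier[OF C(1)]] C(2) by simp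
  qed
  have cF: "card F = 6" unfolding FC by (rule order5_class_normalizer(1)[OF C])
  have "bij_betw Normalizer F E"
    unfolding bij_betw_def
  proof (intro conjI equalityI subsetI)
    show "inj_on Normalizer F"
    proof (rule inj_onI)
      fix K L assume KL: "K \<in> F" "L \<in> F" "Normalizer K = Normalizer L"
      then have "K \<subseteq> Normalizer L" using subset_Normalizer[of K] unfolding F_def by simp
      then show "K = L" using order5_in_normalizer_unique[of L K] KL unfolding F_def by simp
    qed
    fix K assume "K \<in> Normalizer ` F"
    then show "K \<in> E" unfolding F_def E_def using order5_class_normalizer(2) Normalizer_subgroup[OF sub_carrier] by auto
  next
    fix K assume "K \<in> E"
    then have K: "subgroup K G" "card K = 10" unfolding E_def by auto
    have "K \<noteq> carrier G" using K c60 by auto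
    then obtain D where D: "subgroup D G" "card D = 5" "D \<subseteq> K" "K \<subseteq> Normalizer D" using proper_order_dvd5(2)[OF K(1)] K(2) by auto
    have "K = Normalizer D" using sub_eq_card[OF D(4) Normalizer_subgroup[OF sub_carrier[OF D(1)]]] order5_class_normalizer(2)[OF D(1,2)] K(2) by simp
    then show "K \<in> Normalizer ` F" unfolding F_def using D by blast
  qed
  then have cE: "card E = 6" using cF by (metis bij_betw_same_card)
  have "div5_subs = F \<union> E"
  proof (intro equalityI subsetI)
    fix K assume "K \<in> div5_subs" then show "K \<in> F \<union> E" unfolding div5_subs_def F_def E_def using proper_order_dvd5(1)[of K] by auto
  next
    fix K assume "K \<in> F \<union> E"
    then show "K \<in> div5_subs" unfolding div5_subs_def F_def E_def using c60 by auto
  qed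
  moreover have "F \<inter> E = {}" unfolding F_def E_def by auto
  moreover have "finite F" "finite E" using cF cE card_gt_0_iff by (metis zero_less_numeral)+
  ultimately show ?thesis using card_Un_disjoint[of F E] cF cE by simp
qed

text \<open>
  The four Sylow 3-subgroups of \<open>H\<close> occupy eight non-trivial elements, which leaves room for a single subgroup of order 4.
\<close>
lemma order12_complement:
  assumes H: "subgroup H G" "card H = 12"
  shows "\<exists>D. \<forall>V. subgroup V G \<longrightarrow> card V = 4 \<longrightarrow> V \<subseteq> H \<longrightarrow> V = H - D"
proof -
  obtain W where W: "subgroup W G" "W \<subseteq> H" "card W = 3"
    using prime_power_subgroup[of 3 H 1] H by auto
  have Wc: "W \<subseteq> carrier G" by (rule sub_carrier[OF W(1)])
  define E where "E = (\<lambda>g. conjg g W) ` H"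
  have mH: "card E * card (H \<inter> Normalizer W) = 12" unfolding E_def using card_orbit_conjg[OF H(1) Wc] H(2) by simp
  have "sylow_subgroup 3 W H" by (rule sylI[OF W(1,2), of 3 1]) (use W H in auto)
  then have m3: "card E mod 3 = 1" unfolding E_def by (intro syl_count[OF _ H(1)]) simp_all
  have "card E dvd 12" using mH by (metis dvd_triv_left)
  then have "card E \<le> 12" by (rule dvd_imp_le) simp
  then have "card E \<in> {1,4,7,10}" using m3 by (simp; presburger)
  moreover have "card E \<noteq> 1"
  proof
    assume "card E = 1"
    then have "card (H \<inter> Normalizer W) = 12" using mH by simp
    moreover have "card (H \<inter> Normalizer W) \<le> card (Normalizer W)"
      by (rule card_mono[OF fin_sub[OF Normalizer_subgroup[OF Wc]]]) simp
    ultimately show False using order3_normalizer[OF W(1,3)] by simp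
  qed
  ultimately have E4: "card E = 4" using \<open>card E dvd 12\<close> by auto
  have finE: "finite E" unfolding E_def using fin_sub[OF H(1)] by simp
  have Esub: "subgroup e G" "card e = 3" "e \<subseteq> H" if e: "e \<in> E" for e
  proof -
    obtain g where g: "g \<in> H" "e = conjg g W" using e unfolding E_def by blast
    have gc: "g \<in> carrier G" using g(1) subgroup.mem_carrier[OF H(1)] by simp
    show "subgroup e G" "card e = 3" "e \<subseteq> H"
      using g conjg_subgroup[OF gc W(1)] card_conjg[OF gc Wc] W(3) conjg_subset_self[OF H(1) g(1) W(2)] by auto
  qed
  define D where "D = (\<Union>e\<in>E. e - {\<one>})"
  have "card D = (\<Sum>e\<in>E. card (e - {\<one>}))"
    unfolding D_def
  proof (rule card_UN_disjoint[OF finE])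
    show "\<forall>i\<in>E. finite (i - {\<one>})" using Esub(1) fin_sub by blast
    show "\<forall>i\<in>E. \<forall>j\<in>E. i \<noteq> j \<longrightarrow> (i - {\<one>}) \<inter> (j - {\<one>}) = {}"
    proof (intro ballI impI)
      fix i j assume ij: "i \<in> E" "j \<in> E" "i \<noteq> j"
      have I: "subgroup (i \<inter> j) G" by (rule subgroups_Inter_pair[OF Esub(1)[OF ij(1)] Esub(1)[OF ij(2)]])
      have "card (i \<inter> j) dvd 3" using card_dvd[OF Esub(1)[OF ij(1)] I] Esub(2)[OF ij(1)] by simp
      moreover have "card (i \<inter> j) \<noteq> 3"
      proof
        assume c: "card (i \<inter> j) = 3"
        have "i \<inter> j = i" by (rule sub_eq_card[OF Int_lower1 Esub(1)[OF ij(1)]]) (simp add: c Esub(2)[OF ij(1)])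
        moreover have "i \<inter> j = j" by (rule sub_eq_card[OF Int_lower2 Esub(1)[OF ij(2)]]) (simp add: c Esub(2)[OF ij(2)])
        ultimately show False using ij(3) by simp
      qed
      moreover have "prime (3::nat)" by simp
      ultimately have "card (i \<inter> j) = 1" using prime_nat_iff by blast
      then obtain z where "i \<inter> j = {z}" using card_1_singletonE by blast
      then have "i \<inter> j = {\<one>}" using subgroup.one_closed[OF I] by simp
      then show "(i - {\<one>}) \<inter> (j - {\<one>}) = {}" by blast
    qed
  qed
  also have "\<dots> = (\<Sum>e\<in>E. 2)"
  proof (rule sum.cong[OF refl])
    show "card (e - {\<one>}) = 2" if e: "e \<in> E" for e
      using Esub(2)[OF e] subgroup.one_closed[OF Esub(1)[OF e]] fin_sub[OF Esub(1)[OF e]] by simp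
  qed
  finally have cD: "card D = 8" using E4 by simp
  have DH: "D \<subseteq> H" unfolding D_def using Esub(3) by blast
  have cHD: "card (H - D) = 4" using card_Diff_subset[OF finite_subset[OF DH fin_sub[OF H(1)]] DH] cD H(2) by simp
  have "V = H - D" if V: "subgroup V G" "card V = 4" "V \<subseteq> H" for V
  proof -
    have "V \<inter> e = {\<one>}" if e: "e \<in> E" for e
    proof (rule coprime_inter[OF V(1) Esub(1)[OF e]])
      show "coprime (card V) (card e)" unfolding V(2) Esub(2)[OF e] by (simp add: coprime_iff_gcd_eq_1 gcd_non_0_nat)
    qed
    then have "V \<inter> D = {}" unfolding D_def by blast
    then have "V \<subseteq> H - D" using V(3) by blast
    then show ?thesis using card_subset_eq[of "H - D" V] fin_sub[OF H(1)] V(2) cHD by simp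
  qed
  then show ?thesis by blast
qed

lemma order12_is_normalizer:
  assumes H: "subgroup H G" "card H = 12" and V: "subgroup V G" "card V = 4" "V \<subseteq> H"
  shows "H = Normalizer V"
proof -
  obtain D where D0: "\<forall>V. subgroup V G \<longrightarrow> card V = 4 \<longrightarrow> V \<subseteq> H \<longrightarrow> V = H - D"
    using order12_complement[OF H] by (elim exE)
  note D = D0[rule_format]
  have Vc: "V \<subseteq> carrier G" by (rule sub_carrier[OF V(1)])
  have HN: "H \<subseteq> Normalizer V"
  proof
    fix g assume g: "g \<in> H"
    have gc: "g \<in> carrier G" using g subgroup.mem_carrier[OF H(1)] by simp
    have "conjg g V = H - D"
      by (rule D[OF conjg_subgroup[OF gc V(1)] _ conjg_subset_self[OF H(1) g V(3)]]) (use card_conjg[OF gc Vc] V(2) in simp)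
    moreover have "V = H - D" by (rule D[OF V])
    ultimately show "g \<in> Normalizer V" unfolding Normalizer_def using gc by simp
  qed
  have NV: "subgroup (Normalizer V) G" by (rule Normalizer_subgroup[OF Vc])
  obtain t where t: "card (Normalizer V) = 12 * t" using card_dvd[OF NV H(1) HN] H(2) by auto
  have "12 * t dvd 12 * 5" using dvd60[OF NV] t by simp
  then have "t dvd 5" by (simp only: dvd_times_left_cancel_iff)
  moreover have "t \<noteq> 5" using Normalizer_proper[OF V(1)] V(2) t by simp
  moreover have "prime (5::nat)" by simp
  ultimately have "t = 1" using prime_nat_iff by blast
  then show ?thesis using sub_eq_card[OF HN NV] t H(2) by simp
qed

lemma order4_normalizer: assumes V: "subgroup V G" "card V = 4" shows "subgroup (Normalizer V) G" "card (Normalizer V) = 12"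
proof -
  show N: "subgroup (Normalizer V) G" by (rule Normalizer_subgroup[OF sub_carrier[OF V(1)]])
  obtain S where S: "subgroup S G" "card S = 12" using ex12 by blast
  obtain W where W: "subgroup W G" "W \<subseteq> S" "card W = 4" using prime_power_subgroup[of 2 S 2] S by auto
  obtain g where g: "g \<in> carrier G" "V = conjg g W"
    using syl_conj[OF _ subgroup_self syl2[OF W(1,3)] syl2[OF V]] by auto
  have "conjg g S = Normalizer V"
    by (rule order12_is_normalizer[OF conjg_subgroup[OF g(1) S(1)] _ V])
      (use g card_conjg[OF g(1) sub_carrier[OF S(1)]] S(2) conjg_mono[OF W(2)] in auto)
  then show "card (Normalizer V) = 12" using card_conjg[OF g(1) sub_carrier[OF S(1)]] S(2) by simp
qed

text \<open>
  Each subgroup of order 12 is the normalizer of its subgroup of order 4, so they are all conjugate.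
\<close>
lemma card_order12_subs: "card order12_subs = 5"
proof -
  obtain S where S: "subgroup S G" "card S = 12" using ex12 by blast
  have Sc: "S \<subseteq> carrier G" by (rule sub_carrier[OF S(1)])
  obtain W where W: "subgroup W G" "W \<subseteq> S" "card W = 4" using prime_power_subgroup[of 2 S 2] S by auto
  have "order12_subs = conj_class S"
  proof (intro equalityI subsetI)
    fix H assume "H \<in> order12_subs"
    then have H: "subgroup H G" "card H = 12" unfolding order12_subs_def by auto
    obtain V where V: "subgroup V G" "V \<subseteq> H" "card V = 4" using prime_power_subgroup[of 2 H 2] H by auto
    obtain g where g: "g \<in> carrier G" "V = conjg g W"
      using syl_conj[OF _ subgroup_self syl2[OF W(1,3)] syl2[OF V(1,3)]] by auto
    have "conjg g S = Normalizer V"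
      by (rule order12_is_normalizer[OF conjg_subgroup[OF g(1) S(1)] _ V(1,3)])
        (use g card_conjg[OF g(1) Sc] S(2) conjg_mono[OF W(2)] in auto)
    moreover have "H = Normalizer V" by (rule order12_is_normalizer[OF H V(1,3,2)])
    ultimately show "H \<in> conj_class S" unfolding conj_class_def using g(1) by blast
  next
    fix H assume "H \<in> conj_class S"
    then show "H \<in> order12_subs" unfolding order12_subs_def using conj_class_subgroup[OF S(1)] conj_class_card[OF Sc] S(2) by simp
  qed
  moreover have "card (conj_class S) = 5"
  proof -
    have NS: "subgroup (Normalizer S) G" by (rule Normalizer_subgroup[OF Sc])
    obtain t where t: "card (Normalizer S) = 12 * t" using card_dvd[OF NS S(1) subset_Normalizer[OF S(1)]] S(2) by auto
    have "12 * t dvd 12 * 5" using dvd60[OF NS] t by simp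
    then have "t dvd 5" by (simp only: dvd_times_left_cancel_iff)
    moreover have "t \<noteq> 5"
    proof
      assume "t = 5"
      then have "Normalizer S = carrier G" using whole[OF NS] t by simp
      then have "S \<lhd> G" using normal_iff_Normalizer[OF S(1)] by simp
      then show False using no_prime_index[of S 5] S(2) c60 by simp
    qed
    moreover have "prime (5::nat)" by simp
    ultimately have "t = 1" using prime_nat_iff by blast
    then show ?thesis using card_conj_class[OF Sc] t c60 by simp
  qed
  ultimately show ?thesis by simp
qed

text \<open>
  A subgroup \<open>W\<close> of order 3 in the normalizer permutes the three non-trivial elements of \<open>V\<close>. If it fixed one of them it would fix
  all, and \<open>V\<close> would normalize \<open>W\<close>, whose normalizer has order 6.
\<close>
lemma order4_fusion:
  assumes V: "subgroup V G" "card V = 4" and v: "v \<in> V" "v \<noteq> \<one>" and w: "w \<in> V" "w \<noteq> \<one>"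
  shows "\<exists>g\<in>carrier G. w = g \<otimes> v \<otimes> inv g"
proof -
  have Vc: "V \<subseteq> carrier G" by (rule sub_carrier[OF V(1)])
  note S = order4_normalizer[OF V]
  obtain W where W: "subgroup W G" "W \<subseteq> Normalizer V" "card W = 3" using prime_power_subgroup[of 3 "Normalizer V" 1] S by auto
  define E where "E = (\<lambda>v. {v}) ` (V - {\<one>})"
  have inj: "inj_on (\<lambda>v. {v}) (V - {\<one>})" by (rule inj_onI) simp
  have cE: "card E = 3" unfolding E_def using card_image[OF inj] V(2) subgroup.one_closed[OF V(1)] fin_sub[OF V(1)] by simp
  have Ec: "e \<subseteq> carrier G" if "e \<in> E" for e using that Vc unfolding E_def by auto
  have act: "acts G W E conjg"
  proof (rule acts_conjg[OF W(1) Ec])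
    show "conjg g e \<in> E" if g: "g \<in> W" and e: "e \<in> E" for g e
    proof -
      obtain u where u: "u \<in> V" "u \<noteq> \<one>" "e = {u}" using e unfolding E_def by blast
      have gc: "g \<in> carrier G" "conjg g V = V" using g W(2) NormalizerD by blast+
      have uc: "u \<in> carrier G" using u(1) Vc by blast
      have "g \<otimes> u \<otimes> inv g \<in> V" using gc(2) u(1) unfolding conjg_def by blast
      moreover have "g \<otimes> u \<otimes> inv g \<noteq> \<one>"
      proof
        assume "g \<otimes> u \<otimes> inv g = \<one>"
        then have "inv g \<otimes> (g \<otimes> u \<otimes> inv g) \<otimes> g = \<one>" using gc by simp
        moreover have "inv g \<otimes> (g \<otimes> u \<otimes> inv g) \<otimes> g = (inv g \<otimes> g) \<otimes> u \<otimes> (inv g \<otimes> g)"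
          using gc uc by (simp only: m_assoc m_closed inv_closed)
        ultimately show False using u(2) gc uc by simp
      qed
      moreover have "conjg g e = {g \<otimes> u \<otimes> inv g}" unfolding u(3) conjg_def by simp
      ultimately show ?thesis unfolding E_def by blast
    qed
  qed
  define F where "F = {e \<in> E. \<forall>g\<in>W. conjg g e = e}"
  have FE: "F \<subseteq> E" unfolding F_def by simp
  have "prime (3::nat)" by simp
  then have "card E mod 3 = card F mod 3" unfolding F_def by (rule p_group_fixed_points[OF act _, of 3 1]) (simp add: W)
  then have F3: "3 dvd card F" using cE by (simp add: mod_eq_0_iff_dvd)
  have "card F \<noteq> 3"
  proof
    assume "card F = 3"
    then have FE: "F = E" using card_subset_eq[OF actsD(3)[OF act] FE] cE by simp
    have com: "u \<otimes> g = g \<otimes> u" if u: "u \<in> V" and g: "g \<in> W" for u g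
    proof (cases "u = \<one>")
      case True then show ?thesis using g sub_carrier[OF W(1)] by auto
    next
      case False
      then have "{u} \<in> F" unfolding FE E_def using u by simp
      then have "g \<in> Normalizer {u}" unfolding F_def Normalizer_def using g sub_carrier[OF W(1)] by auto
      then show ?thesis using Normalizer_singleton[of u g] u Vc by auto
    qed
    have "V \<subseteq> Normalizer W"
    proof
      fix u assume u: "u \<in> V"
      have uc: "u \<in> carrier G" using u Vc by blast
      have "u \<otimes> g \<otimes> inv u = g" if "g \<in> W" for g
        using com[OF u that] uc subgroup.mem_carrier[OF W(1) that] by (simp add: m_assoc)
      then have "conjg u W = W" unfolding conjg_def by simp
      then show "u \<in> Normalizer W" unfolding Normalizer_def using uc by simp
    qed
    then have "card V dvd card (Normalizer W)" by (rule card_dvd[OF Normalizer_subgroup[OF sub_carrier[OF W(1)]] V(1)])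
    then show False using V(2) order3_normalizer[OF W(1,3)] by simp
  qed
  moreover have "card F \<le> 3" using card_mono[OF actsD(3)[OF act] FE] cE by simp
  ultimately have "card F = 0" using F3 by (auto elim!: dvdE)
  then have F0: "F = {}" using finite_subset[OF FE actsD(3)[OF act]] by simp
  have vE: "{v} \<in> E" "{w} \<in> E" unfolding E_def using v w by auto
  define O' where "O' = (\<lambda>g. conjg g {v}) ` W"
  have OE: "O' \<subseteq> E" unfolding O'_def using actsD(4)[OF act _ vE(1)] by blast
  have "card O' dvd 3" using orbit_stabilizer[OF act vE(1)] W(3) unfolding O'_def by (metis dvd_triv_left)
  moreover have "card O' \<noteq> 1"
  proof
    assume "card O' = 1"
    then obtain z where z: "O' = {z}" using card_1_singletonE by blast
    have "{v} \<in> O'" unfolding O'_def by (rule orbit_refl[OF act vE(1)])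
    then have zv: "z = {v}" using z by simp
    have "conjg g {v} = {v}" if "g \<in> W" for g
    proof -
      have "conjg g {v} \<in> O'" unfolding O'_def using that by (rule imageI)
      then show ?thesis using z zv by simp
    qed
    then have "{v} \<in> F" unfolding F_def using vE by simp
    then show False using F0 by simp
  qed
  ultimately have "card O' = 3" using \<open>prime 3\<close> prime_nat_iff by blast
  then have "O' = E" using card_subset_eq[OF actsD(3)[OF act] OE] cE by simp
  then obtain g where g: "g \<in> W" "{w} = conjg g {v}" using vE(2) unfolding O'_def by blast
  then have "w = g \<otimes> v \<otimes> inv g" unfolding conjg_def by simp
  then show ?thesis using g(1) sub_carrier[OF W(1)] by blast
qed

definition invol :: "'a \<Rightarrow> bool" where "invol h \<longleftrightarrow> h \<in> carrier G \<and> h \<noteq> \<one> \<and> h \<otimes> h = \<one>"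

lemma order2: assumes H: "subgroup H G" "card H = 2" shows "\<exists>h. invol h \<and> H = {\<one>, h}"
proof -
  have o: "\<one> \<in> H" by (rule subgroup.one_closed[OF H(1)])
  have "card (H - {\<one>}) = 1" using H(2) o fin_sub[OF H(1)] by simp
  then obtain h where h: "H - {\<one>} = {h}" using card_1_singletonE by blast
  then have hH: "h \<in> H" "h \<noteq> \<one>" by auto
  have hc: "h \<in> carrier G" using hH subgroup.mem_carrier[OF H(1)] by simp
  have "h [^] (2::nat) = \<one>" using ord_dvd_card[OF H(1) hH(1)] H(2) by simp
  then have "h \<otimes> h = \<one>" using hc by (simp add: numeral_2_eq_2)
  then have "invol h" unfolding invol_def using hc hH(2) by simp
  moreover have "H = {\<one>, h}" using h o by blast
  ultimately show ?thesis by blast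
qed

lemma even_invol: assumes H: "subgroup H G" "2 dvd card H" shows "\<exists>h\<in>H. invol h"
proof -
  obtain R where R: "subgroup R G" "R \<subseteq> H" "card R = 2" using prime_power_subgroup[of 2 H 1] H by auto
  then show ?thesis using order2[OF R(1,3)] by blast
qed

lemma invol_conj_in_order4: assumes h: "invol h" and V: "subgroup V G" "card V = 4"
  shows "\<exists>g\<in>carrier G. \<exists>v\<in>V. v \<noteq> \<one> \<and> h = g \<otimes> v \<otimes> inv g"
proof -
  have hc: "h \<in> carrier G" "h \<noteq> \<one>" "h [^] (2::nat) = \<one>" using h unfolding invol_def by (auto simp: numeral_2_eq_2)
  define R where "R = generate G {h}"
  have R: "subgroup R G" unfolding R_def by (rule gen_sub[OF hc(1)])
  have "ord h dvd 2" using hc pow_eq_id by simp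
  then have "card R dvd 2 ^ 1" unfolding R_def using generate_pow_card[OF hc(1)] by simp
  then obtain k where k: "card R = 2 ^ k" using divides_primepow_nat[OF two_is_prime_nat] by blast
  obtain g where g: "g \<in> carrier G" "R \<subseteq> conjg g V"
    using p_subgroup_conj[OF two_is_prime_nat subgroup_self R sub_carrier[OF R] k V(1) sub_carrier[OF V(1)]] V(2) c60 by auto
  have "h \<in> conjg g V" using g(2) gen_in unfolding R_def by blast
  then obtain v where v: "v \<in> V" "h = g \<otimes> v \<otimes> inv g" unfolding conjg_def by blast
  have "v \<noteq> \<one>" using v(2) hc(2) g(1) by auto
  then show ?thesis using v g(1) by blast
qed

lemma invol_conj: assumes h: "invol h" and k: "invol k" shows "\<exists>g\<in>carrier G. h = g \<otimes> k \<otimes> inv g"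
proof -
  obtain V where V: "subgroup V G" "card V = 4" using exists_sub by blast
  obtain a v where a: "a \<in> carrier G" "v \<in> V" "v \<noteq> \<one>" "h = a \<otimes> v \<otimes> inv a" using invol_conj_in_order4[OF h V] by blast
  obtain b w where b: "b \<in> carrier G" "w \<in> V" "w \<noteq> \<one>" "k = b \<otimes> w \<otimes> inv b" using invol_conj_in_order4[OF k V] by blast
  obtain c where c: "c \<in> carrier G" "v = c \<otimes> w \<otimes> inv c" using order4_fusion[OF V b(2,3) a(2,3)] by blast
  have wc: "w \<in> carrier G" using b(2) subgroup.mem_carrier[OF V(1)] by simp
  have "conjg (a \<otimes> c \<otimes> inv b) {k} = conjg (a \<otimes> c) (conjg (inv b) (conjg b {w}))"
    using conjg_mult[of "a \<otimes> c" "inv b" "conjg b {w}"] a(1) c(1) b wc unfolding b(4) by (simp add: conjg_def)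
  also have "\<dots> = conjg a (conjg c {w})" using conjg_inv(1)[OF b(1), of "{w}"] conjg_mult[OF a(1) c(1), of "{w}"] wc by simp
  also have "\<dots> = {h}" unfolding a(4) c(2) by (simp add: conjg_def)
  finally have "h = (a \<otimes> c \<otimes> inv b) \<otimes> k \<otimes> inv (a \<otimes> c \<otimes> inv b)" unfolding conjg_def by simp
  then show ?thesis using a(1) b(1) c(1) by blast
qed

text \<open>
  A subgroup of order 4 is elementary abelian, because its non-trivial elements are conjugate. So the centralizer of \<open>h\<close> has
  order divisible by 20 and is everything; but then all involutions are equal.
\<close>
lemma invol_not_central5:
  assumes h: "invol h" and C: "subgroup C G" "card C = 5" "C \<subseteq> Normalizer {h}" shows False
proof -
  have hc: "h \<in> carrier G" using h unfolding invol_def by simp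
  have N: "subgroup (Normalizer {h}) G" by (rule Normalizer_subgroup) (use hc in simp)
  obtain V0 where V0: "subgroup V0 G" "card V0 = 4" using exists_sub by blast
  obtain g v where g: "g \<in> carrier G" "v \<in> V0" "h = g \<otimes> v \<otimes> inv g" using invol_conj_in_order4[OF h V0] by blast
  define V where "V = conjg g V0"
  have V: "subgroup V G" "card V = 4" unfolding V_def
    using conjg_subgroup[OF g(1) V0(1)] card_conjg[OF g(1) sub_carrier[OF V0(1)]] V0(2) by auto
  have hV: "h \<in> V" unfolding V_def conjg_def using g by blast
  have hne: "h \<noteq> \<one>" "h \<otimes> h = \<one>" using h unfolding invol_def by auto
  have Vc: "u \<in> carrier G" if "u \<in> V" for u using that subgroup.mem_carrier[OF V(1)] by simp
  have sq: "u \<otimes> u = \<one>" if u: "u \<in> V" for u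
  proof (cases "u = \<one>")
    case False
    obtain k where k: "k \<in> carrier G" "u = k \<otimes> h \<otimes> inv k" using order4_fusion[OF V hV hne(1) u False] by blast
    have "u \<otimes> u = k \<otimes> h \<otimes> (inv k \<otimes> k) \<otimes> h \<otimes> inv k" unfolding k(2)
      using k(1) hc by (simp only: m_assoc m_closed inv_closed)
    also have "\<dots> = k \<otimes> (h \<otimes> h) \<otimes> inv k" using k(1) hc by (simp add: m_assoc)
    finally show ?thesis using hne(2) k(1) by simp
  qed simp
  have "V \<subseteq> Normalizer {h}"
  proof
    fix u assume u: "u \<in> V"
    have uc: "u \<in> carrier G" by (rule Vc[OF u])
    have i: "inv w = w" if "w \<in> V" for w using sq[OF that] Vc[OF that] by (metis inv_equality)
    have "u \<otimes> h = inv (u \<otimes> h)" using i[OF subgroup.m_closed[OF V(1) u hV]] by simp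
    also have "\<dots> = h \<otimes> u" using inv_mult_group[OF uc hc] i[OF u] i[OF hV] by simp
    finally show "u \<in> Normalizer {h}" using Normalizer_singleton[OF hc] uc by simp
  qed
  then have d4: "4 dvd card (Normalizer {h})" using card_dvd[OF N V(1)] V(2) by simp
  have "Normalizer {h} = carrier G"
  proof (rule ccontr)
    assume "Normalizer {h} \<noteq> carrier G"
    moreover have "5 dvd card (Normalizer {h})" using card_dvd[OF N C(1,3)] C(2) by simp
    ultimately show False using proper_order_dvd5(1)[OF N] d4 by auto
  qed
  then have cen: "u \<in> Normalizer {h}" if "u \<in> carrier G" for u using that by simp
  have "V \<subseteq> {\<one>, h}"
  proof
    fix u assume u: "u \<in> V"
    show "u \<in> {\<one>, h}"
    proof (cases "u = \<one>")
      case False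
      obtain k where k: "k \<in> carrier G" "u = k \<otimes> h \<otimes> inv k" using order4_fusion[OF V hV hne(1) u False] by blast
      have "k \<otimes> h = h \<otimes> k" using cen[OF k(1)] Normalizer_singleton[OF hc] by simp
      then have "u = h" using k hc by (simp add: m_assoc)
      then show ?thesis by simp
    qed simp
  qed
  then have "card V \<le> card {\<one>, h}" by (rule card_mono[rotated]) simp
  also have "\<dots> \<le> 2" by (simp add: card_insert_if)
  finally show False using V(2) by simp
qed

end

section \<open>The comaximal subgroup graph of the alternating group on five letters\<close>

context perfect60 begin

lemma dvd12: assumes H: "subgroup H G" "\<not> 5 dvd card H" shows "card H dvd 12"
proof -
  have "coprime 5 (card H)" using H(2) prime_imp_coprime_nat[of 5 "card H"] by simp
  then have "coprime (card H) 5" by (simp only: coprime_commute)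
  moreover have "card H dvd 12 * 5" using dvd60[OF H(1)] by simp
  ultimately show ?thesis by (simp only: coprime_dvd_mult_left_iff)
qed

text \<open>
  A factor may be replaced by a conjugate. Both orders are even and all involutions are conjugate, so the two factors can be
  arranged to meet non-trivially, although their orders force a trivial intersection.
\<close>
lemma no_six_ten:
  assumes H: "subgroup H G" "card H = 6" and K: "subgroup K G" "card K = 10" shows "H <#> K \<noteq> carrier G"
proof
  assume HK: "H <#> K = carrier G"
  obtain h where h: "h \<in> H" "invol h" using even_invol[OF H(1)] H(2) by auto
  obtain k where k: "k \<in> K" "invol k" using even_invol[OF K(1)] K(2) by auto
  obtain g where g: "g \<in> carrier G" "h = g \<otimes> k \<otimes> inv g" using invol_conj[OF h(2) k(2)] by blast
  have gK: "subgroup (conjg g K) G" by (rule conjg_subgroup[OF g(1) K(1)])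
  have "K <#> H = carrier G" by (rule set_mult_eq_carrier_commute[OF H(1) K(1) HK])
  then have "conjg g K <#> H = carrier G" by (rule prod_conjg[OF K(1) H(1) _ g(1)])
  then have "card (conjg g K) * card H = 60 * card (conjg g K \<inter> H)" using prod_card_iff[OF gK H(1)] c60 by simp
  then have "card (conjg g K \<inter> H) = 1" using card_conjg[OF g(1) sub_carrier[OF K(1)]] H(2) K(2) by simp
  then obtain z where z: "conjg g K \<inter> H = {z}" using card_1_singletonE by blast
  have "h \<in> conjg g K" unfolding conjg_def g(2) using k(1) by blast
  then have "h = z" using z h(1) by blast
  moreover have "\<one> = z" using z subgroup.one_closed[OF gK] subgroup.one_closed[OF H(1)] by blast
  ultimately show False using h(2) unfolding invol_def by simp
qed

lemma order12_subs_proper: "order12_subs \<subseteq> proper_nontriv" unfolding order12_subs_def proper_nontriv_def using c60 by auto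
lemma div5_subs_proper: "div5_subs \<subseteq> proper_nontriv" unfolding div5_subs_def proper_nontriv_def by auto
lemma order12_div5_disjoint: "order12_subs \<inter> div5_subs = {}" unfolding order12_subs_def div5_subs_def by auto

lemma order12_div5_prod: assumes H: "H \<in> order12_subs" and K: "K \<in> div5_subs" shows "H <#> K = carrier G"
proof -
  have Hs: "subgroup H G" "card H = 12" and Ks: "subgroup K G" "K \<noteq> carrier G" "5 dvd card K" using H K unfolding order12_subs_def div5_subs_def by auto
  obtain C where C: "subgroup C G" "card C = 5" "C \<subseteq> K" using proper_order_dvd5(2)[OF Ks] by blast
  have "H \<inter> C = {\<one>}" by (rule coprime_inter[OF Hs(1) C(1)]) (simp add: Hs(2) C(2) coprime_iff_gcd_eq_1 gcd_non_0_nat)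
  then have "H <#> C = carrier G" using prod_card_iff[OF Hs(1) C(1)] Hs(2) C(2) c60 by simp
  then have "C <#> H = carrier G" by (rule set_mult_eq_carrier_commute[OF Hs(1) C(1)])
  then have "K <#> H = carrier G" by (rule prod_mono[OF _ C(3) sub_carrier[OF Ks(1)] sub_carrier[OF Hs(1)]])
  then show ?thesis by (rule set_mult_eq_carrier_commute[OF Ks(1) Hs(1)])
qed

text \<open>
  Comparing orders leaves 6 and 12 for the other factor, and \<open>no_six_ten\<close> rules out 6.
\<close>
lemma prod_div5_cases:
  assumes H: "H \<in> proper_nontriv" and K: "K \<in> proper_nontriv" and HK: "H <#> K = carrier G" and K5: "5 dvd card K"
  shows "H \<in> order12_subs \<and> K \<in> div5_subs"
proof -
  have Hs: "subgroup H G" "H \<noteq> carrier G" and Ks: "subgroup K G" "K \<noteq> carrier G" using H K unfolding proper_nontriv_def by auto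
  have cK: "card K = 5 \<or> card K = 10" using proper_order_dvd5(1)[OF Ks K5] by simp
  have c: "card H * card K = 60 * card (H \<inter> K)" using HK prod_card_iff[OF Hs(1) Ks(1)] c60 by simp
  have d: "60 dvd card H * card K" unfolding c by simp
  have H5: "\<not> 5 dvd card H"
  proof
    assume "5 dvd card H"
    then have "card H = 5 \<or> card H = 10" using proper_order_dvd5(1)[OF Hs] by simp
    then show False using cK d by auto
  qed
  have "60 dvd card H * 10" using d cK by auto
  then have "6 dvd card H" by presburger
  then obtain t where t: "card H = 6 * t" by blast
  have "6 * t dvd 6 * 2" using dvd12[OF Hs(1) H5] t by simp
  then have "t dvd 2" by (simp only: dvd_times_left_cancel_iff)
  then have "t = 1 \<or> t = 2" using two_is_prime_nat prime_nat_iff by blast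
  then have "card H = 6 \<or> card H = 12" using t by auto
  moreover have "card H \<noteq> 6"
  proof
    assume H6: "card H = 6"
    then have "card K = 10" using d cK by auto
    then show False using no_six_ten[OF Hs(1) H6 Ks(1)] HK by simp
  qed
  ultimately show ?thesis unfolding order12_subs_def div5_subs_def using Hs Ks K5 by simp
qed

lemma edges: assumes H: "H \<in> proper_nontriv" and K: "K \<in> proper_nontriv"
  shows "H <#> K = carrier G \<longleftrightarrow> (H \<in> order12_subs \<and> K \<in> div5_subs) \<or> (H \<in> div5_subs \<and> K \<in> order12_subs)"
proof
  have Hs: "subgroup H G" and Ks: "subgroup K G" using H K unfolding proper_nontriv_def by auto
  assume HK: "H <#> K = carrier G"
  have "card H * card K = 60 * card (H \<inter> K)" using HK prod_card_iff[OF Hs Ks] c60 by simp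
  then have "5 dvd card H * card K" by simp
  moreover have "prime (5::nat)" by simp
  ultimately have "5 dvd card H \<or> 5 dvd card K" using prime_dvd_mult_iff by blast
  then show "(H \<in> order12_subs \<and> K \<in> div5_subs) \<or> (H \<in> div5_subs \<and> K \<in> order12_subs)"
  proof
    assume "5 dvd card K" then show ?thesis using prod_div5_cases[OF H K HK] by simp
  next
    assume "5 dvd card H" then show ?thesis using prod_div5_cases[OF K H set_mult_eq_carrier_commute[OF Hs Ks HK]] by simp
  qed
next
  have Hs: "subgroup H G" and Ks: "subgroup K G" using H K unfolding proper_nontriv_def by auto
  assume "(H \<in> order12_subs \<and> K \<in> div5_subs) \<or> (H \<in> div5_subs \<and> K \<in> order12_subs)"
  then show "H <#> K = carrier G"
    using order12_div5_prod[of H K] order12_div5_prod[of K H] set_mult_eq_carrier_commute[OF Ks Hs] by blast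
qed

definition isolated :: "'a set set" where "isolated = proper_nontriv - order12_subs - div5_subs"

text \<open>
  The product of \<open>C\<close> with a normalized \<open>H\<close> is the whole group, so that \<open>H\<close> has order 12, or has order 10, so that \<open>C\<close> centralizes an
  involution.
\<close>
lemma order5_moves_isolated:
  assumes C: "subgroup C G" "card C = 5" and H: "H \<in> isolated" shows "\<not> C \<subseteq> Normalizer H"
proof
  assume CN: "C \<subseteq> Normalizer H"
  have Hs: "subgroup H G" "H \<noteq> {\<one>}" "H \<noteq> carrier G" "H \<notin> order12_subs" "H \<notin> div5_subs" using H unfolding isolated_def proper_nontriv_def by auto
  have H5: "\<not> 5 dvd card H" using Hs unfolding div5_subs_def by simp
  have S: "subgroup (C <#> H) G" by (rule normalizing_mult_subgroup[OF C(1) Hs(1) CN])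
  have CI: "C \<inter> H = {\<one>}"
  proof (rule coprime_inter[OF C(1) Hs(1)])
    show "coprime (card C) (card H)" unfolding C(2) using H5 prime_imp_coprime_nat[of 5 "card H"] by simp
  qed
  have cS: "card (C <#> H) = 5 * card H"
    using set_mult_inter_card[OF C(1) Hs(1) fin_sub[OF C(1)] fin_sub[OF Hs(1)]] CI C(2) by simp
  show False
  proof (cases "C <#> H = carrier G")
    case True
    then have "card H = 12" using cS c60 by simp
    then show False using Hs unfolding order12_subs_def by simp
  next
    case False
    have "card (C <#> H) \<in> {5, 10}" by (rule proper_order_dvd5(1)[OF S False]) (simp add: cS)
    then have "card H = 1 \<or> card H = 2" using cS by auto
    then show False
    proof
      assume "card H = 1"
      then obtain z where "H = {z}" using card_1_singletonE by blast
      then show False using Hs(2) subgroup.one_closed[OF Hs(1)] by simp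
    next
      assume "card H = 2"
      then obtain h where h: "invol h" "H = {\<one>, h}" using order2[OF Hs(1)] by blast
      have hc: "h \<in> carrier G" "h \<noteq> \<one>" using h(1) unfolding invol_def by auto
      have "C \<subseteq> Normalizer {h}"
      proof
        fix c assume c: "c \<in> C"
        have cc: "c \<in> carrier G" using c subgroup.mem_carrier[OF C(1)] by simp
        have "conjg c H = H" using CN c NormalizerD(2) by blast
        then have "c \<otimes> h \<otimes> inv c \<in> {\<one>, h}" unfolding conjg_def h(2) by blast
        moreover have "c \<otimes> h \<otimes> inv c \<noteq> \<one>"
        proof
          assume "c \<otimes> h \<otimes> inv c = \<one>"
          then have "inv c \<otimes> (c \<otimes> h \<otimes> inv c) \<otimes> c = \<one>" using cc by simp
          moreover have "inv c \<otimes> (c \<otimes> h \<otimes> inv c) \<otimes> c = (inv c \<otimes> c) \<otimes> h \<otimes> (inv c \<otimes> c)"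
            using cc hc by (simp only: m_assoc m_closed inv_closed)
          ultimately show False using hc cc by simp
        qed
        ultimately have "conjg c {h} = {h}" unfolding conjg_def by simp
        then show "c \<in> Normalizer {h}" unfolding Normalizer_def using cc by simp
      qed
      then show False by (rule invol_not_central5[OF h(1) C])
    qed
  qed
qed

lemma isolated_conjg: assumes H: "H \<in> isolated" and g: "g \<in> carrier G" shows "conjg g H \<in> isolated"
proof -
  have Hs: "subgroup H G" "H \<noteq> {\<one>}" "H \<noteq> carrier G" "card H \<noteq> 12" "\<not> 5 dvd card H" 
    using H unfolding isolated_def proper_nontriv_def order12_subs_def div5_subs_def by auto
  have Hc: "H \<subseteq> carrier G" by (rule sub_carrier[OF Hs(1)])
  have c: "card (conjg g H) = card H" by (rule card_conjg[OF g Hc])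
  have "conjg g H \<noteq> {\<one>}"
  proof
    assume "conjg g H = {\<one>}"
    then have "card H = 1" using c by simp
    then obtain z where "H = {z}" using card_1_singletonE by blast
    then show False using Hs(2) subgroup.one_closed[OF Hs(1)] by simp
  qed
  moreover have "conjg g H \<noteq> carrier G"
  proof
    assume "conjg g H = carrier G"
    then have "card H = card (carrier G)" using c by simp
    then show False using Hs(3) sub_eq_card[OF Hc subgroup_self] by simp
  qed
  ultimately show ?thesis unfolding isolated_def proper_nontriv_def order12_subs_def div5_subs_def using conjg_subgroup[OF g Hs(1)] Hs c by simp
qed

lemma finite_isolated: "finite isolated"
  by (rule finite_subset[of _ "Pow (carrier G)"]) (use fin sub_carrier in \<open>auto simp: isolated_def proper_nontriv_def\<close>)

lemma invariant_isolated_dvd5: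
  assumes J: "J \<subseteq> isolated" and cl: "\<And>g H. g \<in> carrier G \<Longrightarrow> H \<in> J \<Longrightarrow> conjg g H \<in> J"
  shows "5 dvd card J"
proof -
  obtain C where C: "subgroup C G" "card C = 5" using exists_sub by blast
  have Jc: "H \<subseteq> carrier G" if "H \<in> J" for H using that J sub_carrier unfolding isolated_def proper_nontriv_def by blast
  have act: "acts G C J conjg"
    by (rule acts_conjg[OF C(1) Jc]) (use cl subgroup.mem_carrier[OF C(1)] in auto)
  have F0: "{e \<in> J. \<forall>g\<in>C. conjg g e = e} = {}"
  proof (rule ccontr)
    assume "{e \<in> J. \<forall>g\<in>C. conjg g e = e} \<noteq> {}"
    then obtain e where e: "e \<in> J" "\<forall>g\<in>C. conjg g e = e" by blast
    then have "C \<subseteq> Normalizer e" unfolding Normalizer_def using sub_carrier[OF C(1)] by blast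
    then show False using order5_moves_isolated[OF C] e(1) J by blast
  qed
  have "card J mod 5 = card {e \<in> J. \<forall>g\<in>C. conjg g e = e} mod 5"
    by (rule p_group_fixed_points[OF act _, of _ 1]) (simp_all add: C)
  then have "card J mod 5 = 0" unfolding F0 by simp
  then show ?thesis by (simp only: mod_eq_0_iff_dvd)
qed

text \<open>
  The subgroups of order 2, 3 and 4 are isolated. Each of the three families is a non-empty multiple of 5 in size, and the
  second one has size 1 modulo 3, hence at least 10.
\<close>
lemma bipartite_comax_order60: "bipartite_comax G order12_subs div5_subs"
proof
  show "order12_subs \<subseteq> proper_nontriv" by (rule order12_subs_proper)
  show "div5_subs \<subseteq> proper_nontriv" by (rule div5_subs_proper)
  show "order12_subs \<inter> div5_subs = {}" by (rule order12_div5_disjoint)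
  show "H <#> K = carrier G \<longleftrightarrow> (H \<in> order12_subs \<and> K \<in> div5_subs) \<or> (H \<in> div5_subs \<and> K \<in> order12_subs)" if "H \<in> proper_nontriv" "K \<in> proper_nontriv" for H K
    by (rule edges[OF that])
  show "card order12_subs = 5 \<and> card div5_subs = 12 \<or> card order12_subs = 12 \<and> card div5_subs = 5" using card_order12_subs card_div5_subs by simp
  show "5 dvd card (proper_nontriv - order12_subs - div5_subs)" 
  proof -
    have "5 dvd card isolated" by (rule invariant_isolated_dvd5[OF subset_refl]) (use isolated_conjg in simp)
    then show ?thesis unfolding isolated_def .
  qed
  define J where "J n = {H. subgroup H G \<and> card H = n}" for n :: nat
  have J: "J n \<subseteq> isolated" "5 dvd card (J n)" "J n \<noteq> {}" if n: "n \<in> {2,3,4}" for n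
  proof -
    show JI: "J n \<subseteq> isolated"
    proof
      fix H assume "H \<in> J n"
      then have H: "subgroup H G" "card H = n" unfolding J_def by auto
      have "H \<noteq> {\<one>}" using H n by auto
      moreover have "H \<noteq> carrier G" using H n c60 by auto
      moreover have "card H \<noteq> 12" "\<not> 5 dvd card H" using H n by auto
      ultimately show "H \<in> isolated" unfolding isolated_def proper_nontriv_def order12_subs_def div5_subs_def using H(1) by simp
    qed
    show "5 dvd card (J n)"
    proof (rule invariant_isolated_dvd5[OF JI])
      show "conjg g H \<in> J n" if "g \<in> carrier G" "H \<in> J n" for g H
        using that conjg_subgroup card_conjg sub_carrier unfolding J_def by simp
    qed
    show "J n \<noteq> {}" using n exists_sub unfolding J_def by auto
  qed
  have fJ: "finite (J n)" if "n \<in> {2,3,4}" for n using finite_subset[OF J(1)[OF that] finite_isolated] .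
  have J5: "5 \<le> card (J n)" if "n \<in> {2,3,4}" for n
  proof -
    have "card (J n) \<noteq> 0" using J(3)[OF that] fJ[OF that] by simp
    then show ?thesis using dvd_imp_le[OF J(2)[OF that]] by simp
  qed
  have J3: "10 \<le> card (J 3)"
  proof -
    obtain W where W: "subgroup W G" "card W = 3" using exists_sub by blast
    have "J 3 = conj_class W"
    proof (intro equalityI subsetI)
      fix K assume "K \<in> J 3"
      then have "sylow_subgroup 3 K (carrier G)" unfolding J_def using syl3 by simp
      then show "K \<in> conj_class W" using syl_conj[OF _ subgroup_self syl3[OF W]] unfolding conj_class_def by auto
    next
      fix K assume "K \<in> conj_class W"
      then show "K \<in> J 3" unfolding J_def using conj_class_subgroup[OF W(1)] conj_class_card[OF sub_carrier[OF W(1)]] W(2) by simp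
    qed
    then have "card (J 3) mod 3 = 1" using syl_conj_class_count[OF _ syl3[OF W]] by simp
    moreover have "5 dvd card (J 3)" "5 \<le> card (J 3)" using J(2) J5 by auto
    ultimately show ?thesis by presburger
  qed
  have "card (J 2 \<union> J 3 \<union> J 4) = card (J 2) + card (J 3) + card (J 4)"
  proof -
    have d: "J 2 \<inter> J 3 = {}" "(J 2 \<union> J 3) \<inter> J 4 = {}" unfolding J_def by auto
    show ?thesis using card_Un_disjoint[OF _ _ d(2)] card_Un_disjoint[OF _ _ d(1)] fJ by simp
  qed
  moreover have "card (J 2 \<union> J 3 \<union> J 4) \<le> card isolated"
    by (rule card_mono[OF finite_isolated]) (use J(1) in auto)
  moreover have "5 \<le> card (J 2)" "5 \<le> card (J 4)" using J5 by auto
  ultimately show "17 \<le> card (proper_nontriv - order12_subs - div5_subs)" using J3 unfolding isolated_def by linarith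
qed

end

text \<open>
  A normal subgroup of prime index \<open>p\<close> contains all elements of order prime to \<open>p\<close>. Hence it contains the 3-cycles if
  \<open>p\<close> is not 3, and it contains the double transpositions otherwise; a 3-cycle is a product of two of these. The
  3-cycles generate the group.
\<close>
lemma perfect60_alt5: "perfect60 (alt_group 5)"
proof -
  interpret A: group "alt_group 5" by (rule alt_group_is_group)
  have "fact 5 = (120::nat)" by (simp add: fact_numeral)
  then have c: "card (carrier (alt_group 5)) = 60" using alt_group_card_carrier[of 5] by simp
  have f: "finite (carrier (alt_group 5))" using c by (metis card.infinite zero_neq_numeral)
  interpret A: fin_group "alt_group 5" by unfold_locales (rule f)
  show ?thesis
  proof
    show "card (carrier (alt_group 5)) = 60" by (rule c)
    show False if N: "N \<lhd> alt_group 5" and p: "prime p" and Np: "card N * p = card (carrier (alt_group 5))" for N p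
    proof -
      have Ns: "subgroup N (alt_group 5)" using N normal_imp_subgroup by blast
      have pw: "z [^]\<^bsub>alt_group 5\<^esub> p \<in> N" if "z \<in> carrier (alt_group 5)" for z
        using A.index_pow_mem[OF N _ that, of p] Np by (simp add: mult.commute)
      have inv_in: "t \<in> N" if t: "t \<in> carrier (alt_group 5)" "t [^]\<^bsub>alt_group 5\<^esub> n = \<one>\<^bsub>alt_group 5\<^esub>" "coprime n p" for t and n :: nat
        by (rule A.pow_coprime_mem[OF Ns t(1) _ pw[OF t(1)] t(3)]) (use t(2) subgroup.one_closed[OF Ns] in simp)
      have "three_cycles 5 \<subseteq> N"
      proof
        fix c assume cc: "c \<in> three_cycles 5"
        have cA: "c \<in> carrier (alt_group 5)" using cc three_cycles_incl by blast
        obtain cs where cs: "c = cycle_of_list cs" "cycle cs" "length cs = 3" "set cs \<subseteq> {1..5}" using cc by blast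
        obtain x y z where xyz: "cs = [x, y, z]" using stupid_lemma[OF cs(3)] by blast
        have dis: "x \<noteq> y" "y \<noteq> z" "x \<noteq> z" "x \<in> {1..5}" "y \<in> {1..5}" "z \<in> {1..5}" using cs xyz by auto
        have ceq: "c = transpose x y \<circ> transpose y z" using cs(1) xyz by simp
        show "c \<in> N"
        proof (cases "p = 3")
          case False
          have "coprime 3 p" using primes_coprime[of 3 p] p False by simp
          moreover have "c [^]\<^bsub>alt_group 5\<^esub> (3::nat) = \<one>\<^bsub>alt_group 5\<^esub>"
          proof -
            have "c \<circ> (c \<circ> c) = id"
              unfolding ceq using dis(1-3) by (auto simp: fun_eq_iff transpose_def)
            then show ?thesis by (simp add: numeral_3_eq_3 alt_group_mult alt_group_one comp_assoc)
          qed
          ultimately show ?thesis using inv_in[OF cA, of 3] by simp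
        next
          case True
          have "card ({1..5} - {x, y, z}) = 2" using dis by (simp add: card_Diff_subset)
          then obtain d e where de: "{1..5} - {x, y, z} = {d, e}" "d \<noteq> e" by (auto simp: card_2_iff)
          have de': "d \<in> {1..5}" "e \<in> {1..5}" "d \<noteq> x" "d \<noteq> y" "d \<noteq> z" "e \<noteq> x" "e \<noteq> y" "e \<noteq> z"
          proof -
            have "d \<in> {1..5} - {x, y, z}" "e \<in> {1..5} - {x, y, z}" unfolding de(1) by simp_all
            then show "d \<in> {1..5}" "e \<in> {1..5}" "d \<noteq> x" "d \<noteq> y" "d \<noteq> z" "e \<noteq> x" "e \<noteq> y" "e \<noteq> z"
              by simp_all
          qed
          have cop: "coprime 2 p" using True by simp
          have tt: "transpose u v \<circ> transpose d e \<in> N" if uv: "u \<noteq> v" "u \<in> {1..5}" "v \<in> {1..5}" "d \<noteq> u" "d \<noteq> v" "e \<noteq> u" "e \<noteq> v" for u v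
          proof (rule inv_in[OF _ _ cop])
            have "transpose u v \<circ> transpose d e permutes {1..5}"
              by (rule permutes_compose[OF permutes_swap_id[OF de'(1,2)] permutes_swap_id[OF uv(2,3)]])
            moreover have "evenperm (transpose u v \<circ> transpose d e)"
              using uv(1) de(2) by (simp add: evenperm_comp permutation_swap_id evenperm_swap)
            ultimately show "transpose u v \<circ> transpose d e \<in> carrier (alt_group 5)" unfolding alt_group_carrier by simp
            have "(transpose u v \<circ> transpose d e) \<circ> (transpose u v \<circ> transpose d e) = id"
              using uv de(2) by (auto simp: fun_eq_iff transpose_def)
            then show "(transpose u v \<circ> transpose d e) [^]\<^bsub>alt_group 5\<^esub> (2::nat) = \<one>\<^bsub>alt_group 5\<^esub>"
              by (simp add: numeral_2_eq_2 alt_group_mult alt_group_one)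
          qed
          have "(transpose x y \<circ> transpose d e) \<circ> (transpose y z \<circ> transpose d e) \<in> N"
            using subgroup.m_closed[OF Ns tt[of x y] tt[of y z]] dis de' unfolding alt_group_mult by metis
          moreover have "(transpose x y \<circ> transpose d e) \<circ> (transpose y z \<circ> transpose d e) = c"
            unfolding ceq using dis de' de(2) by (auto simp: fun_eq_iff transpose_def)
          ultimately show ?thesis by simp
        qed
      qed
      then have "carrier (alt_group 5) \<subseteq> N"
        using A.generate_subgroup_incl[OF _ Ns] alt_group_carrier_as_three_cycles[of 5] by simp
      then have "N = carrier (alt_group 5)" using A.sub_carrier[OF Ns] by blast
      then show False using Np c prime_gt_1_nat[OF p] by simp
    qed
    show "\<exists>S. subgroup S (alt_group 5) \<and> card S = 12"
    proof -
      let ?S = "{f \<in> carrier (alt_group 5). f 5 = 5}"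
      have act: "acts (alt_group 5) (carrier (alt_group 5)) {1..5} (\<lambda>f i. f i)"
        unfolding acts_def
      proof (intro conjI ballI)
        show "g i \<in> {1..5}" if "g \<in> carrier (alt_group 5)" "i \<in> {1..5}" for g and i :: nat
          using that permutes_in_image[of g "{1..5}" i] unfolding alt_group_carrier by simp
      qed (use A.subgroup_self f in \<open>simp_all add: alt_group_one alt_group_mult\<close>)
      note in_orbit = A.actsD(4)[OF act]
      have idA: "id \<in> carrier (alt_group 5)" using A.one_closed unfolding alt_group_one .
      have "(\<lambda>f. f 5) ` carrier (alt_group 5) = {1..5}"
      proof (intro equalityI subsetI)
        fix i assume "i \<in> (\<lambda>f. f 5) ` carrier (alt_group 5)"
        then obtain g where g: "g \<in> carrier (alt_group 5)" "i = g 5" by blast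
        then show "i \<in> {1..5}" using in_orbit[OF g(1), of 5] by simp
      next
        fix i :: nat assume i: "i \<in> {1..5}"
        show "i \<in> (\<lambda>f. f 5) ` carrier (alt_group 5)"
        proof (cases "i = 5")
          case True
          then show ?thesis using imageI[OF idA, of "\<lambda>f. f 5"] by simp
        next
          case False
          \<comment> \<open>The 3-cycle on 5, \<open>i\<close> and an auxiliary point \<open>j\<close> moves 5 to \<open>i\<close>.\<close>
          define j :: nat where "j = (if i = 1 then 2 else 1)"
          have j: "j \<in> {1..5}" "j \<noteq> 5" "j \<noteq> i" unfolding j_def by auto
          have div5_subs: "transpose 5 j \<circ> transpose i 5 \<in> carrier (alt_group 5)"
          proof -
            have "transpose 5 j \<circ> transpose i 5 permutes {1..5}"
              by (rule permutes_compose[OF permutes_swap_id permutes_swap_id]) (use i j in auto)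
            moreover have "evenperm (transpose 5 j \<circ> transpose i 5)"
              using False j by (simp add: evenperm_comp permutation_swap_id evenperm_swap)
            ultimately show ?thesis unfolding alt_group_carrier by simp
          qed
          have "(transpose 5 j \<circ> transpose i 5) 5 = i" using j False by (simp add: transpose_def)
          then show ?thesis using div5_subs by (metis image_eqI)
        qed
      qed
      then have "5 * card ?S = 60" using A.orbit_stabilizer[OF act, of 5] c by simp
      moreover have "subgroup ?S (alt_group 5)"
      proof (rule A.subgroupI)
        show "?S \<subseteq> carrier (alt_group 5)" by blast
        have "id \<in> ?S" using idA by simp
        then show "?S \<noteq> {}" by blast
        fix a assume a: "a \<in> ?S"
        have "inv\<^bsub>alt_group 5\<^esub> a \<in> carrier (alt_group 5)" using a A.inv_closed by simp
        moreover have "(inv\<^bsub>alt_group 5\<^esub> a) 5 = 5"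
        proof -
          have "inv\<^bsub>alt_group 5\<^esub> a \<circ> a = id" using A.l_inv[of a] a by (simp add: alt_group_mult alt_group_one)
          then have "(inv\<^bsub>alt_group 5\<^esub> a \<circ> a) 5 = id 5" by (rule fun_cong)
          then show ?thesis using a by simp
        qed
        ultimately show "inv\<^bsub>alt_group 5\<^esub> a \<in> ?S" by simp
        fix b assume b: "b \<in> ?S"
        then show "a \<otimes>\<^bsub>alt_group 5\<^esub> b \<in> ?S" using a A.m_closed[of a b] by (simp add: alt_group_mult)
      qed
      ultimately show ?thesis by (intro exI[of _ ?S]) simp
    qed
  qed
qed

section \<open>Recovering the group from its graph\<close>

context bipartite_comax begin

lemma trivial_no_index:
  assumes "subgroup U G" "card U * n = card (carrier G)" shows "n \<notin> {2, 3, 4}"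
proof (rule no_small_index[OF one_is_normal _ assms(1) _ assms(2)])
  show "{\<one>} \<subseteq> U" using subgroup.one_closed[OF assms(1)] by simp
  show False if "N \<lhd> G" "{\<one>} \<subseteq> N" "prime p" "card N * p = card (carrier G)" for N p
    by (rule no_prime_index_normal[OF that(1,3,4)])
qed

text \<open>
  A maximal subgroup above a member of \<open>X\<close> is in \<open>X\<close> with all its conjugates.
\<close>
lemma index_five:
  assumes X5: "card X = 5"
  shows "\<exists>N. subgroup N G \<and> card (conj_class N) = 5 \<and> Normalizer N = N"
proof -
  have "X \<noteq> {}" "Y \<noteq> {}" using XY_card by auto
  then obtain H K where HK: "H \<in> X" "K \<in> Y" by blast
  have HV: "H \<in> proper_nontriv" and KV: "K \<in> proper_nontriv" using HK XV YV by auto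
  note Hd = proper_nontrivD[OF HV] and Kd = proper_nontrivD[OF KV]
  have prod: "H <#> K = carrier G" using edge[OF HV KV] HK by simp
  obtain N where N: "subgroup N G" "H \<subseteq> N" "N \<noteq> carrier G"
    "\<And>U. subgroup U G \<Longrightarrow> N \<subseteq> U \<Longrightarrow> U \<noteq> carrier G \<Longrightarrow> U = N"
    using exists_maximal[OF Hd(1,3)] by blast
  have Nc: "N \<subseteq> carrier G" by (rule sub_carrier[OF N(1)])
  have NK: "N <#> K = carrier G" by (rule prod_mono[OF prod N(2) Nc sub_carrier[OF Kd(1)]])
  have ClX: "conj_class N \<subseteq> X"
  proof
    fix e assume "e \<in> conj_class N"
    then obtain g where g: "g \<in> carrier G" "e = conjg g N" unfolding conj_class_def by blast
    have es: "subgroup e G" unfolding g(2) by (rule conjg_subgroup[OF g(1) N(1)])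
    have ce: "card e = card N" unfolding g(2) by (rule card_conjg[OF g(1) Nc])
    have "e \<in> proper_nontriv"
    proof (rule proper_nontrivI[OF es])
      show "e \<noteq> carrier G"
      proof
        assume "e = carrier G"
        then have "card N = card (carrier G)" using ce by simp
        then show False using N(3) sub_eq_card[OF Nc subgroup_self] by simp
      qed
      show "e \<noteq> {\<one>}"
      proof
        assume "e = {\<one>}"
        then have "card N = 1" using ce by simp
        then obtain z where "N = {z}" using card_1_singletonE by blast
        then have "N = {\<one>}" using subgroup.one_closed[OF N(1)] by simp
        then show False using Hd(2) N(2) subgroup.one_closed[OF Hd(1)] by blast
      qed
    qed
    moreover have "e <#> K = carrier G" unfolding g(2) by (rule prod_conjg[OF N(1) Kd(1) NK g(1)])
    ultimately show "e \<in> X" using edge[OF _ KV, of e] HK(2) XY_disj by blast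
  qed
  have NNs: "subgroup (Normalizer N) G" by (rule Normalizer_subgroup[OF Nc])
  have NN: "Normalizer N = N"
  proof (rule N(4)[OF NNs subset_Normalizer[OF N(1)]])
    show "Normalizer N \<noteq> carrier G"
    proof
      assume "Normalizer N = carrier G"
      then have n: "N \<lhd> G" using normal_iff_Normalizer[OF N(1)] by simp
      obtain p where "prime p" "card N * p = card (carrier G)"
        using normal_maximal_prime_index[OF n N(3,4)] by blast
      then show False using no_prime_index_normal[OF n] by blast
    qed
  qed
  have c: "card N * card (conj_class N) = card (carrier G)" using card_conj_class[OF Nc] NN by (simp add: mult.commute)
  have "card (conj_class N) \<le> 5" using card_mono[OF fin_XY(1) ClX] X5 by simp
  moreover have "card (conj_class N) \<notin> {2, 3, 4}" by (rule trivial_no_index[OF N(1) c])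
  moreover have "card (conj_class N) \<noteq> 1"
  proof
    assume "card (conj_class N) = 1"
    then have "card N = card (carrier G)" using c by simp
    then show False using N(3) sub_eq_card[OF Nc subgroup_self] by simp
  qed
  moreover have "card (conj_class N) \<noteq> 0" using c card_pos[OF subgroup_self] by (intro notI) simp
  ultimately have "card (conj_class N) = 5" by auto
  then show ?thesis using N(1) NN by blast
qed

text \<open>
  An odd permutation in the image would yield a normal subgroup of index 2. The image is transitive on the five conjugates, and
  the proper subgroups of $A_5$ of order 5 and 10 have normal subgroups of index 5 and 2.
\<close>
lemma hom_onto_alt5:
  assumes X5: "card X = 5"
  shows "\<exists>\<phi>. group_hom G (alt_group 5) \<phi> \<and> \<phi> ` carrier G = carrier (alt_group 5)"
proof -
  obtain N where N: "subgroup N G" "card (conj_class N) = 5" "Normalizer N = N" using index_five[OF X5] by blast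
  have Nc: "N \<subseteq> carrier G" by (rule sub_carrier[OF N(1)])
  have act: "acts G (carrier G) (conj_class N) conjg"
    by (rule acts_conjg[OF subgroup_self sub_carrier[OF conj_class_subgroup[OF N(1)]] conj_class_conjg[OF Nc]])
  obtain \<phi> \<beta> where b: "bij_betw \<beta> (conj_class N) {1..5}" and h: "\<phi> \<in> hom G (sym_group 5)"
    and c: "\<forall>g\<in>carrier G. \<forall>e\<in>conj_class N. \<phi> g (\<beta> e) = \<beta> (conjg g e)"
    using perm_rep[OF act N(2)] by (elim exE conjE)
  have gh: "group_hom G (sym_group 5) \<phi>"
    using h sym_group_is_group by (simp add: group_hom_def group_hom_axioms_def)
  interpret S: group_hom G "sym_group 5" \<phi> by (rule gh)
  \<comment> \<open>The kernel of the sign is normal of index 1 or 2.\<close>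
  have sgn: "group_hom G sign_img (sign \<circ> \<phi>)"
    using Group.hom_compose[OF h sign_is_hom[of 5]] sign_img_is_group by (simp add: group_hom_def group_hom_axioms_def)
  interpret Z: group_hom G sign_img "sign \<circ> \<phi>" by (rule sgn)
  have im: "(sign \<circ> \<phi>) ` carrier G \<subseteq> {-1, 1}"
    using Z.hom_closed unfolding sign_img_def by auto
  have cim: "card ((sign \<circ> \<phi>) ` carrier G) * card (kernel G sign_img (sign \<circ> \<phi>)) = card (carrier G)"
    by (rule hom_image_card[OF sgn])
  have "card ((sign \<circ> \<phi>) ` carrier G) \<le> card {-1, 1 :: int}" by (rule card_mono[OF _ im]) simp
  then have "card ((sign \<circ> \<phi>) ` carrier G) \<le> 2" by simp
  moreover have "card ((sign \<circ> \<phi>) ` carrier G) \<noteq> 0" using cim card_pos[OF subgroup_self] by (intro notI) simp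
  moreover have "card ((sign \<circ> \<phi>) ` carrier G) \<noteq> 2"
    using no_prime_index_normal[OF Z.normal_kernel two_is_prime_nat] cim by (auto simp: mult.commute)
  ultimately have "card ((sign \<circ> \<phi>) ` carrier G) = 1" by linarith
  then obtain s where s: "(sign \<circ> \<phi>) ` carrier G = {s}" using card_1_singletonE by blast
  have ev: "evenperm (\<phi> g)" if g: "g \<in> carrier G" for g
  proof -
    have "(sign \<circ> \<phi>) g = s" "(sign \<circ> \<phi>) \<one> = s" using s g by blast+
    moreover have "(sign \<circ> \<phi>) \<one> = 1" using Z.hom_one unfolding sign_img_def by simp
    ultimately have "sign (\<phi> g) = 1" by simp
    then show ?thesis by (simp add: sign_def split: if_splits)
  qed
  have hA: "\<phi> \<in> hom G (alt_group 5)"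
    unfolding hom_def
  proof (intro CollectI conjI ballI Pi_I)
    show "\<phi> x \<in> carrier (alt_group 5)" if "x \<in> carrier G" for x
      using S.hom_closed[OF that] ev[OF that] unfolding sym_group_carrier alt_group_carrier by simp
    show "\<phi> (x \<otimes> y) = \<phi> x \<otimes>\<^bsub>alt_group 5\<^esub> \<phi> y" if "x \<in> carrier G" "y \<in> carrier G" for x y
      using S.hom_mult[OF that] unfolding sym_group_mult alt_group_mult .
  qed
  have gA: "group_hom G (alt_group 5) \<phi>"
    using hA alt_group_is_group by (simp add: group_hom_def group_hom_axioms_def)
  interpret A: group_hom G "alt_group 5" \<phi> by (rule gA)
  interpret P: perfect60 "alt_group 5" by (rule perfect60_alt5)
  define K where "K = kernel G (alt_group 5) \<phi>"
  have Kn: "K \<lhd> G" unfolding K_def by (rule A.normal_kernel)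
  have Ks: "subgroup K G" using Kn normal_imp_subgroup by blast
  have KN: "K \<subseteq> N"
  proof
    fix g assume "g \<in> K"
    then have g: "g \<in> carrier G" "\<phi> g = id" unfolding K_def kernel_def alt_group_one by auto
    have NC: "N \<in> conj_class N" by (rule self_in_conj_class[OF Nc])
    have "\<beta> (conjg g N) = \<beta> N" using bspec[OF bspec[OF c g(1)] NC] g(2) by simp
    then have "conjg g N = N" by (rule inj_onD[OF bij_betw_imp_inj_on[OF b] _ conj_class_conjg[OF Nc NC g(1)] NC])
    then have "g \<in> Normalizer N" unfolding Normalizer_def using g(1) by simp
    then show "g \<in> N" unfolding N(3) .
  qed
  have cI: "card (\<phi> ` carrier G) * card K = card (carrier G)" unfolding K_def by (rule hom_image_card[OF gA])
  have "5 dvd card (\<phi> ` carrier G)"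
  proof -
    obtain t where t: "card N = card K * t" using card_dvd[OF N(1) Ks KN] by blast
    have "card (\<phi> ` carrier G) * card K = 5 * t * card K"
      using card_conj_class[OF Nc] N(2,3) t cI by (simp add: ac_simps)
    then have "card (\<phi> ` carrier G) = 5 * t" using card_pos[OF Ks] by simp
    then show ?thesis by simp
  qed
  moreover have Is: "subgroup (\<phi> ` carrier G) (alt_group 5)" by (rule A.img_is_subgroup)
  ultimately have pr: "\<phi> ` carrier G \<noteq> carrier (alt_group 5) \<Longrightarrow> card (\<phi> ` carrier G) \<in> {5, 10}"
    using P.proper_order_dvd5(1) by blast
  have "\<phi> ` carrier G = carrier (alt_group 5)"
  proof (rule ccontr)
    assume "\<phi> ` carrier G \<noteq> carrier (alt_group 5)"
    then have "card (\<phi> ` carrier G) = 5 \<or> card (\<phi> ` carrier G) = 10" using pr by simp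
    then show False
    proof
      assume "card (\<phi> ` carrier G) = 5"
      then have "card K * 5 = card (carrier G)" using cI by (simp add: mult.commute)
      then show False using no_prime_index_normal[OF Kn, of 5] by simp
    next
      assume i: "card (\<phi> ` carrier G) = 10"
      then have "card (carrier G) = 5 ^ 1 * card K * 2" using cI by simp
      then have d: "5 ^ 1 * card K dvd card (carrier G)" by (rule dvdI)
      have "prime (5::nat)" by simp
      from rel_prime_power_subgroup[OF this Kn d] obtain U where U: "subgroup U G" "card U = 5 ^ 1 * card K" by blast
      then show False using trivial_no_index[OF U(1), of 2] cI i by simp
    qed
  qed
  then show ?thesis using gA by blast
qed

end

text \<open>
  Preimages embed the subgroups of \<open>H\<close> into those of \<open>G\<close>. If the kernel is non-trivial, even the preimage of the trivial
  subgroup is a vertex, and \<open>G\<close> has more vertices than \<open>H\<close>.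
\<close>
lemma (in fin_group) hom_onto_same_count:
  assumes gh: "group_hom G H \<phi>" and surj: "\<phi> ` carrier G = carrier H"
    and nt: "carrier H \<noteq> {\<one>\<^bsub>H\<^esub>}" and eq: "card proper_nontriv = card (group.proper_nontriv H)"
  shows "G \<cong> H"
proof -
  interpret h: group_hom G H \<phi> by (rule gh)
  define pre where "pre S = {g \<in> carrier G. \<phi> g \<in> S}" for S
  have img: "\<phi> ` pre S = S" if S: "subgroup S H" for S
  proof (intro equalityI subsetI)
    fix s assume s: "s \<in> S"
    then have "s \<in> \<phi> ` carrier G" using subgroup.mem_carrier[OF S] surj by simp
    then obtain g where "g \<in> carrier G" "s = \<phi> g" by blast
    then show "s \<in> \<phi> ` pre S" using s unfolding pre_def by simp
  qed (auto simp: pre_def)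
  have pre_sub: "subgroup (pre S) G" if S: "subgroup S H" for S
  proof (rule subgroupI)
    show "pre S \<subseteq> carrier G" unfolding pre_def by blast
    show "pre S \<noteq> {}" unfolding pre_def using h.hom_one subgroup.one_closed[OF S] by force
    show "inv a \<in> pre S" if "a \<in> pre S" for a
      using that subgroup.m_inv_closed[OF S] unfolding pre_def by simp
    show "a \<otimes> b \<in> pre S" if "a \<in> pre S" "b \<in> pre S" for a b
      using that subgroup.m_closed[OF S] unfolding pre_def by simp
  qed
  have finV: "finite proper_nontriv" by (rule finite_subset[of _ "Pow (carrier G)"]) (use fin sub_carrier in \<open>auto simp: proper_nontriv_def\<close>)
  have ker: "kernel G H \<phi> = {\<one>}"
  proof (rule ccontr)
    assume k: "kernel G H \<phi> \<noteq> {\<one>}"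
    have kp: "kernel G H \<phi> = pre {\<one>\<^bsub>H\<^esub>}" unfolding pre_def kernel_def by simp
    define D where "D = insert {\<one>\<^bsub>H\<^esub>} (group.proper_nontriv H)"
    have D: "subgroup S H" "S \<noteq> carrier H" if "S \<in> D" for S
      using that nt h.H.triv_subgroup unfolding D_def h.H.proper_nontriv_def by auto
    have "inj_on pre D"
      by (rule inj_onI) (metis D(1) img)
    moreover have "pre ` D \<subseteq> proper_nontriv"
    proof
      fix z assume "z \<in> pre ` D"
      then obtain S where S: "S \<in> D" "z = pre S" by blast
      have Ss: "subgroup S H" by (rule D(1)[OF S(1)])
      have zs: "subgroup z G" unfolding S(2) by (rule pre_sub[OF Ss])
      have "kernel G H \<phi> \<subseteq> z" unfolding kp S(2) pre_def using subgroup.one_closed[OF Ss] by auto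
      moreover have "\<one> \<in> kernel G H \<phi>" unfolding kernel_def using h.hom_one by simp
      ultimately have "z \<noteq> {\<one>}" using k by blast
      moreover have "z \<noteq> carrier G" using img[OF Ss] surj D(2)[OF S(1)] S(2) by auto
      ultimately show "z \<in> proper_nontriv" unfolding proper_nontriv_def using zs by simp
    qed
    ultimately have "card D \<le> card proper_nontriv" using card_inj_on_le[OF _ _ finV] by blast
    moreover have "card D = Suc (card (group.proper_nontriv H))"
    proof -
      have "finite D" using finite_imageD[OF finite_subset[OF \<open>pre ` D \<subseteq> proper_nontriv\<close> finV] \<open>inj_on pre D\<close>] .
      then show ?thesis unfolding D_def h.H.proper_nontriv_def by simp
    qed
    ultimately show False using eq by simp
  qed
  then have "inj_on \<phi> (carrier G)" by (rule h.trivial_ker_imp_inj)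
  then have "\<phi> \<in> iso G H" unfolding iso_def bij_betw_def using h.homh surj by simp
  then show ?thesis unfolding is_iso_def by blast
qed

lemma pair_graph_imp_wf: assumes "pair_graph H" shows "pair_wf_digraph H"
proof -
  interpret pair_graph H by fact
  show ?thesis by (rule pair_wf_digraph_axioms)
qed

theorem theorem2p2:
  fixes G (structure)
  assumes "group G" and "finite (carrier G)"
    and "digraph_iso (with_proj (comaximal_subgroup_graph G))
                     (with_proj (comaximal_subgroup_graph (alt_group 5)))"
  shows "G \<cong> alt_group 5"
proof -
  interpret group G by (rule assms(1))
  interpret fin_group G by unfold_locales (rule assms(2))
  interpret P: perfect60 "alt_group 5" by (rule perfect60_alt5)
  let ?A = "alt_group 5"
  have "pair_wf_digraph (comaximal_subgroup_graph G)" "pair_wf_digraph (comaximal_subgroup_graph ?A)"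
    using pair_graph_comaximal_subgroup_graph[OF assms(1,2)]
      pair_graph_comaximal_subgroup_graph[OF P.is_group P.fin]
    by (auto intro: pair_graph_imp_wf)
  from assms(3)[unfolded digraph_iso_with_proj_iff[OF this]]
  obtain f where f: "bij_betw f (pverts (comaximal_subgroup_graph G)) (pverts (comaximal_subgroup_graph ?A))"
    and e: "\<forall>u\<in>pverts (comaximal_subgroup_graph G). \<forall>v\<in>pverts (comaximal_subgroup_graph G).
      (u, v) \<in> parcs (comaximal_subgroup_graph G) \<longleftrightarrow> (f u, f v) \<in> parcs (comaximal_subgroup_graph ?A)"
    by (elim exE conjE)
  have vG: "pverts (comaximal_subgroup_graph G) = proper_nontriv" "pverts (comaximal_subgroup_graph ?A) = P.proper_nontriv"
    unfolding comaximal_subgroup_graph_def proper_nontriv_def P.proper_nontriv_def by (simp_all add: Let_def)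
  have pG: "(u, v) \<in> parcs (comaximal_subgroup_graph G) \<longleftrightarrow> u \<in> proper_nontriv \<and> v \<in> proper_nontriv \<and> u \<noteq> v \<and> u <#> v = carrier G" for u v
    unfolding comaximal_subgroup_graph_def proper_nontriv_def by (simp add: Let_def)
  have pA: "(u, v) \<in> parcs (comaximal_subgroup_graph ?A) \<longleftrightarrow> u \<in> P.proper_nontriv \<and> v \<in> P.proper_nontriv \<and> u \<noteq> v \<and> u <#>\<^bsub>?A\<^esub> v = carrier ?A" for u v
    unfolding comaximal_subgroup_graph_def P.proper_nontriv_def by (simp add: Let_def)
  have fb: "bij_betw f proper_nontriv P.proper_nontriv" using f unfolding vG .
  have fV: "f u \<in> P.proper_nontriv" if "u \<in> proper_nontriv" for u using bspec[OF bij_betwE[OF fb] that] .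
  have cV: "card proper_nontriv = card P.proper_nontriv" by (rule bij_betw_same_card[OF fb])
  interpret bA: bipartite_comax ?A P.order12_subs P.div5_subs by (rule P.bipartite_comax_order60)
  define X where "X = {u \<in> proper_nontriv. f u \<in> P.order12_subs}"
  define Y where "Y = {u \<in> proper_nontriv. f u \<in> P.div5_subs}"
  have sel: "card {u \<in> proper_nontriv. f u \<in> Z} = card Z" if Z: "Z \<subseteq> P.proper_nontriv" for Z
  proof -
    have im: "f ` {u \<in> proper_nontriv. f u \<in> Z} = Z"
    proof (intro equalityI subsetI)
      fix z assume z: "z \<in> Z"
      then have "z \<in> f ` proper_nontriv" using bij_betw_imp_surj_on[OF fb] subsetD[OF Z] by simp
      then obtain u where "u \<in> proper_nontriv" "z = f u" by blast
      then show "z \<in> f ` {u \<in> proper_nontriv. f u \<in> Z}" using z by simp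
    qed auto
    have "inj_on f {u \<in> proper_nontriv. f u \<in> Z}" by (rule inj_on_subset[OF bij_betw_imp_inj_on[OF fb]]) simp
    then have "card (f ` {u \<in> proper_nontriv. f u \<in> Z}) = card {u \<in> proper_nontriv. f u \<in> Z}" by (rule card_image)
    then show ?thesis unfolding im by (rule sym)
  qed
  have cX: "card X = 5" unfolding X_def using sel[OF P.order12_subs_proper] P.card_order12_subs by simp
  have cY: "card Y = 12" unfolding Y_def using sel[OF P.div5_subs_proper] P.card_div5_subs by simp
  have VXY: "proper_nontriv - X - Y = {u \<in> proper_nontriv. f u \<in> P.proper_nontriv - P.order12_subs - P.div5_subs}" unfolding X_def Y_def using fV by auto
  have cI: "card (proper_nontriv - X - Y) = card (P.proper_nontriv - P.order12_subs - P.div5_subs)" unfolding VXY by (rule sel) (rule order_trans[OF Diff_subset Diff_subset])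
  have "bipartite_comax G X Y"
  proof
    show "X \<subseteq> proper_nontriv" "Y \<subseteq> proper_nontriv" unfolding X_def Y_def by auto
    show "X \<inter> Y = {}" unfolding X_def Y_def using P.order12_div5_disjoint by blast
    show "card X = 5 \<and> card Y = 12 \<or> card X = 12 \<and> card Y = 5" using cX cY by simp
    show "5 dvd card (proper_nontriv - X - Y)" unfolding cI by (rule bA.isolated_dvd)
    show "17 \<le> card (proper_nontriv - X - Y)" unfolding cI by (rule bA.isolated_ge)
    show "H <#> K = carrier G \<longleftrightarrow> (H \<in> X \<and> K \<in> Y) \<or> (H \<in> Y \<and> K \<in> X)" if HK: "H \<in> proper_nontriv" "K \<in> proper_nontriv" for H K
    proof -
      have self: "L <#>\<^bsub>G\<^esub> L \<noteq> carrier G" if L: "L \<in> proper_nontriv" for L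
      proof -
        have Ls: "subgroup L G" "L \<noteq> carrier G" using L unfolding proper_nontriv_def by auto
        have "L <#> L \<subseteq> L" unfolding set_mult_def using subgroup.m_closed[OF Ls(1)] by blast
        then show ?thesis using Ls(2) sub_carrier[OF Ls(1)] by auto
      qed
      have "H <#> K = carrier G \<longleftrightarrow> (H, K) \<in> parcs (comaximal_subgroup_graph G)"
        unfolding pG using HK self by auto
      also have "\<dots> \<longleftrightarrow> (f H, f K) \<in> parcs (comaximal_subgroup_graph ?A)" using e HK unfolding vG by blast
      also have "\<dots> \<longleftrightarrow> f H \<noteq> f K \<and> ((f H \<in> P.order12_subs \<and> f K \<in> P.div5_subs) \<or> (f H \<in> P.div5_subs \<and> f K \<in> P.order12_subs))"
        unfolding pA using fV[OF HK(1)] fV[OF HK(2)] bA.edge[OF fV[OF HK(1)] fV[OF HK(2)]] by simp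
      also have "\<dots> \<longleftrightarrow> (H \<in> X \<and> K \<in> Y) \<or> (H \<in> Y \<and> K \<in> X)"
        unfolding X_def Y_def using HK P.order12_div5_disjoint by auto
      finally show ?thesis .
    qed
  qed
  then interpret b: bipartite_comax G X Y .
  obtain \<phi> where \<phi>: "group_hom G ?A \<phi>" "\<phi> ` carrier G = carrier ?A" using b.hom_onto_alt5[OF cX] by blast
  have "carrier ?A \<noteq> {\<one>\<^bsub>?A\<^esub>}" using P.c60 by auto
  then show ?thesis by (rule hom_onto_same_count[OF \<phi> _ cV])
qed

end
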